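(* Let $k\ge 0$ be an integer and let $D\subseteq\mathbb{R}^n$ be a starlike and shape-regular Lipschitz domain (satisfying assumptions (A1) and (A2) recalled in the context), with $h=\mathrm{diam}(D)$. Let $u\in H^{k+1}(D)$. Then there exists a polynomial $\chi$ of total degree $k$ (i.e. at most $k$) such that $$|u-\chi|_{l,D}\le c\,(k+1)\,h^{k+1-l}\,|u|_{k+1,D},\qquad l=0,\dots,k.$$ The constant $c$ depends only on $n$, $D$ and the ratio $\mu(D)/\mu(S)$, where $\mu$ is Lebesgue measure and $S$ is the set of points with respect to which $D$ is starlike.
   Context: A Lipschitz domain $D\subseteq\mathbb{R}^n$ is called starlike if there is a point $\mathbf p$ in its interior such that the line segment $[\mathbf p,\mathbf x]$ is contained in $D$ for every $\mathbf x\in D$; then $D$ is said to be starlike with respect to $\mathbf p$. Let $S\subseteq D$ be the set of points with respect to which $D$ is starlike. Assumptions: (A1) $S$ has positive $n$-dimensional measure. (A2) With $\boldsymbol\nu$ the unit outward normal (existing almost everywhere on $\partial D$), there exist a constant $c_0>0$ and a point $\mathbf p\in S$ such that $(\mathbf x-\mathbf p)\cdot\boldsymbol\nu\ge c_0\,\mathrm{diam}(D)$ for almost all $\mathbf x\in\partial D$. Shape-regular means that the diameters of the inscribed and circumscribed balls of $D$ are commensurate (for the bounded sets considered here, which are typical finite element cells, this is implied by (A2)). $|v|_{l,D}$ is the seminorm of $H^l(D)$: $|v|_{l,D}^2=\sum_{|\alpha|=l}\|\partial^\alpha v\|_{L^2(D)}^2$ (so $|v|_{0,D}=\|v\|_{L^2(D)}$).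 *)

theory Defs
  imports "HOL-Analysis.Analysis"
begin

definition starlike_wrt :: "'a::real_normed_vector set \<Rightarrow> 'a \<Rightarrow> bool" where
  "starlike_wrt D p \<longleftrightarrow> p \<in> interior D \<and> (\<forall>x\<in>D. closed_segment p x \<subseteq> D)"

definition star_centres :: "'a::real_normed_vector set \<Rightarrow> 'a set" where
  "star_centres D = {p \<in> D. starlike_wrt D p}"

definition shape_regular :: "real \<Rightarrow> 'a::metric_space set \<Rightarrow> bool" where
  "shape_regular \<sigma> D \<longleftrightarrow>
     (\<exists>x r y R. 0 < r \<and> ball x r \<subseteq> D \<and> D \<subseteq> cball y R \<and> R \<le> \<sigma> * r)"

text \<open>
  Near the point \<open>x\<close>, the set \<open>D\<close> is the region strictly below the graph of \<open>\<phi>\<close> in the direction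
  of the unit vector \<open>e\<close>. Here \<open>\<phi>\<close> is a function on the hyperplane orthogonal to \<open>e\<close>, and
  \<open>y - (e \<bullet> y) *\<^sub>R e\<close> is the orthogonal projection of \<open>y\<close> onto it.
\<close>

definition lipschitz_chart :: "'a::euclidean_space set \<Rightarrow> 'a \<Rightarrow> 'a \<Rightarrow> ('a \<Rightarrow> real) \<Rightarrow> bool" where
  "lipschitz_chart D x e \<phi> \<longleftrightarrow>
     norm e = 1 \<and> (\<exists>L. L-lipschitz_on {y. e \<bullet> y = 0} \<phi>) \<and>
     (\<exists>U. open U \<and> x \<in> U \<and> D \<inter> U = {y \<in> U. e \<bullet> y < \<phi> (y - (e \<bullet> y) *\<^sub>R e)})"

definition lipschitz_domain :: "'a::euclidean_space set \<Rightarrow> bool" where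
  "lipschitz_domain D \<longleftrightarrow>
     open D \<and> connected D \<and> bounded D \<and> (\<forall>x\<in>frontier D. \<exists>e \<phi>. lipschitz_chart D x e \<phi>)"

text \<open>
  Where the boundary graph is differentiable, the outward normal is the normalised gradient of the
  function that is negative on the side of \<open>D\<close> in the chart. That gradient is never zero, since its
  component along \<open>e\<close> is 1.
\<close>

definition outward_unit_normal :: "'a::euclidean_space set \<Rightarrow> 'a \<Rightarrow> 'a \<Rightarrow> bool" where
  "outward_unit_normal D x \<nu> \<longleftrightarrow>
     (\<exists>e \<phi> g. lipschitz_chart D x e \<phi> \<and>
        GDERIV (\<lambda>y. e \<bullet> y - \<phi> (y - (e \<bullet> y) *\<^sub>R e)) x :> g \<and>
        \<nu> = g /\<^sub>R norm g)"

text \<open>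
  Hausdorff measure without the usual normalising factor, which does not affect null sets. The
  empty set is treated separately because \<open>0 ^ 0 = 1\<close>.
\<close>

definition hausdorff_pre_measure :: "nat \<Rightarrow> real \<Rightarrow> 'a::metric_space set \<Rightarrow> ennreal" where
  "hausdorff_pre_measure s \<delta> A =
     (INF E \<in> {E :: nat \<Rightarrow> 'a set.
                 A \<subseteq> (\<Union>i. E i) \<and> (\<forall>i. bounded (E i) \<and> diameter (E i) \<le> \<delta>)}.
        \<Sum>i. if E i = {} then 0 else ennreal (diameter (E i) ^ s))"

definition hausdorff_measure :: "nat \<Rightarrow> 'a::metric_space set \<Rightarrow> ennreal" where
  "hausdorff_measure s A = (SUP \<delta>\<in>{0<..}. hausdorff_pre_measure s \<delta> A)"

definition AE_boundary :: "'a::euclidean_space set \<Rightarrow> ('a \<Rightarrow> bool) \<Rightarrow> bool" where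
  "AE_boundary D P \<longleftrightarrow> hausdorff_measure (DIM('a) - 1) {x \<in> frontier D. \<not> P x} = 0"


type_synonym 'n multi_index = "'n \<Rightarrow> nat"

definition mi_order :: "'n::finite multi_index \<Rightarrow> nat" where
  "mi_order \<alpha> = (\<Sum>i\<in>UNIV. \<alpha> i)"

lemma finite_mi_order_le: "finite {\<alpha> :: 'n::finite multi_index. mi_order \<alpha> \<le> k}"
proof (rule finite_subset)
  show "{\<alpha> :: 'n multi_index. mi_order \<alpha> \<le> k} \<subseteq> PiE UNIV (\<lambda>_. {..k})"
  proof
    fix \<alpha> :: "'n multi_index"
    assume "\<alpha> \<in> {\<alpha>. mi_order \<alpha> \<le> k}"
    then have k: "sum \<alpha> UNIV \<le> k" by (simp add: mi_order_def)
    have "\<alpha> i \<le> k" for i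
    proof -
      have "\<alpha> i \<le> sum \<alpha> UNIV" by (rule member_le_sum) simp_all
      with k show ?thesis by linarith
    qed
    then show "\<alpha> \<in> PiE UNIV (\<lambda>_. {..k})" by (simp add: PiE_iff)
  qed
  show "finite (PiE (UNIV :: 'n set) (\<lambda>_. {..k}))"
    by (rule finite_PiE) simp_all
qed

lemma finite_mi_order_eq: "finite {\<alpha> :: 'n::finite multi_index. mi_order \<alpha> = k}"
  by (rule finite_subset[OF _ finite_mi_order_le[of k]]) auto

definition polynomial_of_degree_le :: "nat \<Rightarrow> (real^'n \<Rightarrow> real) \<Rightarrow> bool" where
  "polynomial_of_degree_le k p \<longleftrightarrow>
     (\<exists>a :: 'n multi_index \<Rightarrow> real.
        \<forall>x. p x = (\<Sum>\<alpha> | mi_order \<alpha> \<le> k. a \<alpha> * (\<Prod>i\<in>UNIV. (x $ i) ^ \<alpha> i)))"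

definition partial :: "'n \<Rightarrow> (real^'n \<Rightarrow> real) \<Rightarrow> real^'n \<Rightarrow> real" where
  "partial i f x = frechet_derivative f (at x) (axis i 1)"

definition iter_partial :: "'n list \<Rightarrow> (real^'n \<Rightarrow> real) \<Rightarrow> real^'n \<Rightarrow> real" where
  "iter_partial is f = foldr partial is f"

definition smooth :: "(real^'n \<Rightarrow> real) \<Rightarrow> bool" where
  "smooth f \<longleftrightarrow> (\<forall>is. iter_partial is f differentiable_on UNIV)"

text \<open>
  The index type carries no order, so an arbitrary order of differentiation is chosen. For smooth
  functions, to which this is applied only, the result does not depend on the choice.
\<close>

definition mi_partial :: "'n multi_index \<Rightarrow> (real^'n \<Rightarrow> real) \<Rightarrow> real^'n \<Rightarrow> real" where
  "mi_partial \<alpha> f = iter_partial (SOME is. \<forall>i. count_list is i = \<alpha> i) f"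

definition test_function :: "(real^'n) set \<Rightarrow> (real^'n \<Rightarrow> real) \<Rightarrow> bool" where
  "test_function D \<phi> \<longleftrightarrow>
     smooth \<phi> \<and> compact (closure {x. \<phi> x \<noteq> 0}) \<and> closure {x. \<phi> x \<noteq> 0} \<subseteq> D"


definition locally_integrable_on :: "('a::euclidean_space \<Rightarrow> real) \<Rightarrow> 'a set \<Rightarrow> bool" where
  "locally_integrable_on u D \<longleftrightarrow> (\<forall>K. compact K \<and> K \<subseteq> D \<longrightarrow> set_integrable lebesgue K u)"

definition weak_derivative ::
    "(real^'n) set \<Rightarrow> 'n::finite multi_index \<Rightarrow> (real^'n \<Rightarrow> real) \<Rightarrow> (real^'n \<Rightarrow> real) \<Rightarrow> bool" where
  "weak_derivative D \<alpha> u v \<longleftrightarrow>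
     locally_integrable_on u D \<and> locally_integrable_on v D \<and>
     (\<forall>\<phi>. test_function D \<phi> \<longrightarrow>
        (LINT x:D|lebesgue. u x * mi_partial \<alpha> \<phi> x) =
        (-1) ^ mi_order \<alpha> * (LINT x:D|lebesgue. v x * \<phi> x))"

definition in_L2 :: "'a::euclidean_space set \<Rightarrow> ('a \<Rightarrow> real) \<Rightarrow> bool" where
  "in_L2 D f \<longleftrightarrow>
     set_borel_measurable lebesgue D f \<and> set_integrable lebesgue D (\<lambda>x. (f x)\<^sup>2)"

definition L2_norm_on :: "'a::euclidean_space set \<Rightarrow> ('a \<Rightarrow> real) \<Rightarrow> real" where
  "L2_norm_on D f = sqrt (LINT x:D|lebesgue. (f x)\<^sup>2)"

definition in_Sobolev :: "nat \<Rightarrow> (real^'n) set \<Rightarrow> (real^'n \<Rightarrow> real) \<Rightarrow> bool" where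
  "in_Sobolev m D u \<longleftrightarrow>
     in_L2 D u \<and> (\<forall>\<alpha>. mi_order \<alpha> \<le> m \<longrightarrow> (\<exists>v. weak_derivative D \<alpha> u v \<and> in_L2 D v))"

text \<open>
  On an open set a weak derivative is unique up to a null set, so the choice of representative does
  not affect the seminorm. The seminorm is meaningful only for functions in the Sobolev space of
  order \<open>l\<close>.
\<close>

definition weak_partial ::
    "(real^'n) set \<Rightarrow> 'n::finite multi_index \<Rightarrow> (real^'n \<Rightarrow> real) \<Rightarrow> real^'n \<Rightarrow> real" where
  "weak_partial D \<alpha> u = (SOME v. weak_derivative D \<alpha> u v)"

definition Sobolev_seminorm :: "nat \<Rightarrow> (real^'n) set \<Rightarrow> (real^'n \<Rightarrow> real) \<Rightarrow> real" where
  "Sobolev_seminorm l D u =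
     sqrt (\<Sum>\<alpha> | mi_order \<alpha> = l. (L2_norm_on D (weak_partial D \<alpha> u))\<^sup>2)"

end

theory Submission
  imports Defs
begin

text \<open>
  The set \<open>S\<close> of star centres of \<open>D\<close> is convex, so positive measure gives it interior points and hence
  a box. Let \<open>\<psi>\<close> be a smooth density of mass one supported in that box. The polynomial \<open>\<chi>\<close> is the
  averaged Taylor polynomial: the Taylor polynomial of degree \<open>k\<close> of \<open>u\<close> at \<open>y\<close>, averaged over \<open>y\<close> with
  weight \<open>\<psi>\<close>. Its coefficients only involve integrals of weak derivatives of \<open>u\<close>, so it makes sense for
  every Sobolev function. Averaging commutes with differentiation, \<open>\<partial>\<^sup>\<beta>\<close> of the polynomial of \<open>u\<close> being the
  polynomial of lower degree of \<open>\<partial>\<^sup>\<beta>u\<close>. So the case \<open>l = 0\<close>, applied to every \<open>\<partial>\<^sup>\<beta>u\<close> with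
  \<open>|\<beta>| = l\<close> and with \<open>m = k + 1 - l\<close>, is all that is needed.

  For the case \<open>l = 0\<close>, pair with a bounded function \<open>\<phi>\<close> on \<open>D\<close> and look at
    \<open>F s = \<integral>\<integral> \<phi> x u ((1 - s) x + s y) \<psi> y dy dx\<close> for \<open>0 < s \<le> 1\<close>.
  The segment from \<open>x \<in> D\<close> to \<open>y \<in> S\<close> stays in \<open>D\<close>, so the substitution \<open>z = (1 - s) x + s y\<close> turns
  the inner integral into an integral of \<open>u z\<close> against a test function of \<open>z\<close>; all the
  dependence on \<open>s\<close> is now in that test function. Differentiating in \<open>s\<close> and using the
  definition of weak derivatives gives the \<open>j\<close>-th derivative of \<open>F\<close> as
    \<open>\<Sum>\<^sub>\<alpha> (j! / \<alpha>!) \<integral>\<integral> \<phi> x (\<partial>\<^sup>\<alpha>u) ((1 - s) x + s y) (y - x)\<^sup>\<alpha> \<psi> y dy dx\<close>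
  (\<open>F_has_derivative\<close>). No approximation of \<open>u\<close> by smooth functions occurs.
  As \<open>s\<close> tends to \<open>0\<close>, \<open>F s\<close> tends to \<open>\<integral> \<phi> u\<close> (\<open>J_tendsto\<close>), while the derivatives of \<open>F\<close> at \<open>s = 1\<close> make
  up the pairing of \<open>\<phi>\<close> with the averaged Taylor polynomial. Taylor's theorem for the function \<open>F\<close> of
  one real variable therefore bounds the pairing of \<open>\<phi>\<close> with the error by the derivative of order \<open>m\<close>
  (\<open>taylor_remainder_pairing\<close>).

  Up to a constant and the \<open>L\<^sup>2\<close> norm of \<open>\<phi>\<close>, that derivative is at most \<open>h\<^sup>m\<close> times the sum of the \<open>L\<^sup>2\<close> norms of the derivatives of order \<open>m\<close>,
  weighted with \<open>m! / \<alpha>!\<close>, because \<open>|y - x| \<le> h\<close> and because the kernel is bounded on \<open>L\<^sup>2\<close> uniformly in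
  \<open>s\<close>: its integral over \<open>z\<close> is one, and its integral over \<open>x\<close> is controlled by changing variables in
  \<open>x\<close> for \<open>s \<le> 1/2\<close> and by the bound of \<open>\<psi>\<close> for \<open>s \<ge> 1/2\<close> (\<open>K0_nn_integral_fst\<close>, \<open>J_bound\<close>). By duality the
  error itself is bounded in \<open>L\<^sup>2\<close> (\<open>taylor_remainder_L2\<close>). The factor \<open>1/m!\<close> of Taylor's theorem leaves
  the weights \<open>1/\<alpha>!\<close>, whose sum is at most \<open>exp n\<close>. The resulting constant is
  independent of \<open>k\<close> and \<open>l\<close>.

  Seminorms are defined through an arbitrary choice of weak derivative, so uniqueness of weak
  derivatives is needed too; it follows from the limit \<open>s \<rightarrow> 0\<close> above, applied in small balls.
\<close>

section \<open>Infinitely differentiable functions of one variable\<close>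

text \<open>
  Differentiability up to a finite order is what induction can handle: the product rule needs the
  statement for one order less for all products.
\<close>

primrec differentiable_times :: "nat \<Rightarrow> (real \<Rightarrow> real) \<Rightarrow> bool" where
  "differentiable_times 0 f \<longleftrightarrow> True"
| "differentiable_times (Suc n) f \<longleftrightarrow>
     (\<forall>x. (f has_real_derivative deriv f x) (at x)) \<and> differentiable_times n (deriv f)"

definition infinitely_differentiable :: "(real \<Rightarrow> real) \<Rightarrow> bool" where
  "infinitely_differentiable f \<longleftrightarrow> (\<forall>n. differentiable_times n f)"

lemma deriv_eqI: "(\<And>x. (f has_real_derivative f' x) (at x)) \<Longrightarrow> deriv f = f'"
  by (auto intro!: ext DERIV_imp_deriv)

lemma differentiable_times_SucI:
  assumes "\<And>x. (f has_real_derivative f' x) (at x)" "differentiable_times n f'"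
  shows "differentiable_times (Suc n) f"
  using assms deriv_eqI[OF assms(1)] by simp

lemma differentiable_times_SucD: "differentiable_times (Suc n) f \<Longrightarrow> differentiable_times n f"
  by (induction n arbitrary: f) auto

lemma differentiable_times_const: "differentiable_times n (\<lambda>x. c)"
proof (induction n arbitrary: c)
  case (Suc n)
  show ?case by (rule differentiable_times_SucI[OF DERIV_const Suc])
qed simp

lemma differentiable_times_add:
  "differentiable_times n f \<Longrightarrow> differentiable_times n g \<Longrightarrow> differentiable_times n (\<lambda>x. f x + g x)"
proof (induction n arbitrary: f g)
  case (Suc n)
  then show ?case
    by (intro differentiable_times_SucI[of _ "\<lambda>x. deriv f x + deriv g x"] DERIV_add) auto
qed simp

lemma differentiable_times_mult:
  "differentiable_times n f \<Longrightarrow> differentiable_times n g \<Longrightarrow> differentiable_times n (\<lambda>x. f x * g x)"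
proof (induction n arbitrary: f g)
  case (Suc n)
  have "differentiable_times n (\<lambda>x. deriv f x * g x + f x * deriv g x)"
    using Suc.prems differentiable_times_SucD[OF Suc.prems(1)] differentiable_times_SucD[OF Suc.prems(2)]
    by (intro differentiable_times_add Suc.IH) auto
  with Suc.prems show ?case
    by (intro differentiable_times_SucI[of _ "\<lambda>x. deriv f x * g x + f x * deriv g x"])
       (auto intro!: derivative_eq_intros)
qed simp

lemma differentiable_times_affine:
  "differentiable_times n f \<Longrightarrow> differentiable_times n (\<lambda>x. f (c * x + d))"
proof (induction n arbitrary: f)
  case (Suc n)
  have "differentiable_times n (\<lambda>x. c * deriv f (c * x + d))"
    using Suc by (intro differentiable_times_mult differentiable_times_const) auto
  moreover have "((\<lambda>x. f (c * x + d)) has_real_derivative c * deriv f (c * x + d)) (at x)" for x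
  proof -
    have "(f has_real_derivative deriv f (c * x + d)) (at (c * x + d))" using Suc.prems by auto
    then have "((\<lambda>x. f (c * x + d)) has_real_derivative deriv f (c * x + d) * c) (at x)"
      by (rule DERIV_chain2[where g = "\<lambda>x. c * x + d"]) (auto intro!: derivative_eq_intros)
    then show ?thesis by (simp add: mult.commute)
  qed
  ultimately show ?case by (intro differentiable_times_SucI)
qed simp

lemma differentiable_times_power: "differentiable_times n (\<lambda>x. x ^ m)"
proof (induction m)
  case (Suc m)
  have "differentiable_times n (\<lambda>x. x)"
  proof (cases n)
    case (Suc m)
    show ?thesis unfolding Suc
      by (rule differentiable_times_SucI[OF DERIV_ident differentiable_times_const])
  qed simp
  with Suc show ?case by (auto intro!: differentiable_times_mult)
qed (auto intro: differentiable_times_const)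

lemma infinitely_differentiable_const [intro]: "infinitely_differentiable (\<lambda>x. c)"
  and infinitely_differentiable_mult [intro]:
    "infinitely_differentiable f \<Longrightarrow> infinitely_differentiable g \<Longrightarrow> infinitely_differentiable (\<lambda>x. f x * g x)"
  and infinitely_differentiable_affine:
    "infinitely_differentiable f \<Longrightarrow> infinitely_differentiable (\<lambda>x. f (c * x + d))"
  and infinitely_differentiable_power [intro]: "infinitely_differentiable (\<lambda>x. x ^ m)"
  unfolding infinitely_differentiable_def
  by (simp_all add: differentiable_times_const differentiable_times_mult differentiable_times_affine
    differentiable_times_power)

lemma infinitely_differentiable_deriv [intro]:
  "infinitely_differentiable f \<Longrightarrow> infinitely_differentiable (deriv f)"
  unfolding infinitely_differentiable_def by (metis differentiable_times.simps(2))

lemma infinitely_differentiable_funpow_deriv [intro]: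
  "infinitely_differentiable f \<Longrightarrow> infinitely_differentiable ((deriv ^^ n) f)"
  by (induction n) auto

lemma infinitely_differentiable_has_derivative:
  "infinitely_differentiable f \<Longrightarrow> (f has_real_derivative deriv f x) (at x)"
  unfolding infinitely_differentiable_def by (metis differentiable_times.simps(2))

lemma infinitely_differentiable_continuous:
  "infinitely_differentiable f \<Longrightarrow> continuous_on A f"
  by (meson DERIV_isCont continuous_at_imp_continuous_on infinitely_differentiable_has_derivative)

text \<open>
  The derivatives of \<open>exp (- 1 / t)\<close> are again of the form \<open>p (1 / t) exp (- 1 / t)\<close> with a polynomial \<open>p\<close>,
  so this family is closed under differentiation, also at \<open>0\<close>.
\<close>

definition flat_exp :: "real poly \<Rightarrow> real \<Rightarrow> real" where
  "flat_exp p t = (if t > 0 then poly p (1 / t) * exp (- (1 / t)) else 0)"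

lemma tendsto_poly_times_exp_minus: "((\<lambda>y. poly p y * exp (- y)) \<longlongrightarrow> (0::real)) at_top"
proof -
  have "((\<lambda>y. \<Sum>i\<le>degree p. coeff p i * (y ^ i / exp y)) \<longlongrightarrow> (\<Sum>i\<le>degree p. coeff p i * 0)) at_top"
    by (intro tendsto_intros tendsto_power_div_exp_0)
  then show ?thesis
    by (simp add: poly_altdef sum_distrib_right exp_minus divide_inverse mult.assoc)
qed

lemma flat_exp_has_derivative:
  "(flat_exp p has_real_derivative flat_exp (pCons 0 (pCons 0 (p - pderiv p))) t) (at t)"
proof -
  consider "t > 0" | "t < 0" | "t = 0" by linarith
  then show ?thesis
  proof cases
    case 1
    have D: "((\<lambda>t. poly p (1 / t) * exp (- (1 / t))) has_real_derivative
        flat_exp (pCons 0 (pCons 0 (p - pderiv p))) t) (at t)"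
    proof -
      have inv: "((\<lambda>t. 1 / t) has_real_derivative - (1 / t\<^sup>2)) (at t)"
        using 1 by (auto intro!: derivative_eq_intros simp: power2_eq_square)
      have "((\<lambda>t. poly p (1 / t)) has_real_derivative poly (pderiv p) (1 / t) * - (1 / t\<^sup>2)) (at t)"
        by (rule DERIV_chain2[OF poly_DERIV inv])
      moreover have "((\<lambda>t. exp (- (1 / t))) has_real_derivative exp (- (1 / t)) * (1 / t\<^sup>2)) (at t)"
        using DERIV_fun_exp[OF DERIV_minus[OF inv]] by simp
      ultimately have "((\<lambda>t. poly p (1 / t) * exp (- (1 / t))) has_real_derivative
          poly (pderiv p) (1 / t) * - (1 / t\<^sup>2) * exp (- (1 / t)) +
          exp (- (1 / t)) * (1 / t\<^sup>2) * poly p (1 / t)) (at t)"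
        by (rule DERIV_mult)
      also have "poly (pderiv p) (1 / t) * - (1 / t\<^sup>2) * exp (- (1 / t)) +
          exp (- (1 / t)) * (1 / t\<^sup>2) * poly p (1 / t) = flat_exp (pCons 0 (pCons 0 (p - pderiv p))) t"
        using 1 by (simp add: flat_exp_def power2_eq_square algebra_simps)
      finally show ?thesis .
    qed
    have "\<forall>\<^sub>F s in nhds t. poly p (1 / s) * exp (- (1 / s)) = flat_exp p s"
      using eventually_nhds_in_open[of "{0<..}" t] 1
      by (auto elim!: eventually_mono simp: flat_exp_def)
    from DERIV_cong_ev[OF refl this refl] D show ?thesis by simp
  next
    case 2
    have ev: "\<forall>\<^sub>F s in nhds t. 0 = flat_exp p s"
      using eventually_nhds_in_open[of "{..<0}" t] 2
      by (auto elim!: eventually_mono simp: flat_exp_def)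
    have "((\<lambda>_. 0) has_real_derivative flat_exp (pCons 0 (pCons 0 (p - pderiv p))) t) (at t)"
      using 2 by (simp add: flat_exp_def)
    with DERIV_cong_ev[OF refl ev refl] show ?thesis by simp
  next
    case 3
    have "((\<lambda>h. poly (pCons 0 p) (inverse h) * exp (- inverse h)) \<longlongrightarrow> (0::real)) (at_right 0)"
      by (rule filterlim_compose[OF tendsto_poly_times_exp_minus filterlim_inverse_at_top_right])
    moreover have "\<forall>\<^sub>F h in at_right 0. poly (pCons 0 p) (inverse h) * exp (- inverse h)
        = (flat_exp p (0 + h) - flat_exp p 0) / h"
      using eventually_at_right_less[of "0 :: real"]
      by eventually_elim (simp add: flat_exp_def divide_inverse mult_ac)
    ultimately have right: "((\<lambda>h. (flat_exp p (0 + h) - flat_exp p 0) / h) \<longlongrightarrow> 0) (at_right 0)"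
      by (rule Lim_transform_eventually)
    have "\<forall>\<^sub>F h in at_left 0. 0 = (flat_exp p (0 + h) - flat_exp p 0) / h"
      by (simp add: eventually_at_filter flat_exp_def)
    then have left: "((\<lambda>h. (flat_exp p (0 + h) - flat_exp p 0) / h) \<longlongrightarrow> 0) (at_left 0)"
      by (rule Lim_transform_eventually[OF tendsto_const])
    from left right have "((\<lambda>h. (flat_exp p (0 + h) - flat_exp p 0) / h) \<longlongrightarrow> 0) (at 0)"
      by (rule filterlim_split_at)
    then show ?thesis using 3 by (simp add: DERIV_def flat_exp_def)
  qed
qed

lemma infinitely_differentiable_flat_exp [intro]: "infinitely_differentiable (flat_exp p)"
  unfolding infinitely_differentiable_def
proof
  fix n show "differentiable_times n (flat_exp p)"
  proof (induction n arbitrary: p)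
    case (Suc n)
    show ?case by (rule differentiable_times_SucI[OF flat_exp_has_derivative Suc])
  qed simp
qed

lemma exists_bump:
  fixes a b :: real
  obtains f where "infinitely_differentiable f" "\<And>t. f t \<ge> 0"
    "\<And>t. f t > 0 \<longleftrightarrow> t \<in> {a<..<b}"
proof
  let ?f = "\<lambda>t. flat_exp 1 (1 * t + - a) * flat_exp 1 ((- 1) * t + b)"
  show "infinitely_differentiable ?f" 
    by (intro infinitely_differentiable_mult infinitely_differentiable_affine infinitely_differentiable_flat_exp)
  show "?f t \<ge> 0" "?f t > 0 \<longleftrightarrow> t \<in> {a<..<b}" for t
    by (auto simp: flat_exp_def)
qed

section \<open>Tensor products as test functions\<close>

text \<open>
  Test functions that are products of functions of one coordinate suffice for the whole argument.
  Their partial derivatives act on one factor each, so iterated partial derivatives are explicit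
  and visibly independent of the order of differentiation.
\<close>

definition tensor :: "('n::finite \<Rightarrow> real \<Rightarrow> real) \<Rightarrow> real^'n \<Rightarrow> real" where
  "tensor \<eta> x = (\<Prod>i\<in>UNIV. \<eta> i (x $ i))"

lemma tensor_fun_upd: "tensor (\<eta>(i := f)) x = f (x $ i) * (\<Prod>j\<in>UNIV - {i}. \<eta> j (x $ j))"
proof -
  have "tensor (\<eta>(i := f)) x = f (x $ i) * (\<Prod>j\<in>UNIV - {i}. (\<eta>(i := f)) j (x $ j))"
    unfolding tensor_def by (subst prod.remove[of UNIV i]) auto
  also have "(\<Prod>j\<in>UNIV - {i}. (\<eta>(i := f)) j (x $ j)) = (\<Prod>j\<in>UNIV - {i}. \<eta> j (x $ j))"
    by (intro prod.cong) auto
  finally show ?thesis .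
qed

lemma has_derivative_tensor:
  assumes "\<And>i x. (\<eta> i has_real_derivative \<eta>' i x) (at x)"
  shows "(tensor \<eta> has_derivative (\<lambda>v. \<Sum>i\<in>UNIV. v $ i * tensor (\<eta>(i := \<eta>' i)) x)) (at x)"
proof -
  have "((\<lambda>y. \<eta> i (y $ i)) has_derivative (\<lambda>v. v $ i * \<eta>' i (x $ i))) (at x)" for i
    by (rule DERIV_compose_FDERIV[OF assms, of "\<lambda>y. y $ i" "\<lambda>v. v $ i"])
       (rule bounded_linear_imp_has_derivative[OF bounded_linear_vec_nth])
  then have "((\<lambda>y. \<Prod>i\<in>UNIV. \<eta> i (y $ i)) has_derivative
      (\<lambda>v. \<Sum>i\<in>UNIV. v $ i * \<eta>' i (x $ i) * (\<Prod>j\<in>UNIV - {i}. \<eta> j (x $ j)))) (at x)"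
    by (intro has_derivative_prod) auto
  moreover have "tensor \<eta> = (\<lambda>y. \<Prod>i\<in>UNIV. \<eta> i (y $ i))" by (simp add: tensor_def fun_eq_iff)
  ultimately show ?thesis unfolding tensor_fun_upd by (simp only: mult.assoc)
qed

lemma partial_eqI: "(f has_derivative f') (at x) \<Longrightarrow> partial i f x = f' (axis i 1)"
  unfolding partial_def using frechet_derivative_at[of f f' x] by metis

lemma partial_tensor:
  assumes "\<And>i. infinitely_differentiable (\<eta> i)"
  shows "partial i (tensor \<eta>) = tensor (\<eta>(i := deriv (\<eta> i)))"
proof
  fix x
  have "partial i (tensor \<eta>) x = (\<Sum>j\<in>UNIV. axis i 1 $ j * tensor (\<eta>(j := deriv (\<eta> j))) x)"
    by (rule partial_eqI, rule has_derivative_tensor)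
       (rule infinitely_differentiable_has_derivative[OF assms])
  also have "\<dots> = tensor (\<eta>(i := deriv (\<eta> i))) x"
    by (subst sum.remove[of UNIV i]) (auto simp: axis_def)
  finally show "partial i (tensor \<eta>) x = tensor (\<eta>(i := deriv (\<eta> i))) x" .
qed

lemma iter_partial_tensor:
  assumes "\<And>i. infinitely_differentiable (\<eta> i)"
  shows "iter_partial is (tensor \<eta>) = tensor (\<lambda>i. (deriv ^^ count_list is i) (\<eta> i))"
proof (induction "is")
  case (Cons j js)
  have "iter_partial (j # js) (tensor \<eta>) = partial j (tensor (\<lambda>i. (deriv ^^ count_list js i) (\<eta> i)))"
    using Cons by (simp add: iter_partial_def)
  also have "\<dots> = tensor ((\<lambda>i. (deriv ^^ count_list js i) (\<eta> i))(j := deriv ((deriv ^^ count_list js j) (\<eta> j))))"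
    by (rule partial_tensor) (auto intro: assms)
  also have "(\<lambda>i. (deriv ^^ count_list js i) (\<eta> i))(j := deriv ((deriv ^^ count_list js j) (\<eta> j)))
      = (\<lambda>i. (deriv ^^ count_list (j # js) i) (\<eta> i))"
    by auto
  finally show ?case .
qed (simp add: iter_partial_def)

lemma differentiable_tensor:
  assumes "\<And>i. infinitely_differentiable (\<eta> i)"
  shows "tensor \<eta> differentiable (at x)"
  unfolding differentiable_def
  by (rule exI, rule has_derivative_tensor, rule infinitely_differentiable_has_derivative, rule assms)

lemma smooth_tensor:
  assumes "\<And>i. infinitely_differentiable (\<eta> i)"
  shows "smooth (tensor \<eta>)"
  unfolding smooth_def iter_partial_tensor[OF assms]
  by (intro allI differentiable_at_imp_differentiable_on differentiable_tensor
      infinitely_differentiable_funpow_deriv assms)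

text \<open>
  The derivative \<open>mi_partial\<close> is taken along a chosen list of directions; this list exists.
\<close>

lemma exists_list_with_counts: "\<exists>is. \<forall>i. count_list is i = (\<alpha> :: 'n::finite multi_index) i"
proof -
  obtain xs where xs: "set xs = (UNIV :: 'n set)" "distinct xs"
    using finite_distinct_list[OF finite_class.finite_UNIV] by blast
  have rep: "count_list (replicate m x) i = (if x = i then m else 0)" for m i and x :: 'n
    by (induction m) auto
  have "distinct ys \<Longrightarrow> count_list (concat (map (\<lambda>i. replicate (\<alpha> i) i) ys)) i
      = (if i \<in> set ys then \<alpha> i else 0)" for ys i
    by (induction ys) (auto simp: rep)
  with xs show ?thesis by (metis UNIV_I)
qed

lemma mi_partial_tensor:
  assumes "\<And>i. infinitely_differentiable (\<eta> i)"
  shows "mi_partial \<alpha> (tensor \<eta>) = tensor (\<lambda>i. (deriv ^^ \<alpha> i) (\<eta> i))"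
  using someI_ex[OF exists_list_with_counts[of \<alpha>]]
  by (simp add: mi_partial_def iter_partial_tensor[OF assms])

lemma mi_order_list:
  assumes "\<forall>i. count_list is i = (\<alpha> :: 'n::finite multi_index) i"
  shows "mi_order \<alpha> = length is"
  using sum_count_set[of "is" UNIV] assms by (simp add: mi_order_def)

lemma closure_support_subset_cbox:
  assumes "\<And>i t. \<eta> i t \<noteq> 0 \<Longrightarrow> t \<in> {a $ i..b $ i}"
  shows "closure {x. tensor \<eta> x \<noteq> 0} \<subseteq> cbox a b"
  by (rule closure_minimal) (use assms in \<open>auto simp: tensor_def mem_box_cart\<close>)

lemma test_function_tensor:
  assumes "\<And>i. infinitely_differentiable (\<eta> i)"
    and "\<And>i t. \<eta> i t \<noteq> 0 \<Longrightarrow> t \<in> {a $ i..b $ i}" and "cbox a b \<subseteq> D"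
  shows "test_function D (tensor \<eta>)"
  unfolding test_function_def
  using smooth_tensor[OF assms(1)] closure_support_subset_cbox[OF assms(2)] assms(3)
  by (auto intro: bounded_subset[OF bounded_cbox] simp: compact_eq_bounded_closed)

section \<open>Differentiation under the integral sign\<close>

lemma integrable_times_bounded:
  fixes W K :: "'a \<Rightarrow> real"
  assumes "integrable M W" "K \<in> borel_measurable M" "\<And>p. W p \<noteq> 0 \<Longrightarrow> \<bar>K p\<bar> \<le> C"
  shows "integrable M (\<lambda>p. W p * K p)"
proof (rule Bochner_Integration.integrable_bound)
  show "integrable M (\<lambda>p. C * W p)" using assms(1) by simp
  show "(\<lambda>p. W p * K p) \<in> borel_measurable M" using assms(1,2) by measurable
  have "\<bar>W p * K p\<bar> \<le> \<bar>C * W p\<bar>" for p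
  proof (cases "W p = 0")
    case False
    with assms(3) have "\<bar>W p\<bar> * \<bar>K p\<bar> \<le> \<bar>W p\<bar> * \<bar>C\<bar>" by (intro mult_left_mono) force+
    then show ?thesis by (simp add: abs_mult mult.commute)
  qed simp
  then show "AE p in M. norm (W p * K p) \<le> norm (C * W p)" by simp
qed

text \<open>
  Dominated convergence for the difference quotients, which the mean value theorem bounds by the
  bound of \<open>K'\<close>. Bounds are asked for only where \<open>W\<close> does not vanish: the kernels below are bounded
  uniformly only for \<open>x\<close> in a bounded set.
\<close>

lemma has_real_derivative_integral:
  fixes W :: "'a \<Rightarrow> real" and K K' :: "real \<Rightarrow> 'a \<Rightarrow> real"
  assumes W: "integrable M W" and s: "s \<in> {a<..<b}"
    and K: "\<And>t. t \<in> {a<..<b} \<Longrightarrow> K t \<in> borel_measurable M"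
    and K': "K' s \<in> borel_measurable M"
    and deriv: "\<And>t p. t \<in> {a<..<b} \<Longrightarrow> ((\<lambda>t. K t p) has_real_derivative K' t p) (at t)"
    and bound: "\<And>t p. t \<in> {a<..<b} \<Longrightarrow> W p \<noteq> 0 \<Longrightarrow> \<bar>K t p\<bar> \<le> C"
      "\<And>t p. t \<in> {a<..<b} \<Longrightarrow> W p \<noteq> 0 \<Longrightarrow> \<bar>K' t p\<bar> \<le> C"
  shows "((\<lambda>t. \<integral>p. W p * K t p \<partial>M) has_real_derivative (\<integral>p. W p * K' s p \<partial>M)) (at s)"
proof -
  \<comment> \<open>Set to zero away from the interval, so that one bound serves for all members of a sequence.\<close>
  define Q where "Q y p = (if y \<in> {a<..<b} then W p * ((K y p - K s p) / (y - s)) else 0)" for y p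
  have Wm [measurable]: "W \<in> borel_measurable M" using W by auto
  have "(\<lambda>n. \<integral>p. Q (X n) p \<partial>M) \<longlonglongrightarrow> (\<integral>p. W p * K' s p \<partial>M)"
    if X: "\<And>i. X i \<noteq> s" "X \<longlonglongrightarrow> s" for X
  proof (rule integral_dominated_convergence)
    show "integrable M (\<lambda>p. \<bar>C * W p\<bar>)" using W by simp
    show "(\<lambda>p. W p * K' s p) \<in> borel_measurable M" using K' by measurable
    show "Q (X n) \<in> borel_measurable M" for n
    proof (cases "X n \<in> {a<..<b}")
      case True
      then show ?thesis using K[OF True] K[OF s] by (simp add: Q_def[abs_def])
    next
      case False
      then have "Q (X n) = (\<lambda>p. 0)" by (simp only: Q_def[abs_def] if_False)
      then show ?thesis by simp
    qed
    have "(\<lambda>n. Q (X n) p) \<longlonglongrightarrow> W p * K' s p" for p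
    proof (rule Lim_transform_eventually)
      have "((\<lambda>y. (K y p - K s p) / (y - s)) \<longlongrightarrow> K' s p) (at s)"
        using deriv[OF s, of p] by (simp add: has_field_derivative_iff)
      moreover have "filterlim X (at s) sequentially" using X by (simp add: filterlim_at)
      ultimately show "(\<lambda>n. W p * ((K (X n) p - K s p) / (X n - s))) \<longlonglongrightarrow> W p * K' s p"
        by (intro tendsto_mult tendsto_const) (rule filterlim_compose)
      have "\<forall>\<^sub>F n in sequentially. X n \<in> {a<..<b}"
        using X(2) s by (intro topological_tendstoD) auto
      then show "\<forall>\<^sub>F n in sequentially. W p * ((K (X n) p - K s p) / (X n - s)) = Q (X n) p"
        by eventually_elim (simp add: Q_def)
    qed
    then show "AE p in M. (\<lambda>n. Q (X n) p) \<longlonglongrightarrow> W p * K' s p" by simp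
    have "\<bar>Q (X n) p\<bar> \<le> \<bar>C * W p\<bar>" for n p
    proof (cases "X n \<in> {a<..<b} \<and> W p \<noteq> 0")
      case True
      have norm: "norm (K (X n) p - K s p) \<le> C * norm (X n - s)"
      proof (rule field_differentiable_bound[of "{a<..<b}" "\<lambda>t. K t p" "\<lambda>t. K' t p"])
        show "((\<lambda>t. K t p) has_real_derivative K' z p) (at z within {a<..<b})" if "z \<in> {a<..<b}" for z
          by (rule has_field_derivative_at_within[OF deriv[OF that]])
        show "norm (K' z p) \<le> C" if "z \<in> {a<..<b}" for z
          using bound(2)[OF that] True by simp
      qed (use True s in simp_all)
      have "\<bar>(K (X n) p - K s p) / (X n - s)\<bar> \<le> \<bar>C\<bar>"
      proof -
        have "norm (K (X n) p - K s p) \<le> \<bar>C\<bar> * norm (X n - s)"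
          using norm mult_right_mono[OF abs_ge_self[of C], of "norm (X n - s)"] by simp
        with X(1)[of n] show ?thesis by (simp add: abs_divide divide_le_eq)
      qed
      then have "\<bar>W p\<bar> * \<bar>(K (X n) p - K s p) / (X n - s)\<bar> \<le> \<bar>W p\<bar> * \<bar>C\<bar>"
        by (rule mult_left_mono) simp
      with True show ?thesis by (simp add: Q_def abs_mult mult.commute)
    qed (auto simp: Q_def)
    then show "AE p in M. norm (Q (X n) p) \<le> \<bar>C * W p\<bar>" for n by simp
  qed
  then have lim: "((\<lambda>y. \<integral>p. Q y p \<partial>M) \<longlongrightarrow> (\<integral>p. W p * K' s p \<partial>M)) (at s)"
    by (auto simp: tendsto_at_iff_sequentially comp_def)
  have int: "integrable M (\<lambda>p. W p * K t p)" if "t \<in> {a<..<b}" for t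
    using integrable_times_bounded[OF W K[OF that] bound(1)[OF that]] by simp
  have "\<forall>\<^sub>F y in at s. y \<in> {a<..<b}" using s by (intro eventually_at_in_open') auto
  then have "\<forall>\<^sub>F y in at s. (\<integral>p. Q y p \<partial>M) =
      ((\<integral>p. W p * K y p \<partial>M) - (\<integral>p. W p * K s p \<partial>M)) / (y - s)"
  proof eventually_elim
    case (elim y)
    have "(\<integral>p. Q y p \<partial>M) = (\<integral>p. (W p * K y p - W p * K s p) / (y - s) \<partial>M)"
      using elim by (intro Bochner_Integration.integral_cong) (auto simp: Q_def algebra_simps)
    also have "\<dots> = (\<integral>p. W p * K y p - W p * K s p \<partial>M) / (y - s)" by simp
    also have "(\<integral>p. W p * K y p - W p * K s p \<partial>M) = (\<integral>p. W p * K y p \<partial>M) - (\<integral>p. W p * K s p \<partial>M)"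
      using int[OF elim] int[OF s] by simp
    finally show ?case .
  qed
  from Lim_transform_eventually[OF lim this] show ?thesis by (simp add: has_field_derivative_iff)
qed

section \<open>Rescaled bump functions\<close>

text \<open>
  One factor of the Taylor kernel. With \<open>y = x + (z - x) / s\<close>, that is \<open>z = (1 - s) x + s y\<close>, it is
  \<open>(y - x)\<^sup>a / a!\<close> times \<open>f y\<close> times the Jacobian \<open>1 / s\<close> of the passage from \<open>y\<close> to \<open>z\<close>. The second function is its
  derivative in \<open>s\<close>.
\<close>

definition scaled_bump :: "(real \<Rightarrow> real) \<Rightarrow> real \<Rightarrow> real \<Rightarrow> nat \<Rightarrow> real \<Rightarrow> real" where
  "scaled_bump f x s a z = ((z - x) / s) ^ a / fact a * f (x + (z - x) / s) / s"

definition scaled_bump_ds :: "(real \<Rightarrow> real) \<Rightarrow> real \<Rightarrow> real \<Rightarrow> nat \<Rightarrow> real \<Rightarrow> real" where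
  "scaled_bump_ds f x s a z = - (((z - x) / s) ^ a / fact a *
     ((real a + 1) * f (x + (z - x) / s) + (z - x) / s * deriv f (x + (z - x) / s)) / s\<^sup>2)"

lemma infinitely_differentiable_scaled_bump:
  assumes "infinitely_differentiable f"
  shows "infinitely_differentiable (scaled_bump f x s a)"
proof -
  have "infinitely_differentiable (\<lambda>z. (1 / s * z + (- x / s)) ^ a * (f (1 / s * z + (x - x / s)) * (1 / (fact a * s))))"
    by (intro infinitely_differentiable_mult infinitely_differentiable_const
        infinitely_differentiable_affine[OF infinitely_differentiable_power]
        infinitely_differentiable_affine[OF assms])
  moreover have "(\<lambda>z. (1 / s * z + (- x / s)) ^ a * (f (1 / s * z + (x - x / s)) * (1 / (fact a * s))))
      = scaled_bump f x s a"
    by (auto simp: scaled_bump_def fun_eq_iff diff_divide_distrib algebra_simps)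
  ultimately show ?thesis by simp
qed

lemma scaled_bump_has_derivative:
  assumes "infinitely_differentiable f" "s > 0"
  shows "((\<lambda>s. scaled_bump f x s a z) has_real_derivative scaled_bump_ds f x s a z) (at s)"
proof -
  have t: "((\<lambda>s. (z - x) / s) has_real_derivative - ((z - x) / s / s)) (at s)"
    using assms(2) by (auto intro!: derivative_eq_intros simp: field_simps)
  have shift: "((\<lambda>s. x + (z - x) / s) has_real_derivative - ((z - x) / s / s)) (at s)"
    using DERIV_add[OF DERIV_const t, of x] by simp
  have f: "((\<lambda>s. f (x + (z - x) / s)) has_real_derivative
      deriv f (x + (z - x) / s) * - ((z - x) / s / s)) (at s)"
    by (rule DERIV_chain2[OF infinitely_differentiable_has_derivative[OF assms(1)]])
       (rule shift)
  have p: "((\<lambda>s. ((z - x) / s) ^ a) has_real_derivative - (real a * ((z - x) / s) ^ a / s)) (at s)"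
  proof (cases a)
    case (Suc k)
    show ?thesis unfolding Suc
      by (rule DERIV_cong[OF DERIV_power[OF t]]) (use assms(2) in \<open>simp add: field_simps\<close>)
  qed simp
  have i: "((\<lambda>s. 1 / s) has_real_derivative - (1 / s\<^sup>2)) (at s)"
    using assms(2) by (auto intro!: derivative_eq_intros simp: power2_eq_square)
  have "((\<lambda>s. ((z - x) / s) ^ a * (1 / fact a) * f (x + (z - x) / s) * (1 / s))
      has_real_derivative scaled_bump_ds f x s a z) (at s)"
    by (rule DERIV_cong[OF DERIV_mult[OF DERIV_mult[OF DERIV_mult[OF p DERIV_const] f] i]])
       (use assms(2) in \<open>simp add: scaled_bump_ds_def field_simps power2_eq_square\<close>)
  then show ?thesis by (simp add: scaled_bump_def)
qed

text \<open>
  This identity drives the proof: a derivative in \<open>s\<close> is minus a derivative in \<open>z\<close> of the factor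
  with one more power of \<open>y - x\<close>, and derivatives in \<open>z\<close> can be moved onto a function of \<open>z\<close>.
  It holds because \<open>g ((z - x) / s) / s\<close> has \<open>s\<close>-derivative \<open>- \<partial>\<^sub>z\<close> of \<open>t g t / s\<close> with \<open>t = (z - x) / s\<close>.
\<close>

lemma deriv_scaled_bump_Suc:
  assumes "infinitely_differentiable f" "s > 0"
  shows "(real a + 1) * deriv (scaled_bump f x s (Suc a)) z = - scaled_bump_ds f x s a z"
proof -
  have t: "((\<lambda>z. (z - x) / s) has_real_derivative 1 / s) (at z)"
    by (rule DERIV_cong[OF DERIV_cdivide[OF DERIV_diff[OF DERIV_ident DERIV_const]]]) simp
  have shift: "((\<lambda>z. x + (z - x) / s) has_real_derivative 1 / s) (at z)"
    using DERIV_add[OF DERIV_const t, of x] by simp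
  have f: "((\<lambda>z. f (x + (z - x) / s)) has_real_derivative deriv f (x + (z - x) / s) * (1 / s)) (at z)"
    by (rule DERIV_chain2[OF infinitely_differentiable_has_derivative[OF assms(1)]])
       (rule shift)
  have p: "((\<lambda>z. ((z - x) / s) ^ Suc a) has_real_derivative (real a + 1) * ((z - x) / s) ^ a / s) (at z)"
    by (rule DERIV_cong[OF DERIV_power[OF t]]) (simp add: field_simps)
  have "((\<lambda>z. ((z - x) / s) ^ Suc a * f (x + (z - x) / s) * (1 / (fact (Suc a) * s)))
      has_real_derivative - scaled_bump_ds f x s a z / (real a + 1)) (at z)"
    by (rule DERIV_cong[OF DERIV_mult[OF DERIV_mult[OF p f] DERIV_const]])
       (use assms(2) in \<open>simp add: scaled_bump_ds_def divide_simps power2_eq_square add_eq_0_iff\<close>, algebra)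
  moreover have "(\<lambda>z. ((z - x) / s) ^ Suc a * f (x + (z - x) / s) * (1 / (fact (Suc a) * s)))
      = scaled_bump f x s (Suc a)"
    by (simp add: scaled_bump_def fun_eq_iff)
  ultimately have "(scaled_bump f x s (Suc a) has_real_derivative - scaled_bump_ds f x s a z / (real a + 1)) (at z)"
    by simp
  then show ?thesis by (simp add: DERIV_imp_deriv)
qed

lemma bounded_of_compact_support:
  fixes f :: "real \<Rightarrow> real"
  assumes "continuous_on UNIV f" "\<And>t. f t \<noteq> 0 \<Longrightarrow> t \<in> {a..b}"
  obtains M where "M \<ge> 0" "\<And>t. \<bar>f t\<bar> \<le> M"
proof -
  have "bounded (f ` {a..b})"
    using assms(1) by (intro compact_imp_bounded compact_continuous_image) (auto intro: continuous_on_subset)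
  then obtain M where M: "\<And>t. t \<in> {a..b} \<Longrightarrow> \<bar>f t\<bar> \<le> M" 
    unfolding bounded_iff real_norm_def by blast
  show thesis
  proof (rule that[of "max M 0"])
    show "\<bar>f t\<bar> \<le> max M 0" for t using M[of t] assms(2)[of t] by (cases "f t = 0") auto
  qed simp
qed

lemma deriv_support:
  fixes f :: "real \<Rightarrow> real"
  assumes "\<And>t. f t \<noteq> 0 \<Longrightarrow> t \<in> {a..b}" "deriv f t \<noteq> 0"
  shows "t \<in> {a..b}"
proof (rule ccontr)
  assume t: "t \<notin> {a..b}"
  have "open (- {a..b})" by auto
  with t have "\<forall>\<^sub>F u in nhds t. u \<in> - {a..b}" by (intro eventually_nhds_in_open) auto
  then have "\<forall>\<^sub>F u in nhds t. 0 = f u"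
    by eventually_elim (use assms(1) in force)
  from DERIV_cong_ev[OF refl this refl, of 0] have "(f has_real_derivative 0) (at t)" by simp
  with assms(2) show False by (simp add: DERIV_imp_deriv)
qed

lemma scaled_bump_bounds:
  assumes f: "infinitely_differentiable f" and supp: "\<And>t. f t \<noteq> 0 \<Longrightarrow> t \<in> {a..b}" and s0: "s0 > 0"
  obtains C where "C \<ge> 0" "\<And>x s z. \<bar>x\<bar> \<le> R \<Longrightarrow> s > s0 \<Longrightarrow> \<bar>scaled_bump f x s n z\<bar> \<le> C"
    "\<And>x s z. \<bar>x\<bar> \<le> R \<Longrightarrow> s > s0 \<Longrightarrow> \<bar>scaled_bump_ds f x s n z\<bar> \<le> C"
proof -
  obtain M0 where M0: "M0 \<ge> 0" "\<And>t. \<bar>f t\<bar> \<le> M0"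
    using bounded_of_compact_support[OF infinitely_differentiable_continuous[OF f] supp] by blast
  obtain M1 where M1: "M1 \<ge> 0" "\<And>t. \<bar>deriv f t\<bar> \<le> M1"
    using bounded_of_compact_support[OF infinitely_differentiable_continuous[OF infinitely_differentiable_deriv[OF f]]
        deriv_support[of f, OF supp]] by blast
  define H where "H = \<bar>R\<bar> + \<bar>a\<bar> + \<bar>b\<bar>"
  define C0 where "C0 = H ^ n / fact n * M0 / s0"
  define C1 where "C1 = H ^ n / fact n * ((real n + 1) * M0 + H * M1) / s0\<^sup>2"
  have H0: "H \<ge> 0" by (simp add: H_def)
  have C: "C0 \<ge> 0" "C1 \<ge> 0" using H0 M0 M1 s0 by (auto simp: C0_def C1_def)
  have "\<bar>scaled_bump f x s n z\<bar> \<le> C0 \<and> \<bar>scaled_bump_ds f x s n z\<bar> \<le> C1"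
    if x: "\<bar>x\<bar> \<le> R" and s: "s > s0" for x s z
  proof -
    define t where "t = (z - x) / s"
    have s2: "s0\<^sup>2 \<le> s\<^sup>2" using s s0 by (intro power_mono) auto
    show ?thesis
    proof (cases "x + t \<in> {a..b}")
      case True
      then have t: "\<bar>t\<bar> \<le> H" using x by (auto simp: H_def)
      then have tn: "\<bar>t\<bar> ^ n \<le> H ^ n" by (intro power_mono) auto
      have "\<bar>scaled_bump f x s n z\<bar> = \<bar>t\<bar> ^ n / fact n * \<bar>f (x + t)\<bar> / s"
        using s s0 by (simp add: scaled_bump_def t_def abs_mult power_abs abs_divide)
      also have "\<dots> \<le> C0" unfolding C0_def
        using s s0 tn M0 H0 by (intro frac_le mult_mono divide_right_mono) auto
      finally have 1: "\<bar>scaled_bump f x s n z\<bar> \<le> C0" .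
      have "\<bar>(real n + 1) * f (x + t) + t * deriv f (x + t)\<bar> \<le>
          \<bar>(real n + 1) * f (x + t)\<bar> + \<bar>t * deriv f (x + t)\<bar>" by (rule abs_triangle_ineq)
      also have "\<dots> \<le> (real n + 1) * M0 + H * M1"
        unfolding abs_mult using M0 M1 t H0 by (intro add_mono mult_mono) auto
      finally have b: "\<bar>(real n + 1) * f (x + t) + t * deriv f (x + t)\<bar> \<le> (real n + 1) * M0 + H * M1" .
      have "\<bar>scaled_bump_ds f x s n z\<bar> =
          \<bar>t\<bar> ^ n / fact n * \<bar>(real n + 1) * f (x + t) + t * deriv f (x + t)\<bar> / s\<^sup>2"
        using s s0 by (simp add: scaled_bump_ds_def t_def abs_mult power_abs abs_divide)
      also have "\<dots> \<le> C1" unfolding C1_def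
        using s2 s0 tn b H0 M0 M1 by (intro frac_le mult_mono divide_right_mono) auto
      finally show ?thesis using 1 by simp
    next
      case False
      then have "f (x + t) = 0" "deriv f (x + t) = 0" using supp deriv_support[of f, OF supp] by blast+
      then show ?thesis using C by (simp add: scaled_bump_def scaled_bump_ds_def t_def)
    qed
  qed
  note B = this
  show thesis
  proof (rule that[of "C0 + C1"])
    fix x s z assume "\<bar>x\<bar> \<le> R" "s > s0"
    with B[of x s z] C show "\<bar>scaled_bump f x s n z\<bar> \<le> C0 + C1" "\<bar>scaled_bump_ds f x s n z\<bar> \<le> C0 + C1"
      by linarith+
  qed (use C in simp)
qed

section \<open>Multi-indices and weak jets\<close>

definition mi_inc :: "'n \<Rightarrow> 'n::finite multi_index \<Rightarrow> 'n multi_index" where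
  "mi_inc i \<alpha> = \<alpha>(i := Suc (\<alpha> i))"

abbreviation mi_fact :: "'n::finite multi_index \<Rightarrow> real" where
  "mi_fact \<alpha> \<equiv> \<Prod>i\<in>UNIV. fact (\<alpha> i)"

lemma mi_order_inc [simp]: "mi_order (mi_inc i \<alpha>) = Suc (mi_order \<alpha>)"
  unfolding mi_order_def mi_inc_def
  by (subst (1 2) sum.remove[of UNIV i]) (auto intro!: sum.cong)

text \<open>
  Each \<open>\<beta>\<close> of order \<open>j + 1\<close> arises from \<open>\<alpha> = \<beta> - e\<^sub>i\<close> with factor \<open>\<alpha>\<^sub>i + 1 = \<beta>\<^sub>i\<close>, and the \<open>\<beta>\<^sub>i\<close> add up to \<open>j + 1\<close>.
  Indices with \<open>\<beta>\<^sub>i = 0\<close> contribute nothing.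
\<close>

lemma sum_mi_inc:
  fixes g :: "'n::finite multi_index \<Rightarrow> real"
  shows "(\<Sum>\<alpha> | mi_order \<alpha> = j. \<Sum>i\<in>UNIV. (real (\<alpha> i) + 1) * g (mi_inc i \<alpha>))
    = (real j + 1) * (\<Sum>\<beta> | mi_order \<beta> = Suc j. g \<beta>)"
proof -
  let ?A = "{\<alpha> :: 'n multi_index. mi_order \<alpha> = j}" and ?B = "{\<alpha> :: 'n multi_index. mi_order \<alpha> = Suc j}"
  have fin: "finite ?A" "finite ?B" by (rule finite_mi_order_eq)+
  have dec: "mi_order (\<beta>(i := \<beta> i - 1)) = j" if "mi_order \<beta> = Suc j" "\<beta> i > 0" for \<beta> :: "'n multi_index" and i
  proof -
    have "mi_inc i (\<beta>(i := \<beta> i - 1)) = \<beta>" using that(2) by (auto simp: mi_inc_def)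
    then have "Suc (mi_order (\<beta>(i := \<beta> i - 1))) = Suc j" using that(1) by (metis mi_order_inc)
    then show ?thesis by simp
  qed
  have "(\<Sum>\<alpha>\<in>?A. \<Sum>i\<in>UNIV. (real (\<alpha> i) + 1) * g (mi_inc i \<alpha>))
      = (\<Sum>(\<alpha>, i)\<in>?A \<times> UNIV. (real (\<alpha> i) + 1) * g (mi_inc i \<alpha>))"
    by (rule sum.cartesian_product)
  also have "\<dots> = (\<Sum>(\<beta>, i)\<in>{(\<beta>, i). mi_order \<beta> = Suc j \<and> \<beta> i > 0}. real (\<beta> i) * g \<beta>)"
    by (rule sum.reindex_bij_witness[of _ "\<lambda>(\<beta>, i). (\<beta>(i := \<beta> i - 1), i)" "\<lambda>(\<alpha>, i). (mi_inc i \<alpha>, i)"])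
       (auto simp: mi_inc_def dec[simplified] mi_order_inc[unfolded mi_inc_def])
  also have "\<dots> = (\<Sum>(\<beta>, i)\<in>?B \<times> UNIV. real (\<beta> i) * g \<beta>)"
    using fin by (intro sum.mono_neutral_left) auto
  also have "\<dots> = (\<Sum>\<beta>\<in>?B. \<Sum>i\<in>UNIV. real (\<beta> i) * g \<beta>)"
    by (rule sum.cartesian_product[symmetric])
  also have "\<dots> = (\<Sum>\<beta>\<in>?B. (real j + 1) * g \<beta>)"
  proof (rule sum.cong[OF refl])
    fix \<beta> :: "'n multi_index" assume "\<beta> \<in> ?B"
    then have "real (\<Sum>i\<in>UNIV. \<beta> i) = real j + 1" by (simp add: mi_order_def)
    then show "(\<Sum>i\<in>UNIV. real (\<beta> i) * g \<beta>) = (real j + 1) * g \<beta>"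
      by (simp add: sum_distrib_right[symmetric])
  qed
  finally show ?thesis by (simp add: sum_distrib_left)
qed

lemma vec_nth_measurable [measurable]: "(\<lambda>x. x $ i) \<in> borel_measurable (borel :: (real^'n::finite) measure)"
  by (intro borel_measurable_continuous_onI continuous_intros)

lemma infinitely_differentiable_measurable:
  "infinitely_differentiable f \<Longrightarrow> f \<in> borel_measurable borel"
  by (intro borel_measurable_continuous_onI infinitely_differentiable_continuous)

lemma tensor_measurable:
  "(\<And>i. infinitely_differentiable (\<eta> i)) \<Longrightarrow> tensor \<eta> \<in> borel_measurable borel"
  unfolding tensor_def[abs_def] using infinitely_differentiable_measurable[of "\<eta> i" for i]
  by measurable

lemma integrable_times_tensor:
  assumes "integrable lborel v" "\<And>i. infinitely_differentiable (\<eta> i)"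
    and "\<And>i t. \<eta> i t \<noteq> 0 \<Longrightarrow> t \<in> {c $ i..d $ i}"
  shows "integrable lborel (\<lambda>z. v z * tensor \<eta> z)"
proof -
  have "\<exists>M. \<forall>t. \<bar>\<eta> i t\<bar> \<le> M" for i
    using bounded_of_compact_support[OF infinitely_differentiable_continuous[OF assms(2)] assms(3)] by metis
  then obtain M where M: "\<And>i t. \<bar>\<eta> i t\<bar> \<le> M i" by metis
  have "\<bar>tensor \<eta> z\<bar> \<le> (\<Prod>i\<in>UNIV. M i)" for z
    unfolding tensor_def abs_prod by (intro prod_mono) (auto simp: M)
  then show ?thesis
    using tensor_measurable[of \<eta>] assms(1,2) by (intro integrable_times_bounded) auto
qed

lemma integrable_product_lborel:
  fixes f :: "'a::euclidean_space \<Rightarrow> real" and g :: "'b::euclidean_space \<Rightarrow> real"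
  assumes "integrable lborel f" "integrable lborel g"
  shows "integrable (lborel \<Otimes>\<^sub>M lborel) (\<lambda>p. f (fst p) * g (snd p))"
proof (rule lborel_pair.Fubini_integrable)
  have [measurable]: "f \<in> borel_measurable borel" "g \<in> borel_measurable borel" using assms by auto
  show "(\<lambda>p. f (fst p) * g (snd p)) \<in> borel_measurable (lborel \<Otimes>\<^sub>M lborel)" by measurable
qed (use assms in \<open>simp_all add: abs_mult\<close>)

lemma Fubini_times_bounded:
  fixes f :: "'a::euclidean_space \<Rightarrow> real" and g :: "'b::euclidean_space \<Rightarrow> real"
  assumes "integrable lborel f" "integrable lborel g"
    and "(\<lambda>p. G (fst p) (snd p)) \<in> borel_measurable (lborel \<Otimes>\<^sub>M lborel)"
    and "\<And>x z. f x \<noteq> 0 \<Longrightarrow> \<bar>G x z\<bar> \<le> C"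
  shows "integrable (lborel \<Otimes>\<^sub>M lborel) (\<lambda>p. f (fst p) * g (snd p) * G (fst p) (snd p))"
    and "integrable lborel (\<lambda>x. f x * (LBINT z. g z * G x z))"
    and "(\<integral>p. f (fst p) * g (snd p) * G (fst p) (snd p) \<partial>(lborel \<Otimes>\<^sub>M lborel))
      = (LBINT x. f x * (LBINT z. g z * G x z))"
proof -
  show int: "integrable (lborel \<Otimes>\<^sub>M lborel) (\<lambda>p. f (fst p) * g (snd p) * G (fst p) (snd p))"
    by (rule integrable_times_bounded[OF integrable_product_lborel[OF assms(1,2)] assms(3)]) (use assms(4) in auto)
  show "integrable lborel (\<lambda>x. f x * (LBINT z. g z * G x z))"
    using lborel_pair.integrable_fst'[OF int] by (simp add: mult.assoc)
  show "(\<integral>p. f (fst p) * g (snd p) * G (fst p) (snd p) \<partial>(lborel \<Otimes>\<^sub>M lborel))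
      = (LBINT x. f x * (LBINT z. g z * G x z))"
    using lborel_pair.integral_fst'[OF int] by (simp add: mult.assoc)
qed

text \<open>
  The data that the Taylor argument uses: Borel functions on the whole space, zero outside \<open>D\<close>, such
  that \<open>V (\<alpha> + e\<^sub>i)\<close> is the weak derivative of \<open>V \<alpha>\<close> in direction \<open>i\<close> as far as tensor test functions can
  see. Such a family can be shifted by a multi-index, and the shifted family belongs to a derivative
  of the function.
\<close>

definition weak_jet :: "(real^'n::finite) set \<Rightarrow> nat \<Rightarrow> ('n multi_index \<Rightarrow> real^'n \<Rightarrow> real) \<Rightarrow> bool" where
  "weak_jet D m V \<longleftrightarrow>
     (\<forall>\<alpha>. mi_order \<alpha> \<le> m \<longrightarrow> integrable lborel (V \<alpha>) \<and> integrable lborel (\<lambda>x. (V \<alpha> x)\<^sup>2) \<and>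
        (\<forall>x. x \<notin> D \<longrightarrow> V \<alpha> x = 0)) \<and>
     (\<forall>\<alpha> i \<eta> c d. mi_order \<alpha> < m \<longrightarrow> (\<forall>j. infinitely_differentiable (\<eta> j)) \<longrightarrow>
        (\<forall>j t. \<eta> j t \<noteq> 0 \<longrightarrow> t \<in> {c $ j..d $ j}) \<longrightarrow> cbox c d \<subseteq> D \<longrightarrow>
        (LBINT z. V \<alpha> z * partial i (tensor \<eta>) z) = - (LBINT z. V (mi_inc i \<alpha>) z * tensor \<eta> z))"

lemma weak_jetD:
  assumes "weak_jet D m V" "mi_order \<alpha> \<le> m"
  shows "integrable lborel (V \<alpha>)" "integrable lborel (\<lambda>x. (V \<alpha> x)\<^sup>2)" "x \<notin> D \<Longrightarrow> V \<alpha> x = 0"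
  using assms unfolding weak_jet_def by blast+

lemma weak_jet_integral:
  assumes "weak_jet D m V" "mi_order \<alpha> < m" "\<And>j. infinitely_differentiable (\<eta> j)"
    "\<And>j t. \<eta> j t \<noteq> 0 \<Longrightarrow> t \<in> {c $ j..d $ j}" "cbox c d \<subseteq> D"
  shows "(LBINT z. V \<alpha> z * partial i (tensor \<eta>) z) = - (LBINT z. V (mi_inc i \<alpha>) z * tensor \<eta> z)"
  using assms unfolding weak_jet_def by blast

section \<open>The Taylor kernel\<close>

text \<open>
  The standing situation: a bump function \<open>tensor \<psi>\<close> of mass one lives in a box all of whose points are
  star centres of \<open>D\<close>.
\<close>

locale star_kernel =
  fixes D :: "(real^'n::finite) set" and a b :: "real^'n" and \<psi> :: "'n \<Rightarrow> real \<Rightarrow> real"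
  assumes open_D: "open D" and bounded_D: "bounded D"
    and smooth_\<psi>: "\<And>i. infinitely_differentiable (\<psi> i)"
    and \<psi>_nonneg: "\<And>i t. \<psi> i t \<ge> 0"
    and \<psi>_support: "\<And>i t. \<psi> i t \<noteq> 0 \<Longrightarrow> t \<in> {a $ i..b $ i}"
    and \<psi>_integral: "(LBINT y. tensor \<psi> y) = 1"
    and star: "\<And>x y. x \<in> D \<Longrightarrow> y \<in> cbox a b \<Longrightarrow> closed_segment x y \<subseteq> D"
begin

text \<open>
  \<open>K \<alpha> s x z\<close> is \<open>(y - x)\<^sup>\<alpha> / \<alpha>!\<close> times \<open>tensor \<psi> y\<close> times \<open>1 / s\<^sup>n\<close>, where \<open>z = (1 - s) x + s y\<close>; \<open>K'\<close> is its
  derivative in \<open>s\<close>.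
\<close>

definition K :: "'n multi_index \<Rightarrow> real \<Rightarrow> real^'n \<Rightarrow> real^'n \<Rightarrow> real" where
  "K \<alpha> s x = tensor (\<lambda>i. scaled_bump (\<psi> i) (x $ i) s (\<alpha> i))"

definition K' :: "'n multi_index \<Rightarrow> real \<Rightarrow> real^'n \<Rightarrow> real^'n \<Rightarrow> real" where
  "K' \<alpha> s x z = (\<Sum>i\<in>UNIV. scaled_bump_ds (\<psi> i) (x $ i) s (\<alpha> i) (z $ i) *
      (\<Prod>j\<in>UNIV - {i}. scaled_bump (\<psi> j) (x $ j) s (\<alpha> j) (z $ j)))"

lemma smooth_scaled: "infinitely_differentiable (scaled_bump (\<psi> i) x s n)"
  by (rule infinitely_differentiable_scaled_bump[OF smooth_\<psi>])

lemma K_has_derivative: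
  "s > 0 \<Longrightarrow> ((\<lambda>s. K \<alpha> s x z) has_real_derivative K' \<alpha> s x z) (at s)"
  unfolding K_def K'_def tensor_def
  by (intro has_field_derivative_prod scaled_bump_has_derivative smooth_\<psi>)

lemma K'_eq:
  assumes "s > 0"
  shows "K' \<alpha> s x z = - (\<Sum>i\<in>UNIV. (real (\<alpha> i) + 1) * partial i (K (mi_inc i \<alpha>) s x) z)"
proof -
  have "(real (\<alpha> i) + 1) * partial i (K (mi_inc i \<alpha>) s x) z =
     - (scaled_bump_ds (\<psi> i) (x $ i) s (\<alpha> i) (z $ i) *
        (\<Prod>j\<in>UNIV - {i}. scaled_bump (\<psi> j) (x $ j) s (\<alpha> j) (z $ j)))" for i
  proof -
    have "partial i (K (mi_inc i \<alpha>) s x) z = deriv (scaled_bump (\<psi> i) (x $ i) s (Suc (\<alpha> i))) (z $ i) *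
        (\<Prod>j\<in>UNIV - {i}. scaled_bump (\<psi> j) (x $ j) s (mi_inc i \<alpha> j) (z $ j))"
      unfolding K_def by (subst partial_tensor[OF smooth_scaled]) (simp add: tensor_fun_upd mi_inc_def)
    also have "(\<Prod>j\<in>UNIV - {i}. scaled_bump (\<psi> j) (x $ j) s (mi_inc i \<alpha> j) (z $ j)) =
        (\<Prod>j\<in>UNIV - {i}. scaled_bump (\<psi> j) (x $ j) s (\<alpha> j) (z $ j))"
      by (intro prod.cong) (auto simp: mi_inc_def)
    finally show ?thesis
      using deriv_scaled_bump_Suc[OF smooth_\<psi> assms, of "\<alpha> i" i "x $ i" "z $ i"]
      by (simp add: mult.assoc[symmetric])
  qed
  then show ?thesis by (simp add: K'_def sum_negf)
qed

lemma K_bounds: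
  assumes "s0 > 0"
  obtains C where "\<And>x s z. x \<in> D \<Longrightarrow> s > s0 \<Longrightarrow> \<bar>K \<alpha> s x z\<bar> \<le> C"
    "\<And>x s z. x \<in> D \<Longrightarrow> s > s0 \<Longrightarrow> \<bar>K' \<alpha> s x z\<bar> \<le> C"
proof -
  obtain R where R: "\<And>x. x \<in> D \<Longrightarrow> norm x \<le> R" using bounded_D unfolding bounded_iff by blast
  have Ri: "\<bar>x $ i\<bar> \<le> R" if "x \<in> D" for x i using R[OF that] component_le_norm_cart[of x i] by simp
  have "\<exists>C\<ge>0. (\<forall>x s z. \<bar>x\<bar> \<le> R \<longrightarrow> s > s0 \<longrightarrow> \<bar>scaled_bump (\<psi> i) x s (\<alpha> i) z\<bar> \<le> C) \<and>
      (\<forall>x s z. \<bar>x\<bar> \<le> R \<longrightarrow> s > s0 \<longrightarrow> \<bar>scaled_bump_ds (\<psi> i) x s (\<alpha> i) z\<bar> \<le> C)" for i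
    using scaled_bump_bounds[OF smooth_\<psi> \<psi>_support assms, where R=R and n="\<alpha> i", of i i] by metis
  then obtain C where C: "\<And>i. C i \<ge> 0"
    "\<And>i x s z. \<bar>x\<bar> \<le> R \<Longrightarrow> s > s0 \<Longrightarrow> \<bar>scaled_bump (\<psi> i) x s (\<alpha> i) z\<bar> \<le> C i"
    "\<And>i x s z. \<bar>x\<bar> \<le> R \<Longrightarrow> s > s0 \<Longrightarrow> \<bar>scaled_bump_ds (\<psi> i) x s (\<alpha> i) z\<bar> \<le> C i"
    by metis
  let ?C0 = "\<Prod>i\<in>UNIV. C i" and ?C1 = "\<Sum>i\<in>UNIV. C i * (\<Prod>j\<in>UNIV - {i}. C j)"
  have nonneg: "?C0 \<ge> 0" "?C1 \<ge> 0" using C(1) by (auto intro!: prod_nonneg sum_nonneg mult_nonneg_nonneg)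
  have 1: "\<bar>K \<alpha> s x z\<bar> \<le> ?C0" if "x \<in> D" "s > s0" for x s z
    unfolding K_def tensor_def abs_prod using C(2)[OF Ri[OF that(1)] that(2)] by (intro prod_mono) auto
  have 2: "\<bar>K' \<alpha> s x z\<bar> \<le> ?C1" if "x \<in> D" "s > s0" for x s z
    unfolding K'_def using C(2,3)[OF Ri[OF that(1)] that(2)] C(1)
    by (intro order_trans[OF sum_abs] sum_mono)
       (auto simp: abs_mult abs_prod intro!: mult_mono prod_mono prod_nonneg)
  show thesis
  proof (rule that[of "?C0 + ?C1"])
    show "\<bar>K \<alpha> s x z\<bar> \<le> ?C0 + ?C1" "\<bar>K' \<alpha> s x z\<bar> \<le> ?C0 + ?C1" if "x \<in> D" "s > s0" for x s z
      using 1[OF that, of z] 2[OF that, of z] nonneg by linarith+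
  qed
qed

lemma K_measurable [measurable]:
  "(\<lambda>p. K \<alpha> s (fst p) (snd p)) \<in> borel_measurable (lborel \<Otimes>\<^sub>M lborel)"
proof -
  have [measurable]: "\<psi> i \<in> borel_measurable borel" for i
    using smooth_\<psi> by (rule infinitely_differentiable_measurable)
  show ?thesis unfolding K_def tensor_def scaled_bump_def by measurable
qed

lemma K'_measurable [measurable]:
  "(\<lambda>p. K' \<alpha> s (fst p) (snd p)) \<in> borel_measurable (lborel \<Otimes>\<^sub>M lborel)"
proof -
  have [measurable]: "\<psi> i \<in> borel_measurable borel" "deriv (\<psi> i) \<in> borel_measurable borel" for i
    using smooth_\<psi> infinitely_differentiable_deriv[OF smooth_\<psi>]
    by (auto intro: infinitely_differentiable_measurable)
  show ?thesis unfolding K'_def scaled_bump_def scaled_bump_ds_def by measurable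
qed

lemma scaled_support:
  assumes "0 < s" "scaled_bump (\<psi> i) (x $ i) s n t \<noteq> 0"
  shows "t \<in> {((1 - s) *\<^sub>R x + s *\<^sub>R a) $ i..((1 - s) *\<^sub>R x + s *\<^sub>R b) $ i}"
proof -
  from assms(2) have "\<psi> i (x $ i + (t - x $ i) / s) \<noteq> 0" by (auto simp: scaled_bump_def)
  from \<psi>_support[OF this] have "a $ i \<le> x $ i + (t - x $ i) / s" "x $ i + (t - x $ i) / s \<le> b $ i" by auto
  then have "s * a $ i \<le> s * (x $ i + (t - x $ i) / s)" "s * (x $ i + (t - x $ i) / s) \<le> s * b $ i"
    using assms(1) by (auto intro: mult_left_mono)
  moreover have "s * (x $ i + (t - x $ i) / s) = t - (1 - s) * x $ i"
    using assms(1) by (simp add: field_simps)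
  ultimately show ?thesis by simp
qed

text \<open>
  This is how star-shape enters: for \<open>x \<in> D\<close> and \<open>0 < s \<le> 1\<close> the kernel as a function of \<open>z\<close> is
  supported in the box contracted towards \<open>x\<close>, which lies in \<open>D\<close>. So it is a test function on \<open>D\<close>.
\<close>

lemma scaled_box_subset:
  assumes "x \<in> D" "0 < s" "s \<le> 1"
  shows "cbox ((1 - s) *\<^sub>R x + s *\<^sub>R a) ((1 - s) *\<^sub>R x + s *\<^sub>R b) \<subseteq> D"
proof
  fix z assume z: "z \<in> cbox ((1 - s) *\<^sub>R x + s *\<^sub>R a) ((1 - s) *\<^sub>R x + s *\<^sub>R b)"
  define y where "y = x + (1 / s) *\<^sub>R (z - x)"
  have "s * y $ i = z $ i - (1 - s) * x $ i" for i
    using assms(2) by (simp add: y_def algebra_simps)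
  note y = this
  have "s * a $ i \<le> s * y $ i \<and> s * y $ i \<le> s * b $ i" for i
  proof -
    have "(1 - s) * x $ i + s * a $ i \<le> z $ i" "z $ i \<le> (1 - s) * x $ i + s * b $ i"
      using z[unfolded mem_box_cart, rule_format, of i] by simp_all
    with y[of i] show ?thesis by linarith
  qed
  then have "y \<in> cbox a b" using assms(2) by (simp add: mem_box_cart)
  then have "closed_segment x y \<subseteq> D" using star assms(1) by blast
  moreover have "z = (1 - s) *\<^sub>R x + s *\<^sub>R y"
    using assms(2) by (simp add: y_def vec_eq_iff field_simps)
  then have "z \<in> closed_segment x y" unfolding closed_segment_def using assms(2,3) by auto
  ultimately show "z \<in> D" by blast
qed

text \<open>
  After the substitution \<open>z = (1 - s) x + s y\<close> this is
  \<open>\<integral>\<integral> \<phi> x v ((1 - s) x + s y) (y - x)\<^sup>\<alpha> / \<alpha>! \<psi> y dy dx\<close>, written so that \<open>s\<close> occurs in the kernel only.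
\<close>

definition J :: "(real^'n \<Rightarrow> real) \<Rightarrow> (real^'n \<Rightarrow> real) \<Rightarrow> 'n multi_index \<Rightarrow> real \<Rightarrow> real" where
  "J \<phi> v \<alpha> s = (LBINT x. \<phi> x * (LBINT z. v z * K \<alpha> s x z))"

lemma J_has_derivative:
  assumes \<phi>: "integrable lborel \<phi>" "\<And>x. x \<notin> D \<Longrightarrow> \<phi> x = 0" and v: "integrable lborel v" and s: "s > 0"
  shows "((\<lambda>s. J \<phi> v \<alpha> s) has_real_derivative (LBINT x. \<phi> x * (LBINT z. v z * K' \<alpha> s x z))) (at s)"
proof -
  obtain C where C: "\<And>x t z. x \<in> D \<Longrightarrow> t > s / 2 \<Longrightarrow> \<bar>K \<alpha> t x z\<bar> \<le> C"
    "\<And>x t z. x \<in> D \<Longrightarrow> t > s / 2 \<Longrightarrow> \<bar>K' \<alpha> t x z\<bar> \<le> C"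
    using K_bounds[of "s / 2" \<alpha>] s by auto
  have D: "x \<in> D" if "\<phi> x \<noteq> 0" for x using \<phi>(2) that by blast
  have W: "integrable (lborel \<Otimes>\<^sub>M lborel) (\<lambda>p. \<phi> (fst p) * v (snd p))"
    by (rule integrable_product_lborel[OF \<phi>(1) v])
  have "((\<lambda>t. \<integral>p. \<phi> (fst p) * v (snd p) * K \<alpha> t (fst p) (snd p) \<partial>(lborel \<Otimes>\<^sub>M lborel))
      has_real_derivative (\<integral>p. \<phi> (fst p) * v (snd p) * K' \<alpha> s (fst p) (snd p) \<partial>(lborel \<Otimes>\<^sub>M lborel))) (at s)"
  proof (rule has_real_derivative_integral[OF W, of s "s / 2" "s + 1" _ _ C])
    show "((\<lambda>t. K \<alpha> t (fst p) (snd p)) has_real_derivative K' \<alpha> t (fst p) (snd p)) (at t)"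
      if "t \<in> {s / 2<..<s + 1}" for t p
      using that s by (intro K_has_derivative) auto
  qed (use s C D in auto)
  also have "(\<integral>p. \<phi> (fst p) * v (snd p) * K' \<alpha> s (fst p) (snd p) \<partial>(lborel \<Otimes>\<^sub>M lborel))
      = (LBINT x. \<phi> x * (LBINT z. v z * K' \<alpha> s x z))"
    using C(2) s D by (intro Fubini_times_bounded(3)[OF \<phi>(1) v, where C = C]) auto
  finally have der: "((\<lambda>t. \<integral>p. \<phi> (fst p) * v (snd p) * K \<alpha> t (fst p) (snd p) \<partial>(lborel \<Otimes>\<^sub>M lborel))
      has_real_derivative (LBINT x. \<phi> x * (LBINT z. v z * K' \<alpha> s x z))) (at s)" .
  have "\<forall>\<^sub>F t in nhds s. t \<in> {s / 2<..}" using s by (intro eventually_nhds_in_open) auto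
  then have "\<forall>\<^sub>F t in nhds s. (\<integral>p. \<phi> (fst p) * v (snd p) * K \<alpha> t (fst p) (snd p) \<partial>(lborel \<Otimes>\<^sub>M lborel)) = J \<phi> v \<alpha> t"
  proof eventually_elim
    case (elim t)
    show ?case unfolding J_def
      using C(1) elim D by (intro Fubini_times_bounded(3)[OF \<phi>(1) v, where C = C]) auto
  qed
  from DERIV_cong_ev[OF refl this refl] der show ?thesis by simp
qed

lemma integrable_J:
  assumes \<phi>: "integrable lborel \<phi>" "\<And>x. x \<notin> D \<Longrightarrow> \<phi> x = 0" and v: "integrable lborel v" and s: "s > 0"
  shows "integrable lborel (\<lambda>x. \<phi> x * (LBINT z. v z * K \<alpha> s x z))"
proof -
  obtain C where C: "\<And>x t z. x \<in> D \<Longrightarrow> t > s / 2 \<Longrightarrow> \<bar>K \<alpha> t x z\<bar> \<le> C"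
    using K_bounds[of "s / 2" \<alpha>] s by (metis half_gt_zero)
  have D: "x \<in> D" if "\<phi> x \<noteq> 0" for x using \<phi>(2) that by blast
  show ?thesis using C s D by (intro Fubini_times_bounded(2)[OF \<phi>(1) v, of _ C]) auto
qed

text \<open>
  The derivative of the kernel in \<open>s\<close> is a sum of \<open>z\<close>-derivatives of kernels of order one higher; the
  weak derivative takes these derivatives over.
\<close>

lemma J_derivative_eq:
  assumes V: "weak_jet D m V" "mi_order \<alpha> < m"
    and \<phi>: "integrable lborel \<phi>" "\<And>x. x \<notin> D \<Longrightarrow> \<phi> x = 0" and s: "0 < s" "s \<le> 1"
  shows "(LBINT x. \<phi> x * (LBINT z. V \<alpha> z * K' \<alpha> s x z))
    = (\<Sum>i\<in>UNIV. (real (\<alpha> i) + 1) * J \<phi> (V (mi_inc i \<alpha>)) (mi_inc i \<alpha>) s)"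
proof -
  have Vi: "integrable lborel (V \<alpha>)" "integrable lborel (V (mi_inc i \<alpha>))" for i
    using weak_jetD(1)[OF V(1)] V(2) by (auto simp: Suc_le_eq)
  have inner: "(LBINT z. V \<alpha> z * K' \<alpha> s x z) =
      (\<Sum>i\<in>UNIV. (real (\<alpha> i) + 1) * (LBINT z. V (mi_inc i \<alpha>) z * K (mi_inc i \<alpha>) s x z))"
    if x: "x \<in> D" for x
  proof -
    let ?c = "(1 - s) *\<^sub>R x + s *\<^sub>R a" and ?d = "(1 - s) *\<^sub>R x + s *\<^sub>R b"
    let ?\<eta> = "\<lambda>i j. scaled_bump (\<psi> j) (x $ j) s (mi_inc i \<alpha> j)"
    have supp: "?\<eta> i j t \<noteq> 0 \<Longrightarrow> t \<in> {?c $ j..?d $ j}" for i j t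
      by (rule scaled_support[OF s(1)])
    have int: "integrable lborel (\<lambda>z. V \<alpha> z * partial i (K (mi_inc i \<alpha>) s x) z)" for i
      unfolding K_def partial_tensor[OF smooth_scaled]
    proof (rule integrable_times_tensor[OF Vi(1)])
      show "infinitely_differentiable (((?\<eta> i)(i := deriv (?\<eta> i i))) j)" for j
        using smooth_scaled by auto
      show "t \<in> {?c $ j..?d $ j}" if "((?\<eta> i)(i := deriv (?\<eta> i i))) j t \<noteq> 0" for j t
      proof (cases "j = i")
        case True
        with that have "deriv (?\<eta> i i) t \<noteq> 0" by simp
        from deriv_support[of "?\<eta> i i" "?c $ i" "?d $ i" t, OF supp this] True show ?thesis by simp
      next
        case False
        with that have "?\<eta> i j t \<noteq> 0" by simp
        then show ?thesis by (rule supp)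
      qed
    qed
    have "(LBINT z. V \<alpha> z * K' \<alpha> s x z) =
        (LBINT z. - (\<Sum>i\<in>UNIV. (real (\<alpha> i) + 1) * (V \<alpha> z * partial i (K (mi_inc i \<alpha>) s x) z)))"
      by (simp add: K'_eq[OF s(1)] sum_distrib_left mult_ac)
    also have "\<dots> = - (\<Sum>i\<in>UNIV. (real (\<alpha> i) + 1) * (LBINT z. V \<alpha> z * partial i (K (mi_inc i \<alpha>) s x) z))"
      using int by simp
    finally have 1: "(LBINT z. V \<alpha> z * K' \<alpha> s x z) =
        - (\<Sum>i\<in>UNIV. (real (\<alpha> i) + 1) * (LBINT z. V \<alpha> z * partial i (K (mi_inc i \<alpha>) s x) z))" .
    have 2: "(LBINT z. V \<alpha> z * partial i (K (mi_inc i \<alpha>) s x) z) =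
        - (LBINT z. V (mi_inc i \<alpha>) z * K (mi_inc i \<alpha>) s x z)" for i
      unfolding K_def
      by (rule weak_jet_integral[OF V smooth_scaled supp scaled_box_subset[OF x s]])
    show ?thesis unfolding 1 2 by (simp add: sum_negf)
  qed
  have "(LBINT x. \<phi> x * (LBINT z. V \<alpha> z * K' \<alpha> s x z)) =
      (LBINT x. (\<Sum>i\<in>UNIV. (real (\<alpha> i) + 1) *
        (\<phi> x * (LBINT z. V (mi_inc i \<alpha>) z * K (mi_inc i \<alpha>) s x z))))"
  proof (rule Bochner_Integration.integral_cong[OF refl])
    fix x show "\<phi> x * (LBINT z. V \<alpha> z * K' \<alpha> s x z) = (\<Sum>i\<in>UNIV. (real (\<alpha> i) + 1) *
        (\<phi> x * (LBINT z. V (mi_inc i \<alpha>) z * K (mi_inc i \<alpha>) s x z)))"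
      using inner[of x] \<phi>(2)[of x] by (cases "x \<in> D") (auto simp: sum_distrib_left mult_ac)
  qed
  also have "\<dots> = (\<Sum>i\<in>UNIV. (real (\<alpha> i) + 1) * J \<phi> (V (mi_inc i \<alpha>)) (mi_inc i \<alpha>) s)"
    unfolding J_def using integrable_J[OF \<phi> Vi(2) s(1)] by simp
  finally show ?thesis .
qed

text \<open>
  The \<open>j\<close>-th derivative of \<open>F \<phi> V 0\<close>, for \<open>V\<close> a weak jet of sufficient order. The factor \<open>j!\<close> cancels
  the multiplicities in \<open>sum_mi_inc\<close>.
\<close>

definition F :: "(real^'n \<Rightarrow> real) \<Rightarrow> ('n multi_index \<Rightarrow> real^'n \<Rightarrow> real) \<Rightarrow> nat \<Rightarrow> real \<Rightarrow> real" where
  "F \<phi> V j s = fact j * (\<Sum>\<alpha> | mi_order \<alpha> = j. J \<phi> (V \<alpha>) \<alpha> s)"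

lemma F_has_derivative:
  assumes V: "weak_jet D m V" "j < m"
    and \<phi>: "integrable lborel \<phi>" "\<And>x. x \<notin> D \<Longrightarrow> \<phi> x = 0" and s: "0 < s" "s \<le> 1"
  shows "(F \<phi> V j has_real_derivative F \<phi> V (Suc j) s) (at s)"
proof -
  have "((\<lambda>s. fact j * (\<Sum>\<alpha> | mi_order \<alpha> = j. J \<phi> (V \<alpha>) \<alpha> s)) has_real_derivative
      fact j * (\<Sum>\<alpha> | mi_order \<alpha> = j. LBINT x. \<phi> x * (LBINT z. V \<alpha> z * K' \<alpha> s x z))) (at s)"
  proof (intro DERIV_cmult DERIV_sum)
    fix \<alpha> :: "'n multi_index" assume "\<alpha> \<in> {\<alpha>. mi_order \<alpha> = j}"
    then have "mi_order \<alpha> \<le> m" using V(2) by simp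
    from J_has_derivative[OF \<phi> weak_jetD(1)[OF V(1) this] s(1)]
    show "((\<lambda>s. J \<phi> (V \<alpha>) \<alpha> s) has_real_derivative
      (LBINT x. \<phi> x * (LBINT z. V \<alpha> z * K' \<alpha> s x z))) (at s)" .
  qed
  also have "(\<Sum>\<alpha> | mi_order \<alpha> = j. LBINT x. \<phi> x * (LBINT z. V \<alpha> z * K' \<alpha> s x z)) =
      (\<Sum>\<alpha> | mi_order \<alpha> = j. \<Sum>i\<in>UNIV. (real (\<alpha> i) + 1) * J \<phi> (V (mi_inc i \<alpha>)) (mi_inc i \<alpha>) s)"
    using V \<phi> s by (intro sum.cong refl J_derivative_eq) auto
  also have "\<dots> = (real j + 1) * (\<Sum>\<beta> | mi_order \<beta> = Suc j. J \<phi> (V \<beta>) \<beta> s)"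
    by (rule sum_mi_inc)
  finally show ?thesis by (simp add: F_def[abs_def] mult_ac add.commute)
qed

end

section \<open>Bounds in the space of square integrable functions\<close>

lemma nn_integral_lborel_affine:
  fixes f :: "'a::euclidean_space \<Rightarrow> ennreal"
  assumes [measurable]: "f \<in> borel_measurable borel" and c: "c \<noteq> 0"
  shows "(\<integral>\<^sup>+x. f x \<partial>lborel) = ennreal (\<bar>c\<bar> ^ DIM('a)) * (\<integral>\<^sup>+x. f (t + c *\<^sub>R x) \<partial>lborel)"
  by (subst lborel_affine[OF c, of t])
     (simp add: nn_integral_density nn_integral_distr nn_integral_cmult)

lemma integral_lborel_affine:
  fixes f :: "'a::euclidean_space \<Rightarrow> real"
  assumes [measurable]: "f \<in> borel_measurable borel" and c: "c \<noteq> 0"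
  shows "(LBINT x. f x) = \<bar>c\<bar> ^ DIM('a) * (LBINT x. f (t + c *\<^sub>R x))"
  by (subst lborel_affine[OF c, of t])
     (simp add: integral_density integral_distr)

lemma integrable_bounded_support:
  fixes f :: "'a::euclidean_space \<Rightarrow> real"
  assumes "f \<in> borel_measurable borel" "bounded D" "D \<in> sets borel"
    "\<And>x. x \<notin> D \<Longrightarrow> f x = 0" "\<And>x. x \<in> D \<Longrightarrow> \<bar>f x\<bar> \<le> M"
  shows "integrable lborel f"
proof (rule Bochner_Integration.integrable_bound)
  show "integrable lborel (\<lambda>x. M * indicator D x)"
    using assms(2,3) emeasure_bounded_finite[of D] by auto
  show "AE x in lborel. norm (f x) \<le> norm (M * indicator D x)"
  proof (rule AE_I2)
    fix x show "norm (f x) \<le> norm (M * indicator D x)"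
      using assms(4)[of x] assms(5)[of x] by (cases "x \<in> D") auto
  qed
qed (use assms in auto)

lemma ennreal_le_of_power2_le:
  assumes "x\<^sup>2 \<le> (ennreal r)\<^sup>2" "r \<ge> 0"
  shows "x \<le> ennreal r"
proof (cases x)
  case (real q)
  with assms have "q\<^sup>2 \<le> r\<^sup>2" by (simp add: ennreal_power)
  then show ?thesis using real assms(2) by (auto intro!: ennreal_leI power2_le_imp_le)
next
  case top
  with assms show ?thesis by (simp add: ennreal_power top_unique)
qed

text \<open>
  Bounded Borel functions are limits almost everywhere of continuous functions with the same bound.
  Measurable functions are such limits without a bound, and truncation restores it.
\<close>

lemma continuous_approximation:
  fixes f :: "'a::euclidean_space \<Rightarrow> real"
  assumes f: "f \<in> borel_measurable borel" "\<And>x. \<bar>f x\<bar> \<le> M"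
  obtains g where "\<And>n. continuous_on UNIV (g n)" "\<And>n x. \<bar>g n x\<bar> \<le> M"
    "AE x in lborel. (\<lambda>n. g n x) \<longlonglongrightarrow> f x"
proof -
  have M: "M \<ge> 0" using f(2)[of 0] by linarith
  have "f \<in> borel_measurable lebesgue" using f(1) by (simp add: measurable_completion)
  then have "f measurable_on UNIV" by (simp add: lebesgue_measurable_imp_measurable_on)
  then obtain N g where g: "negligible N" "\<And>n. continuous_on UNIV (g n)" "\<And>x. x \<notin> N \<Longrightarrow> (\<lambda>n. g n x) \<longlonglongrightarrow> f x"
    unfolding measurable_on_def by auto
  show thesis
  proof (rule that[of "\<lambda>n x. max (- M) (min M (g n x))"])
    show "continuous_on UNIV (\<lambda>x. max (- M) (min M (g n x)))" for n
      using g(2) by (intro continuous_intros)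
    show "\<bar>max (- M) (min M (g n x))\<bar> \<le> M" for n x using M by auto
    have "(\<lambda>n. max (- M) (min M (g n x))) \<longlonglongrightarrow> f x" if "x \<notin> N" for x
    proof -
      have "(\<lambda>n. max (- M) (min M (g n x))) \<longlonglongrightarrow> max (- M) (min M (f x))"
        by (intro tendsto_intros g(3) that)
      also have "max (- M) (min M (f x)) = f x" using f(2)[of x] by auto
      finally show ?thesis .
    qed
    moreover have "AE x in lebesgue. x \<notin> N"
      using g(1) AE_not_in negligible_iff_null_sets by blast
    ultimately have "AE x in lebesgue. (\<lambda>n. max (- M) (min M (g n x))) \<longlonglongrightarrow> f x"
      by auto
    then show "AE x in lborel. (\<lambda>n. max (- M) (min M (g n x))) \<longlonglongrightarrow> f x"
      by (simp add: AE_completion_iff)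
  qed
qed

text \<open>
  The natural function to test \<open>G\<close> with is \<open>G\<close> itself. Truncating its values makes it bounded;
  approximation by continuous functions makes it admissible.
\<close>

lemma L2_bound_by_duality:
  fixes G :: "'a::euclidean_space \<Rightarrow> real"
  assumes D: "bounded D" "D \<in> sets borel" and G: "integrable lborel G" "integrable lborel (\<lambda>x. (G x)\<^sup>2)"
    "\<And>x. x \<notin> D \<Longrightarrow> G x = 0" and A: "A \<ge> 0"
    and dual: "\<And>f M. continuous_on UNIV f \<Longrightarrow> (\<And>x. \<bar>f x\<bar> \<le> M) \<Longrightarrow>
      \<bar>\<integral>x. f x * indicator D x * G x \<partial>lborel\<bar> \<le> A * sqrt (LBINT x. (f x * indicator D x)\<^sup>2)"
  shows "(LBINT x. (G x)\<^sup>2) \<le> A\<^sup>2"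
proof -
  have [measurable]: "G \<in> borel_measurable borel" using G(1) by auto
  note [measurable] = D(2)
  have D1: "integrable lborel (\<lambda>x. c * indicator D x :: real)" for c
    using D emeasure_bounded_finite[of D] by auto
  have gen: "\<bar>\<integral>x. f x * indicator D x * G x \<partial>lborel\<bar> \<le> A * sqrt (LBINT x. (f x * indicator D x)\<^sup>2)"
    if f[measurable]: "f \<in> borel_measurable borel" and fM: "\<And>x. \<bar>f x\<bar> \<le> M" for f M
  proof -
    obtain g where g: "\<And>n. continuous_on UNIV (g n)" "\<And>n x. \<bar>g n x\<bar> \<le> M"
      "AE x in lborel. (\<lambda>n. g n x) \<longlonglongrightarrow> f x" using continuous_approximation[OF f fM] by blast
    have [measurable]: "g n \<in> borel_measurable borel" for n
      using g(1) by (intro borel_measurable_continuous_onI)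
    have "(\<lambda>n. LBINT x. g n x * indicator D x * G x) \<longlonglongrightarrow> (LBINT x. f x * indicator D x * G x)"
    proof (rule integral_dominated_convergence[where w = "\<lambda>x. M * \<bar>G x\<bar>"])
      show "integrable lborel (\<lambda>x. M * \<bar>G x\<bar>)" using G(1) by simp
      show "AE x in lborel. (\<lambda>n. g n x * indicator D x * G x) \<longlonglongrightarrow> f x * indicator D x * G x"
        using g(3) by eventually_elim (intro tendsto_intros)
      have "norm (g n x * indicator D x * G x) \<le> M * \<bar>G x\<bar>" for n x
        using mult_right_mono[OF g(2)[of n x], of "\<bar>G x\<bar>"] order_trans[OF abs_ge_zero g(2)[of n x]]
        by (auto simp: abs_mult indicator_def)
      then show "AE x in lborel. norm (g n x * indicator D x * G x) \<le> M * \<bar>G x\<bar>" for n by simp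
    qed measurable
    moreover have "(\<lambda>n. LBINT x. (g n x * indicator D x)\<^sup>2) \<longlonglongrightarrow> (LBINT x. (f x * indicator D x)\<^sup>2)"
    proof (rule integral_dominated_convergence[where w = "\<lambda>x. M\<^sup>2 * indicator D x"])
      show "integrable lborel (\<lambda>x. M\<^sup>2 * indicator D x :: real)" by (rule D1)
      show "AE x in lborel. (\<lambda>n. (g n x * indicator D x)\<^sup>2) \<longlonglongrightarrow> (f x * indicator D x)\<^sup>2"
        using g(3) by eventually_elim (intro tendsto_intros)
      have "norm ((g n x * indicator D x)\<^sup>2) \<le> M\<^sup>2 * indicator D x" for n x
        using power_mono[OF g(2)[of n x], of 2] by (auto simp: indicator_def)
      then show "AE x in lborel. norm ((g n x * indicator D x)\<^sup>2) \<le> M\<^sup>2 * indicator D x" for n by simp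
    qed measurable
    ultimately show ?thesis
      using dual[OF g(1) g(2)] by (intro LIMSEQ_le[OF tendsto_rabs tendsto_mult[OF tendsto_const tendsto_real_sqrt]]) auto
  qed
  define I where "I N x = (if \<bar>G x\<bar> \<le> real N then (G x)\<^sup>2 else 0)" for N x
  have "(LBINT x. I N x) \<le> A\<^sup>2" for N
  proof -
    let ?f = "\<lambda>x. if \<bar>G x\<bar> \<le> real N then G x else 0"
    have "?f x * indicator D x * G x = I N x" "(?f x * indicator D x)\<^sup>2 = I N x" for x
      using G(3)[of x] by (auto simp: I_def power2_eq_square indicator_def)
    with gen[of ?f "real N"] have le: "\<bar>\<integral>x. I N x \<partial>lborel\<bar> \<le> A * sqrt (LBINT x. I N x)"
      by simp
    have nn: "(LBINT x. I N x) \<ge> 0" by (auto simp: I_def)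
    define r where "r = sqrt (LBINT x. I N x)"
    have "r\<^sup>2 \<le> A * r" "r \<ge> 0" using le nn by (auto simp: r_def)
    then have "r \<le> A" using A by (cases "r = 0") (auto simp: power2_eq_square)
    then have "r\<^sup>2 \<le> A\<^sup>2" using \<open>r \<ge> 0\<close> by (intro power_mono)
    then show ?thesis using nn by (simp add: r_def)
  qed
  moreover have "(\<lambda>N. LBINT x. I N x) \<longlonglongrightarrow> (LBINT x. (G x)\<^sup>2)"
  proof (rule integral_dominated_convergence[where w = "\<lambda>x. (G x)\<^sup>2"])
    show "I N \<in> borel_measurable lborel" for N unfolding I_def[abs_def] by measurable
    have "(\<lambda>N. I N x) \<longlonglongrightarrow> (G x)\<^sup>2" for x
    proof (rule Lim_transform_eventually[OF tendsto_const])
      obtain n where "\<bar>G x\<bar> \<le> real n" using real_arch_simple by blast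
      then show "\<forall>\<^sub>F N in sequentially. (G x)\<^sup>2 = I N x"
        by (intro eventually_sequentiallyI[of n]) (auto simp: I_def)
    qed
    then show "AE x in lborel. (\<lambda>N. I N x) \<longlonglongrightarrow> (G x)\<^sup>2" by simp
    show "AE x in lborel. norm (I N x) \<le> (G x)\<^sup>2" for N by (auto simp: I_def)
  qed (use G in auto)
  ultimately show ?thesis by (intro LIMSEQ_le_const2) auto
qed

context star_kernel
begin

abbreviation \<Psi> :: "real^'n \<Rightarrow> real" where "\<Psi> \<equiv> tensor \<psi>"

abbreviation K0 :: "real \<Rightarrow> real^'n \<Rightarrow> real^'n \<Rightarrow> real" where "K0 \<equiv> K (\<lambda>_. 0)"

lemma \<Psi>_measurable [measurable]: "\<Psi> \<in> borel_measurable borel"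
  by (rule tensor_measurable[OF smooth_\<psi>])

lemma \<Psi>_nonneg: "\<Psi> y \<ge> 0"
  unfolding tensor_def by (intro prod_nonneg) (auto simp: \<psi>_nonneg)

lemma \<Psi>_integrable: "integrable lborel \<Psi>"
  using \<psi>_integral not_integrable_integral_eq by fastforce

lemma \<Psi>_nn_integral: "(\<integral>\<^sup>+y. \<Psi> y \<partial>lborel) = 1"
  using nn_integral_eq_integral[OF \<Psi>_integrable] \<Psi>_nonneg \<psi>_integral by simp

lemma \<Psi>_bounded: obtains B where "B \<ge> 0" "\<And>y. \<Psi> y \<le> B"
proof -
  have "\<exists>M. \<forall>t. \<bar>\<psi> i t\<bar> \<le> M" for i
    using bounded_of_compact_support[OF infinitely_differentiable_continuous[OF smooth_\<psi>] \<psi>_support] by metis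
  then obtain M where M: "\<And>i t. \<bar>\<psi> i t\<bar> \<le> M i" by metis
  have B: "\<Psi> y \<le> (\<Prod>i\<in>UNIV. M i)" for y
    unfolding tensor_def using M \<psi>_nonneg by (intro prod_mono) (auto simp: abs_le_iff)
  moreover have "(\<Prod>i\<in>UNIV. M i) \<ge> 0" using B[of 0] \<Psi>_nonneg[of 0] by linarith
  ultimately show thesis using that by blast
qed

lemma K0_eq: "K0 s x z = \<Psi> (x + (1 / s) *\<^sub>R (z - x)) / s ^ CARD('n)"
  unfolding K_def tensor_def scaled_bump_def by (simp add: prod_dividef)

lemma K0_nonneg: "s > 0 \<Longrightarrow> K0 s x z \<ge> 0"
  by (simp add: K0_eq \<Psi>_nonneg)

lemma K0_nn_integral_snd:
  assumes "s > 0"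
  shows "(\<integral>\<^sup>+z. K0 s x z \<partial>lborel) = 1"
proof -
  have "(\<integral>\<^sup>+y. \<Psi> y \<partial>lborel) = ennreal (\<bar>1 / s\<bar> ^ DIM(real^'n)) *
      (\<integral>\<^sup>+z. \<Psi> ((x - (1 / s) *\<^sub>R x) + (1 / s) *\<^sub>R z) \<partial>lborel)"
    by (rule nn_integral_lborel_affine) (use assms in auto)
  also have "\<dots> = (\<integral>\<^sup>+z. ennreal (\<bar>1 / s\<bar> ^ DIM(real^'n)) * \<Psi> ((x - (1 / s) *\<^sub>R x) + (1 / s) *\<^sub>R z) \<partial>lborel)"
    by (subst nn_integral_cmult) auto
  also have "\<dots> = (\<integral>\<^sup>+z. K0 s x z \<partial>lborel)"
    using assms by (intro nn_integral_cong)
      (simp add: K0_eq ennreal_mult'[symmetric] algebra_simps power_divide)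
  finally show ?thesis by (simp add: \<Psi>_nn_integral)
qed

text \<open>
  The integral over \<open>x\<close> of the kernel is at most \<open>1 / (1 - s)\<^sup>n\<close>, which is fine for \<open>s \<le> 1/2\<close>. Near \<open>s = 1\<close> the kernel
  is bounded and the measure of \<open>D\<close> is finite.
\<close>

lemma K0_nn_integral_fst:
  obtains C where "C \<ge> 0" "\<And>s z. 0 < s \<Longrightarrow> s < 1 \<Longrightarrow> (\<integral>\<^sup>+x. K0 s x z * indicator D x \<partial>lborel) \<le> ennreal C"
proof -
  obtain B :: real where B: "B \<ge> 0" "\<And>y. \<Psi> y \<le> B" using \<Psi>_bounded by blast
  have [measurable]: "D \<in> sets borel" using open_D by simp
  let ?\<mu> = "measure lborel D" and ?n = "CARD('n)"
  have \<mu>: "emeasure lborel D = ennreal ?\<mu>"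
    using emeasure_bounded_finite[OF bounded_D] by (simp add: emeasure_eq_ennreal_measure)
  have "(\<integral>\<^sup>+x. K0 s x z * indicator D x \<partial>lborel) \<le> ennreal (2 ^ ?n * (1 + B * ?\<mu>))"
    if s: "0 < s" "s < 1" for s z
  proof (cases "s \<le> 1 / 2")
    case True
    have "(\<integral>\<^sup>+y. \<Psi> y \<partial>lborel) = ennreal (\<bar>1 - 1 / s\<bar> ^ DIM(real^'n)) *
        (\<integral>\<^sup>+x. \<Psi> ((1 / s) *\<^sub>R z + (1 - 1 / s) *\<^sub>R x) \<partial>lborel)"
      by (rule nn_integral_lborel_affine) (use s in auto)
    also have "\<dots> = (\<integral>\<^sup>+x. ennreal (\<bar>1 - 1 / s\<bar> ^ DIM(real^'n)) * \<Psi> ((1 / s) *\<^sub>R z + (1 - 1 / s) *\<^sub>R x) \<partial>lborel)"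
      by (subst nn_integral_cmult) auto
    finally have one: "(\<integral>\<^sup>+x. ennreal (\<bar>1 - 1 / s\<bar> ^ ?n) * \<Psi> ((1 / s) *\<^sub>R z + (1 - 1 / s) *\<^sub>R x) \<partial>lborel) = 1"
      by (simp add: \<Psi>_nn_integral)
    have "1 / s \<le> 2 * \<bar>1 - 1 / s\<bar>" using s True by (simp add: abs_if field_simps)
    then have "(1 / s) ^ ?n \<le> (2 * \<bar>1 - 1 / s\<bar>) ^ ?n" using s by (intro power_mono) auto
    then have pw: "(1 / s) ^ ?n \<le> 2 ^ ?n * \<bar>1 - 1 / s\<bar> ^ ?n" by (simp add: power_mult_distrib)
    have "K0 s x z * indicator D x \<le> 2 ^ ?n * (\<bar>1 - 1 / s\<bar> ^ ?n * \<Psi> ((1 / s) *\<^sub>R z + (1 - 1 / s) *\<^sub>R x))" for x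
    proof -
      have "K0 s x z * indicator D x \<le> K0 s x z" using K0_nonneg[OF s(1)] by (auto simp: indicator_def)
      also have "\<dots> = (1 / s) ^ ?n * \<Psi> ((1 / s) *\<^sub>R z + (1 - 1 / s) *\<^sub>R x)"
        by (simp add: K0_eq algebra_simps power_divide)
      also have "\<dots> \<le> (2 ^ ?n * \<bar>1 - 1 / s\<bar> ^ ?n) * \<Psi> ((1 / s) *\<^sub>R z + (1 - 1 / s) *\<^sub>R x)"
        by (rule mult_right_mono[OF pw \<Psi>_nonneg])
      finally show ?thesis by simp
    qed
    then have "(\<integral>\<^sup>+x. K0 s x z * indicator D x \<partial>lborel) \<le>
        (\<integral>\<^sup>+x. ennreal (2 ^ ?n) * (ennreal (\<bar>1 - 1 / s\<bar> ^ ?n) * \<Psi> ((1 / s) *\<^sub>R z + (1 - 1 / s) *\<^sub>R x)) \<partial>lborel)"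
      by (intro nn_integral_mono) (auto simp: ennreal_mult'[symmetric] intro!: ennreal_leI)
    also have "\<dots> = ennreal (2 ^ ?n)" using one by (subst nn_integral_cmult) auto
    also have "\<dots> \<le> ennreal (2 ^ ?n * (1 + B * ?\<mu>))" using B(1) by (intro ennreal_leI) simp
    finally show ?thesis .
  next
    case False
    have "1 / s \<le> 2" using s False by (simp add: field_simps)
    then have "(1 / s) ^ ?n \<le> 2 ^ ?n" using s by (intro power_mono) auto
    then have "K0 s x z \<le> 2 ^ ?n * B" for x
      using B \<Psi>_nonneg mult_mono[of "(1 / s) ^ ?n" "2 ^ ?n" "\<Psi> (x + (1 / s) *\<^sub>R (z - x))" B]
      by (simp add: K0_eq power_divide)
    then have "(\<integral>\<^sup>+x. K0 s x z * indicator D x \<partial>lborel) \<le> (\<integral>\<^sup>+x. ennreal (2 ^ ?n * B) * indicator D x \<partial>lborel)"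
      by (intro nn_integral_mono) (auto simp: indicator_def intro!: ennreal_leI)
    also have "\<dots> = ennreal (2 ^ ?n * B * ?\<mu>)"
      using B(1) by (simp add: nn_integral_cmult_indicator \<mu> ennreal_mult'[symmetric])
    also have "\<dots> \<le> ennreal (2 ^ ?n * (1 + B * ?\<mu>))" by (intro ennreal_leI) (simp add: algebra_simps)
    finally show ?thesis .
  qed
  then show thesis using B(1) by (intro that[of "2 ^ ?n * (1 + B * ?\<mu>)"]) auto
qed

lemma mi_prod_power: "(\<Prod>i\<in>UNIV. (h::real) ^ \<alpha> i) = h ^ mi_order \<alpha>"
  by (simp add: mi_order_def power_sum)

text \<open>
  On the support of the kernel both \<open>x\<close> and \<open>y\<close> lie in \<open>D\<close>, so no coordinate of \<open>y - x\<close> exceeds the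
  diameter.
\<close>

lemma K_le:
  assumes "x \<in> D" "0 < s"
  shows "\<bar>K \<alpha> s x z\<bar> \<le> diameter D ^ mi_order \<alpha> / mi_fact \<alpha> * K0 s x z"
proof (cases "K \<alpha> s x z = 0")
  case True
  then show ?thesis using K0_nonneg[OF assms(2)] diameter_ge_0[OF bounded_D]
    by (auto intro!: mult_nonneg_nonneg divide_nonneg_nonneg prod_nonneg)
next
  case False
  define y where "y = x + (1 / s) *\<^sub>R (z - x)"
  have "\<psi> i (y $ i) \<noteq> 0" for i
    using False by (auto simp: K_def tensor_def scaled_bump_def y_def)
  then have "y \<in> cbox a b" using \<psi>_support by (force simp: mem_box_cart)
  then have "y \<in> D" using star[OF assms(1)] by auto
  then have "dist y x \<le> diameter D" using diameter_bounded_bound[OF bounded_D] assms(1) by blast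
  then have yx: "\<bar>(y - x) $ i\<bar> \<le> diameter D" for i
    using component_le_norm_cart[of "y - x" i] by (simp add: dist_norm)
  have le: "\<bar>scaled_bump (\<psi> i) (x $ i) s (\<alpha> i) (z $ i)\<bar> \<le>
      diameter D ^ \<alpha> i / fact (\<alpha> i) * scaled_bump (\<psi> i) (x $ i) s 0 (z $ i)" for i
  proof -
    have "(z $ i - x $ i) / s = (y - x) $ i" by (simp add: y_def)
    then have "\<bar>scaled_bump (\<psi> i) (x $ i) s (\<alpha> i) (z $ i)\<bar> =
      \<bar>(y - x) $ i\<bar> ^ \<alpha> i / fact (\<alpha> i) * scaled_bump (\<psi> i) (x $ i) s 0 (z $ i)"
      using assms(2) \<psi>_nonneg by (simp add: scaled_bump_def abs_mult power_abs)
    also have "\<dots> \<le> diameter D ^ \<alpha> i / fact (\<alpha> i) * scaled_bump (\<psi> i) (x $ i) s 0 (z $ i)"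
      using assms(2) \<psi>_nonneg yx
      by (intro mult_right_mono divide_right_mono power_mono) (auto simp: scaled_bump_def)
    finally show ?thesis .
  qed
  have "\<bar>K \<alpha> s x z\<bar> = (\<Prod>i\<in>UNIV. \<bar>scaled_bump (\<psi> i) (x $ i) s (\<alpha> i) (z $ i)\<bar>)"
    by (simp add: K_def tensor_def abs_prod)
  also have "\<dots> \<le> (\<Prod>i\<in>UNIV. diameter D ^ \<alpha> i / fact (\<alpha> i) * scaled_bump (\<psi> i) (x $ i) s 0 (z $ i))"
    by (intro prod_mono conjI abs_ge_zero le)
  also have "\<dots> = diameter D ^ mi_order \<alpha> / mi_fact \<alpha> * K0 s x z"
    by (simp add: prod.distrib prod_dividef mi_prod_power K_def tensor_def)
  finally show ?thesis .
qed

text \<open>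
  Schur's test: by Cauchy-Schwarz for the measure with density \<open>K0\<close>, where the two marginals of the
  kernel are bounded by \<open>1\<close> and by \<open>C\<close>.
\<close>

lemma J_bound:
  assumes C: "C \<ge> 0" "\<And>s z. 0 < s \<Longrightarrow> s < 1 \<Longrightarrow> (\<integral>\<^sup>+x. K0 s x z * indicator D x \<partial>lborel) \<le> ennreal C"
    and \<phi>: "integrable lborel \<phi>" "\<And>x. x \<notin> D \<Longrightarrow> \<phi> x = 0" "integrable lborel (\<lambda>x. (\<phi> x)\<^sup>2)"
    and v: "integrable lborel v" "integrable lborel (\<lambda>x. (v x)\<^sup>2)" and s: "0 < s" "s < 1"
  shows "\<bar>J \<phi> v \<alpha> s\<bar> \<le> diameter D ^ mi_order \<alpha> / mi_fact \<alpha> * (sqrt C *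
     sqrt (LBINT x. (\<phi> x)\<^sup>2) * sqrt (LBINT x. (v x)\<^sup>2))"
proof -
  let ?h = "diameter D ^ mi_order \<alpha> / mi_fact \<alpha>" and ?P = "lborel \<Otimes>\<^sub>M (lborel :: (real^'n) measure)"
  have h: "?h \<ge> 0" using diameter_ge_0[OF bounded_D] by (auto intro!: divide_nonneg_nonneg prod_nonneg)
  have [measurable]: "\<phi> \<in> borel_measurable borel" "v \<in> borel_measurable borel" "D \<in> sets borel"
    using \<phi> v open_D by auto
  have D: "x \<in> D" if "\<phi> x \<noteq> 0" for x using \<phi>(2) that by blast
  obtain B where B: "\<And>x t z. x \<in> D \<Longrightarrow> t > s / 2 \<Longrightarrow> \<bar>K \<alpha> t x z\<bar> \<le> B"
    using K_bounds[of "s / 2" \<alpha>] s by (metis half_gt_zero)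
  have B': "\<bar>K \<alpha> s x z\<bar> \<le> B" if "\<phi> x \<noteq> 0" for x z using B[OF D[OF that]] s by simp
  note Fub = Fubini_times_bounded[where f = \<phi> and g = v and G = "K \<alpha> s" and C = B, OF \<phi>(1) v(1) K_measurable B']
  let ?N = "\<integral>\<^sup>+p. ennreal (\<bar>\<phi> (fst p)\<bar> * \<bar>v (snd p)\<bar> * K0 s (fst p) (snd p)) \<partial>?P"
  let ?f = "\<lambda>p. ennreal (\<bar>\<phi> (fst p)\<bar> * sqrt (K0 s (fst p) (snd p)))"
  let ?g = "\<lambda>p. ennreal (\<bar>v (snd p)\<bar> * sqrt (K0 s (fst p) (snd p)) * indicator D (fst p))"
  have K0n: "K0 s x z \<ge> 0" for x z by (rule K0_nonneg[OF s(1)])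
  have fg: "?f p * ?g p = ennreal (\<bar>\<phi> (fst p)\<bar> * \<bar>v (snd p)\<bar> * K0 s (fst p) (snd p))" for p
    using K0n[of "fst p" "snd p"] \<phi>(2)[of "fst p"]
    by (auto simp: ennreal_mult'[symmetric] indicator_def algebra_simps)
  have f2: "(?f p)\<^sup>2 = ennreal ((\<phi> (fst p))\<^sup>2) * ennreal (K0 s (fst p) (snd p))" for p
    using K0n[of "fst p" "snd p"] by (simp add: ennreal_power ennreal_mult'[symmetric] power_mult_distrib)
  have g2: "(?g p)\<^sup>2 = ennreal ((v (snd p))\<^sup>2) * ennreal (K0 s (fst p) (snd p) * indicator D (fst p))" for p
    using K0n[of "fst p" "snd p"]
    by (auto simp: ennreal_power ennreal_mult'[symmetric] power_mult_distrib indicator_def)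
  have "(\<integral>\<^sup>+p. (?f p)\<^sup>2 \<partial>?P) = (\<integral>\<^sup>+x. \<integral>\<^sup>+z. ennreal ((\<phi> x)\<^sup>2) * ennreal (K0 s x z) \<partial>lborel \<partial>lborel)"
    unfolding f2 by (subst lborel.nn_integral_fst[symmetric]) auto
  also have "\<dots> = (\<integral>\<^sup>+x. ennreal ((\<phi> x)\<^sup>2) \<partial>lborel)"
    using K0_nn_integral_snd[OF s(1)] by (subst nn_integral_cmult) (auto simp: K0_eq)
  also have "\<dots> = ennreal (LBINT x. (\<phi> x)\<^sup>2)"
    by (rule nn_integral_eq_integral[OF \<phi>(3)]) auto
  finally have F2: "(\<integral>\<^sup>+p. (?f p)\<^sup>2 \<partial>?P) = ennreal (LBINT x. (\<phi> x)\<^sup>2)" .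
  have "(\<integral>\<^sup>+p. (?g p)\<^sup>2 \<partial>?P) =
      (\<integral>\<^sup>+z. \<integral>\<^sup>+x. ennreal ((v z)\<^sup>2) * ennreal (K0 s x z * indicator D x) \<partial>lborel \<partial>lborel)"
    unfolding g2 by (subst lborel_pair.nn_integral_snd[symmetric]) auto
  also have "\<dots> = (\<integral>\<^sup>+z. ennreal ((v z)\<^sup>2) * (\<integral>\<^sup>+x. ennreal (K0 s x z * indicator D x) \<partial>lborel) \<partial>lborel)"
    by (subst nn_integral_cmult) (auto simp: K0_eq)
  also have "\<dots> \<le> (\<integral>\<^sup>+z. ennreal ((v z)\<^sup>2) * ennreal C \<partial>lborel)"
    by (intro nn_integral_mono mult_left_mono C(2) s) auto
  also have "\<dots> = ennreal (LBINT x. (v x)\<^sup>2) * ennreal C"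
    by (subst nn_integral_multc) (auto simp: nn_integral_eq_integral[OF v(2)])
  finally have G2: "(\<integral>\<^sup>+p. (?g p)\<^sup>2 \<partial>?P) \<le> ennreal (LBINT x. (v x)\<^sup>2) * ennreal C" .
  have "?N\<^sup>2 = (\<integral>\<^sup>+p. ?f p * ?g p \<partial>?P)\<^sup>2" by (simp only: fg)
  also have "\<dots> \<le> (\<integral>\<^sup>+p. (?f p)\<^sup>2 \<partial>?P) * (\<integral>\<^sup>+p. (?g p)\<^sup>2 \<partial>?P)"
    by (rule Cauchy_Schwarz_nn_integral) measurable
  also have "\<dots> \<le> ennreal (LBINT x. (\<phi> x)\<^sup>2) * (ennreal (LBINT x. (v x)\<^sup>2) * ennreal C)"
    unfolding F2 by (intro mult_left_mono G2) auto
  also have "\<dots> = ennreal ((sqrt C * sqrt (LBINT x. (\<phi> x)\<^sup>2) * sqrt (LBINT x. (v x)\<^sup>2))\<^sup>2)"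
    using C(1) by (simp add: ennreal_mult[symmetric] power_mult_distrib mult_ac)
  also have "\<dots> = (ennreal (sqrt C * sqrt (LBINT x. (\<phi> x)\<^sup>2) * sqrt (LBINT x. (v x)\<^sup>2)))\<^sup>2"
    using C(1) by (subst ennreal_power) auto
  finally have N: "?N \<le> ennreal (sqrt C * sqrt (LBINT x. (\<phi> x)\<^sup>2) * sqrt (LBINT x. (v x)\<^sup>2))"
    by (rule ennreal_le_of_power2_le) (use C(1) in simp)
  have "(LBINT x. \<phi> x * (LBINT z. v z * K \<alpha> s x z)) = (\<integral>p. \<phi> (fst p) * v (snd p) * K \<alpha> s (fst p) (snd p) \<partial>?P)"
    by (rule Fub(3)[symmetric])
  then have "ennreal \<bar>J \<phi> v \<alpha> s\<bar> = ennreal (norm (\<integral>p. \<phi> (fst p) * v (snd p) * K \<alpha> s (fst p) (snd p) \<partial>?P))"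
    by (simp only: J_def real_norm_def)
  also have "\<dots> \<le> (\<integral>\<^sup>+p. ennreal (norm (\<phi> (fst p) * v (snd p) * K \<alpha> s (fst p) (snd p))) \<partial>?P)"
    by (rule integral_norm_bound_ennreal[OF Fub(1)])
  also have "\<dots> \<le> (\<integral>\<^sup>+p. ennreal ?h * ennreal (\<bar>\<phi> (fst p)\<bar> * \<bar>v (snd p)\<bar> * K0 s (fst p) (snd p)) \<partial>?P)"
  proof (rule nn_integral_mono)
    fix p :: "(real^'n) \<times> (real^'n)"
    have "\<bar>\<phi> (fst p)\<bar> * \<bar>v (snd p)\<bar> * \<bar>K \<alpha> s (fst p) (snd p)\<bar> \<le>
        \<bar>\<phi> (fst p)\<bar> * \<bar>v (snd p)\<bar> * (?h * K0 s (fst p) (snd p))"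
    proof (cases "\<phi> (fst p) = 0")
      case False
      show ?thesis by (intro mult_left_mono K_le D False s) auto
    qed simp
    then show "ennreal (norm (\<phi> (fst p) * v (snd p) * K \<alpha> s (fst p) (snd p))) \<le>
        ennreal ?h * ennreal (\<bar>\<phi> (fst p)\<bar> * \<bar>v (snd p)\<bar> * K0 s (fst p) (snd p))"
      using h by (subst ennreal_mult'[symmetric]) (auto simp: abs_mult mult_ac intro!: ennreal_leI)
  qed
  also have "\<dots> = ennreal ?h * ?N" by (subst nn_integral_cmult) auto
  also have "\<dots> \<le> ennreal ?h * ennreal (sqrt C * sqrt (LBINT x. (\<phi> x)\<^sup>2) * sqrt (LBINT x. (v x)\<^sup>2))"
    by (intro mult_left_mono N) simp
  finally have "ennreal \<bar>J \<phi> v \<alpha> s\<bar> \<le>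
      ennreal (?h * (sqrt C * sqrt (LBINT x. (\<phi> x)\<^sup>2) * sqrt (LBINT x. (v x)\<^sup>2)))"
    by (subst ennreal_mult'[OF h])
  moreover have "0 \<le> ?h * (sqrt C * sqrt (LBINT x. (\<phi> x)\<^sup>2) * sqrt (LBINT x. (v x)\<^sup>2))"
    using h C(1) by (intro mult_nonneg_nonneg) auto
  ultimately show ?thesis by (simp only: ennreal_le_iff)
qed

end

section \<open>The Taylor formula and its remainder\<close>

context star_kernel
begin

lemma D_borel [measurable]: "D \<in> sets borel"
  using open_D by simp

lemma indicator_bounded:
  assumes "\<And>x. \<bar>f x\<bar> \<le> M"
  shows "\<bar>f x * indicator D x\<bar> \<le> (M::real)"
  using assms[of x] order_trans[OF abs_ge_zero assms[of x]] by (auto simp: indicator_def)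

text \<open>
  Returning from the variable \<open>x\<close> to \<open>y\<close> in \<open>z = (1 - s) x + s y\<close>, for fixed \<open>z\<close>. In this form the
  behaviour for small \<open>s\<close> is visible.
\<close>

lemma K0_transform:
  assumes [measurable]: "\<phi> \<in> borel_measurable borel" and s: "0 < s" "s < 1"
  shows "(LBINT x. \<phi> x * K0 s x z) = (1 / (1 - s)) ^ CARD('n) *
    (LBINT y. \<phi> ((1 / (1 - s)) *\<^sub>R z + (- s / (1 - s)) *\<^sub>R y) * \<Psi> y)"
proof -
  let ?t = "(1 / (1 - s)) *\<^sub>R z" and ?c = "- s / (1 - s)"
  have [measurable]: "(\<lambda>x. K0 s x z) \<in> borel_measurable borel" unfolding K0_eq by measurable
  have "?t + ?c *\<^sub>R y + (1 / s) *\<^sub>R (z - (?t + ?c *\<^sub>R y)) = y" for y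
  proof -
    have "(?t + ?c *\<^sub>R y + (1 / s) *\<^sub>R (z - (?t + ?c *\<^sub>R y))) $ i = y $ i" for i
      using s by (simp add: divide_simps) algebra
    then show ?thesis by (simp add: vec_eq_iff)
  qed
  then have K: "K0 s (?t + ?c *\<^sub>R y) z = \<Psi> y / s ^ CARD('n)" for y
    by (simp only: K0_eq)
  have "(LBINT x. \<phi> x * K0 s x z) =
      \<bar>?c\<bar> ^ DIM(real^'n) * (LBINT y. \<phi> (?t + ?c *\<^sub>R y) * K0 s (?t + ?c *\<^sub>R y) z)"
    by (rule integral_lborel_affine) (use s in auto)
  also have "\<dots> = \<bar>?c\<bar> ^ CARD('n) * ((LBINT y. \<phi> (?t + ?c *\<^sub>R y) * \<Psi> y) / s ^ CARD('n))"
    unfolding K by simp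
  also have "\<dots> = (\<bar>?c\<bar> / s) ^ CARD('n) * (LBINT y. \<phi> (?t + ?c *\<^sub>R y) * \<Psi> y)"
    using s by (simp add: power_divide power_mult_distrib)
  also have "\<bar>?c\<bar> / s = 1 / (1 - s)" using s by (simp add: abs_divide)
  finally show ?thesis .
qed

text \<open>
  For fixed \<open>y\<close> the point \<open>x = (z - s y) / (1 - s)\<close> tends to \<open>z\<close>. As \<open>D\<close> is open, it is eventually in \<open>D\<close>, so
  cutting \<open>f\<close> off outside \<open>D\<close> does no harm.
\<close>

lemma K0_approximate_identity:
  assumes f: "continuous_on UNIV f" "\<And>x. \<bar>f x\<bar> \<le> M" and z: "z \<in> D"
    and X: "\<And>n. 0 < X n" "\<And>n. X n \<le> 1 / 2" "X \<longlonglongrightarrow> 0"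
  shows "(\<lambda>n. LBINT x. f x * indicator D x * K0 (X n) x z) \<longlonglongrightarrow> f z"
proof -
  let ?\<phi> = "\<lambda>x. f x * indicator D x"
  have [measurable]: "f \<in> borel_measurable borel" using f(1) by (rule borel_measurable_continuous_onI)
  let ?u = "\<lambda>n y. ?\<phi> ((1 / (1 - X n)) *\<^sub>R z + (- X n / (1 - X n)) *\<^sub>R y)"
  have lim: "(\<lambda>n. ?u n y) \<longlonglongrightarrow> f z" for y
  proof -
    have "(\<lambda>n. (1 / (1 - X n)) *\<^sub>R z + (- X n / (1 - X n)) *\<^sub>R y) \<longlonglongrightarrow>
        (1 / (1 - 0)) *\<^sub>R z + (- 0 / (1 - 0)) *\<^sub>R y"
      by (intro tendsto_intros X(3)) auto
    then have p: "(\<lambda>n. (1 / (1 - X n)) *\<^sub>R z + (- X n / (1 - X n)) *\<^sub>R y) \<longlonglongrightarrow> z" by simp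
    have "isCont f z" using f(1) by (simp add: continuous_on_eq_continuous_at)
    from isCont_tendsto_compose[OF this p]
    have "(\<lambda>n. f ((1 / (1 - X n)) *\<^sub>R z + (- X n / (1 - X n)) *\<^sub>R y)) \<longlonglongrightarrow> f z" .
    moreover have "\<forall>\<^sub>F n in sequentially. (1 / (1 - X n)) *\<^sub>R z + (- X n / (1 - X n)) *\<^sub>R y \<in> D"
      by (rule topological_tendstoD[OF p open_D z])
    then have "\<forall>\<^sub>F n in sequentially. f ((1 / (1 - X n)) *\<^sub>R z + (- X n / (1 - X n)) *\<^sub>R y) = ?u n y"
      by eventually_elim simp
    ultimately show ?thesis by (rule Lim_transform_eventually)
  qed
  have "(\<lambda>n. LBINT y. ?u n y * \<Psi> y) \<longlonglongrightarrow> (LBINT y. f z * \<Psi> y)"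
  proof (rule integral_dominated_convergence[where w = "\<lambda>y. M * \<Psi> y"])
    show "integrable lborel (\<lambda>y. M * \<Psi> y)" using \<Psi>_integrable by simp
    show "AE y in lborel. (\<lambda>n. ?u n y * \<Psi> y) \<longlonglongrightarrow> f z * \<Psi> y"
      by (intro AE_I2 tendsto_mult lim tendsto_const)
    show "AE y in lborel. norm (?u n y * \<Psi> y) \<le> M * \<Psi> y" for n
    proof (rule AE_I2)
      fix y
      show "norm (?u n y * \<Psi> y) \<le> M * \<Psi> y"
        using mult_right_mono[OF indicator_bounded[OF f(2)] \<Psi>_nonneg] \<Psi>_nonneg[of y]
        by (simp add: abs_mult)
    qed
  qed measurable
  then have "(\<lambda>n. (1 / (1 - X n)) ^ CARD('n) * (LBINT y. ?u n y * \<Psi> y)) \<longlonglongrightarrow>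
      (1 / (1 - 0)) ^ CARD('n) * (LBINT y. f z * \<Psi> y)"
    by (intro tendsto_intros X(3)) auto
  also have "(1 / (1 - 0)) ^ CARD('n) * (LBINT y. f z * \<Psi> y) = f z"
    by (simp add: \<psi>_integral)
  also have "(\<lambda>n. (1 / (1 - X n)) ^ CARD('n) * (LBINT y. ?u n y * \<Psi> y)) =
      (\<lambda>n. LBINT x. ?\<phi> x * K0 (X n) x z)"
  proof
    fix n
    have "X n < 1" using X(2)[of n] by linarith
    from K0_transform[OF _ X(1) this, of ?\<phi> z, symmetric]
    show "(1 / (1 - X n)) ^ CARD('n) * (LBINT y. ?u n y * \<Psi> y) = (LBINT x. ?\<phi> x * K0 (X n) x z)"
      by simp
  qed
  finally show ?thesis .
qed

lemma K0_average_bound: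
  assumes f: "f \<in> borel_measurable borel" "\<And>x. \<bar>f x\<bar> \<le> M" and s: "0 < s" "s \<le> 1 / 2"
  shows "\<bar>\<integral>x. f x * indicator D x * K0 s x z \<partial>lborel\<bar> \<le> 2 ^ CARD('n) * M"
proof -
  note [measurable] = f(1)
  let ?\<phi> = "\<lambda>x. f x * indicator D x"
  let ?u = "\<lambda>y. ?\<phi> ((1 / (1 - s)) *\<^sub>R z + (- s / (1 - s)) *\<^sub>R y)"
  have M: "M \<ge> 0" using f(2)[of 0] by linarith
  have "\<bar>\<integral>y. ?u y * \<Psi> y \<partial>lborel\<bar> \<le> (LBINT y. M * \<Psi> y)"
  proof (rule integral_abs_bound[THEN order_trans], rule integral_mono_AE')
    show "integrable lborel (\<lambda>y. M * \<Psi> y)" using \<Psi>_integrable by simp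
    have "\<bar>?u y * \<Psi> y\<bar> \<le> M * \<Psi> y" for y
      using mult_right_mono[OF indicator_bounded[OF f(2)] \<Psi>_nonneg] \<Psi>_nonneg[of y]
      by (simp add: abs_mult)
    then show "AE y in lborel. \<bar>?u y * \<Psi> y\<bar> \<le> M * \<Psi> y" by simp
  qed (simp add: M \<Psi>_nonneg)
  also have "(LBINT y. M * \<Psi> y) = M" by (simp add: \<psi>_integral)
  finally have 1: "\<bar>\<integral>y. ?u y * \<Psi> y \<partial>lborel\<bar> \<le> M" .
  have "1 / (1 - s) \<le> 2" using s by (simp add: field_simps)
  then have "(1 / (1 - s)) ^ CARD('n) \<le> 2 ^ CARD('n)" using s by (intro power_mono) auto
  with 1 M s show ?thesis
    by (subst K0_transform) (auto simp: abs_mult intro!: mult_mono)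
qed

lemma null_sequence_below_half:
  "\<exists>X :: nat \<Rightarrow> real. (\<forall>n. 0 < X n \<and> X n \<le> 1 / 2) \<and> X \<longlonglongrightarrow> 0"
proof (intro exI conjI allI)
  show "(\<lambda>n. 1 / real (n + 3)) \<longlonglongrightarrow> 0" by (rule LIMSEQ_ignore_initial_segment[OF lim_1_over_n])
qed (auto simp: field_simps)

lemma J_tendsto:
  assumes f: "continuous_on UNIV f" "\<And>x. \<bar>f x\<bar> \<le> M"
    and v: "integrable lborel v" "\<And>x. x \<notin> D \<Longrightarrow> v x = 0"
    and X: "\<And>n. 0 < X n" "\<And>n. X n \<le> 1 / 2" "X \<longlonglongrightarrow> 0"
  shows "(\<lambda>n. J (\<lambda>x. f x * indicator D x) v (\<lambda>_. 0) (X n)) \<longlonglongrightarrow> (LBINT x. f x * v x)"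
proof -
  let ?\<phi> = "\<lambda>x. f x * indicator D x"
  have [measurable]: "f \<in> borel_measurable borel" using f(1) by (rule borel_measurable_continuous_onI)
  have [measurable]: "v \<in> borel_measurable borel" using v by auto
  have \<phi>: "integrable lborel ?\<phi>"
    by (rule integrable_bounded_support[OF _ bounded_D D_borel, of _ M]) (use f(2) in auto)
  have swap: "J ?\<phi> v (\<lambda>_. 0) s = (LBINT z. v z * (LBINT x. ?\<phi> x * K0 s x z))" if s: "s > 0" for s
  proof -
    obtain B where B: "\<And>x t z. x \<in> D \<Longrightarrow> t > s / 2 \<Longrightarrow> \<bar>K0 t x z\<bar> \<le> B"
      using K_bounds[of "s / 2" "\<lambda>_. 0"] s by (metis half_gt_zero)
    have "\<bar>K0 s x z\<bar> \<le> B" if "?\<phi> x \<noteq> 0" for x z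
      using B[of x s z] that s by (auto simp: indicator_def split: if_splits)
    note Fub = Fubini_times_bounded[where f = ?\<phi> and g = v and G = "K0 s" and C = B,
        OF \<phi> v(1) K_measurable this]
    have "integrable (lborel \<Otimes>\<^sub>M lborel) (\<lambda>(x, z). ?\<phi> x * v z * K0 s x z)"
      unfolding case_prod_beta' by (rule Fub(1))
    from lborel_pair.integral_snd[OF this]
    have "(LBINT z. (LBINT x. ?\<phi> x * v z * K0 s x z)) =
        (\<integral>p. ?\<phi> (fst p) * v (snd p) * K0 s (fst p) (snd p) \<partial>(lborel \<Otimes>\<^sub>M lborel))"
      by (simp only: case_prod_beta')
    also have "\<dots> = J ?\<phi> v (\<lambda>_. 0) s" unfolding J_def by (rule Fub(3))
    finally have "J ?\<phi> v (\<lambda>_. 0) s = (LBINT z. (LBINT x. v z * (?\<phi> x * K0 s x z)))"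
      by (simp add: mult_ac)
    then show ?thesis by simp
  qed
  have "(\<lambda>n. LBINT z. v z * (LBINT x. ?\<phi> x * K0 (X n) x z)) \<longlonglongrightarrow> (LBINT z. v z * f z)"
  proof (rule integral_dominated_convergence[where w = "\<lambda>z. 2 ^ CARD('n) * M * \<bar>v z\<bar>"])
    show "integrable lborel (\<lambda>z. 2 ^ CARD('n) * M * \<bar>v z\<bar>)" using v by simp
    show "(\<lambda>z. v z * (LBINT x. ?\<phi> x * K0 (X n) x z)) \<in> borel_measurable lborel" for n
      unfolding K0_eq by measurable
    show "AE z in lborel. (\<lambda>n. v z * (LBINT x. ?\<phi> x * K0 (X n) x z)) \<longlonglongrightarrow> v z * f z"
    proof (rule AE_I2)
      fix z show "(\<lambda>n. v z * (LBINT x. ?\<phi> x * K0 (X n) x z)) \<longlonglongrightarrow> v z * f z"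
      proof (cases "z \<in> D")
        case True
        show ?thesis by (intro tendsto_mult tendsto_const K0_approximate_identity[OF f True X])
      qed (simp add: v(2))
    qed
    show "AE z in lborel. norm (v z * (LBINT x. ?\<phi> x * K0 (X n) x z)) \<le> 2 ^ CARD('n) * M * \<bar>v z\<bar>" for n
    proof (rule AE_I2)
      fix z
      have "\<bar>\<integral>x. ?\<phi> x * K0 (X n) x z \<partial>lborel\<bar> \<le> 2 ^ CARD('n) * M"
        by (rule K0_average_bound[OF _ f(2) X(1,2)]) simp
      from mult_left_mono[OF this, of "\<bar>v z\<bar>"]
      show "norm (v z * (LBINT x. ?\<phi> x * K0 (X n) x z)) \<le> 2 ^ CARD('n) * M * \<bar>v z\<bar>"
        by (simp add: abs_mult mult_ac)
    qed
  qed measurable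
  then show ?thesis using swap[OF X(1)] by (simp add: mult.commute)
qed

text \<open>
  Since \<open>K \<alpha> 1 x z\<close> is \<open>(z - x)\<^sup>\<alpha> / \<alpha>!\<close> times the bump function at \<open>z\<close>, the signs make this the Taylor
  polynomial at \<open>z\<close>, of degree less than \<open>m\<close>, averaged over \<open>z\<close>. The weight of a jet is the right-hand
  side of the remainder estimate without its dependence on \<open>D\<close>.
\<close>

definition averaged_taylor :: "('n multi_index \<Rightarrow> real^'n \<Rightarrow> real) \<Rightarrow> nat \<Rightarrow> real^'n \<Rightarrow> real" where
  "averaged_taylor V m x = (\<Sum>j<m. (-1) ^ j * (\<Sum>\<alpha> | mi_order \<alpha> = j. LBINT z. V \<alpha> z * K \<alpha> 1 x z))"

definition taylor_weight :: "nat \<Rightarrow> ('n multi_index \<Rightarrow> real^'n \<Rightarrow> real) \<Rightarrow> real" where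
  "taylor_weight m V = (\<Sum>\<alpha> | mi_order \<alpha> = m.
     sqrt (LBINT x. (V \<alpha> x)\<^sup>2) / mi_fact \<alpha>)"

lemma averaged_taylor_bounded:
  assumes "weak_jet D m V"
  obtains B where "\<And>x. x \<in> D \<Longrightarrow> \<bar>averaged_taylor V m x\<bar> \<le> B"
proof -
  have "\<exists>B. \<forall>x\<in>D. \<bar>\<integral>z. V \<alpha> z * K \<alpha> 1 x z \<partial>lborel\<bar> \<le> B" if \<alpha>: "mi_order \<alpha> \<le> m" for \<alpha>
  proof -
    obtain C where C: "\<And>x s z. x \<in> D \<Longrightarrow> s > 1 / 2 \<Longrightarrow> \<bar>K \<alpha> s x z\<bar> \<le> C"
      using K_bounds[of "1 / 2" \<alpha>] by (metis half_gt_zero zero_less_one)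
    have "\<bar>\<integral>z. V \<alpha> z * K \<alpha> 1 x z \<partial>lborel\<bar> \<le> (LBINT z. C * \<bar>V \<alpha> z\<bar>)" if "x \<in> D" for x
    proof (rule integral_abs_bound[THEN order_trans], rule integral_mono_AE')
      show "integrable lborel (\<lambda>z. C * \<bar>V \<alpha> z\<bar>)" using weak_jetD(1)[OF assms \<alpha>] by simp
      have "\<bar>V \<alpha> z * K \<alpha> 1 x z\<bar> \<le> C * \<bar>V \<alpha> z\<bar>" for z
        using mult_left_mono[OF C[OF that, of 1 z], of "\<bar>V \<alpha> z\<bar>"] by (simp add: abs_mult mult.commute)
      then show "AE z in lborel. \<bar>V \<alpha> z * K \<alpha> 1 x z\<bar> \<le> C * \<bar>V \<alpha> z\<bar>" by simp
      have "C \<ge> 0" using order_trans[OF abs_ge_zero C[OF that, of 1]] by simp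
      then show "AE z in lborel. 0 \<le> C * \<bar>V \<alpha> z\<bar>" by simp
    qed
    then show ?thesis by blast
  qed
  then obtain B where B: "\<And>\<alpha> x. mi_order \<alpha> \<le> m \<Longrightarrow> x \<in> D \<Longrightarrow> \<bar>\<integral>z. V \<alpha> z * K \<alpha> 1 x z \<partial>lborel\<bar> \<le> B \<alpha>"
    by metis
  show thesis
  proof (rule that[of "\<Sum>j<m. \<Sum>\<alpha> | mi_order \<alpha> = j. B \<alpha>"])
    fix x assume "x \<in> D"
    then show "\<bar>averaged_taylor V m x\<bar> \<le> (\<Sum>j<m. \<Sum>\<alpha> | mi_order \<alpha> = j. B \<alpha>)"
      unfolding averaged_taylor_def
      by (intro order_trans[OF sum_abs] sum_mono)
         (auto simp: abs_mult intro!: order_trans[OF sum_abs] sum_mono B)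
  qed
qed

lemma averaged_taylor_measurable:
  assumes "weak_jet D m V"
  shows "averaged_taylor V m \<in> borel_measurable borel"
proof -
  have "(\<lambda>x. LBINT z. V \<alpha> z * K \<alpha> 1 x z) \<in> borel_measurable borel" if "mi_order \<alpha> \<le> m" for \<alpha>
  proof -
    have [measurable]: "V \<alpha> \<in> borel_measurable borel" using weak_jetD(1)[OF assms that] by auto
    have "(\<lambda>p. V \<alpha> (snd p) * K \<alpha> 1 (fst p) (snd p)) \<in> borel_measurable (lborel \<Otimes>\<^sub>M lborel)" by measurable
    then have "(\<lambda>(x, z). V \<alpha> z * K \<alpha> 1 x z) \<in> borel_measurable (borel \<Otimes>\<^sub>M lborel)"
      by (simp add: case_prod_beta cong: measurable_cong_sets)
    then show ?thesis by (rule lborel.borel_measurable_lebesgue_integral)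
  qed
  then show ?thesis unfolding averaged_taylor_def[abs_def]
    by (intro borel_measurable_sum borel_measurable_times borel_measurable_const) auto
qed

text \<open>
  Taylor's theorem for \<open>F\<close> on \<open>[s, 1]\<close>, expanded at \<open>1\<close>, followed by \<open>s \<rightarrow> 0\<close>. The remainder stays
  bounded because \<open>J_bound\<close> is uniform in \<open>s\<close>.
\<close>

lemma taylor_remainder_pairing:
  assumes V: "weak_jet D m V" "m > 0"
    and C: "C \<ge> 0" "\<And>s z. 0 < s \<Longrightarrow> s < 1 \<Longrightarrow> (\<integral>\<^sup>+x. K0 s x z * indicator D x \<partial>lborel) \<le> ennreal C"
    and f: "continuous_on UNIV f" "\<And>x. \<bar>f x\<bar> \<le> M"
  shows "\<bar>\<integral>x. f x * indicator D x * (V (\<lambda>_. 0) x - averaged_taylor V m x) \<partial>lborel\<bar> \<le>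
    diameter D ^ m * sqrt C * taylor_weight m V * sqrt (LBINT x. (f x * indicator D x)\<^sup>2)"
proof -
  let ?\<phi> = "\<lambda>x. f x * indicator D x" and ?A = "averaged_taylor V m"
  let ?R = "diameter D ^ m * sqrt C * taylor_weight m V * sqrt (LBINT x. (?\<phi> x)\<^sup>2)"
  have [measurable]: "f \<in> borel_measurable borel" using f(1) by (rule borel_measurable_continuous_onI)
  have \<phi>: "integrable lborel ?\<phi>" "\<And>x. x \<notin> D \<Longrightarrow> ?\<phi> x = 0"
    by (rule integrable_bounded_support[OF _ bounded_D D_borel, of _ M]) (use f(2) in auto)
  have "(f x)\<^sup>2 \<le> M\<^sup>2" for x
    using power_mono[OF f(2) abs_ge_zero, of x 2] by simp
  then have \<phi>2: "integrable lborel (\<lambda>x. (?\<phi> x)\<^sup>2)"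
    by (intro integrable_bounded_support[OF _ bounded_D D_borel, of _ "M\<^sup>2"]) auto
  have V0: "integrable lborel (V (\<lambda>_. 0))" "\<And>x. x \<notin> D \<Longrightarrow> V (\<lambda>_. 0) x = 0"
    using weak_jetD[OF V(1), of "\<lambda>_. 0"] by (auto simp: mi_order_def)
  have Fm: "\<bar>F ?\<phi> V m t\<bar> \<le> fact m * ?R" if t: "0 < t" "t < 1" for t
  proof -
    have "\<bar>J ?\<phi> (V \<alpha>) \<alpha> t\<bar> \<le> diameter D ^ m * sqrt C * sqrt (LBINT x. (?\<phi> x)\<^sup>2) *
        (sqrt (LBINT x. (V \<alpha> x)\<^sup>2) / mi_fact \<alpha>)" if "mi_order \<alpha> = m" for \<alpha>
      using J_bound[OF C \<phi> \<phi>2 _ _ t, of "V \<alpha>" \<alpha>] weak_jetD[OF V(1), of \<alpha>] that by (simp add: mult_ac)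
    note J = this
    have "\<bar>\<Sum>\<alpha> | mi_order \<alpha> = m. J ?\<phi> (V \<alpha>) \<alpha> t\<bar> \<le> (\<Sum>\<alpha> | mi_order \<alpha> = m. \<bar>J ?\<phi> (V \<alpha>) \<alpha> t\<bar>)"
      by (rule sum_abs)
    also have "\<dots> \<le> (\<Sum>\<alpha> | mi_order \<alpha> = m. diameter D ^ m * sqrt C * sqrt (LBINT x. (?\<phi> x)\<^sup>2) *
        (sqrt (LBINT x. (V \<alpha> x)\<^sup>2) / mi_fact \<alpha>))"
      by (rule sum_mono, rule J) simp
    also have "\<dots> = ?R"
      unfolding taylor_weight_def sum_distrib_left[symmetric] by (simp only: mult_ac)
    finally have "\<bar>\<Sum>\<alpha> | mi_order \<alpha> = m. J ?\<phi> (V \<alpha>) \<alpha> t\<bar> \<le> ?R" .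
    then show ?thesis by (simp add: F_def abs_mult)
  qed
  have taylor: "\<bar>F ?\<phi> V 0 s - (\<Sum>j<m. F ?\<phi> V j 1 / fact j * (s - 1) ^ j)\<bar> \<le> ?R" if s: "0 < s" "s < 1" for s
  proof -
    have "\<exists>t. (if s < 1 then s < t \<and> t < 1 else 1 < t \<and> t < s) \<and>
      F ?\<phi> V 0 s = (\<Sum>j<m. F ?\<phi> V j 1 / fact j * (s - 1) ^ j) + F ?\<phi> V m t / fact m * (s - 1) ^ m"
    proof (rule Taylor[OF V(2) refl, of s 1])
      show "\<forall>j t. j < m \<and> s \<le> t \<and> t \<le> 1 \<longrightarrow> DERIV (F ?\<phi> V j) t :> F ?\<phi> V (Suc j) t"
        using s by (auto intro!: F_has_derivative[OF V(1) _ \<phi>])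
    qed (use s in auto)
    then obtain t where t: "s < t" "t < 1"
      "F ?\<phi> V 0 s = (\<Sum>j<m. F ?\<phi> V j 1 / fact j * (s - 1) ^ j) + F ?\<phi> V m t / fact m * (s - 1) ^ m"
      using s by auto
    have pw: "\<bar>s - 1\<bar> ^ m \<le> 1" using s by (intro power_le_one) auto
    have b: "\<bar>F ?\<phi> V m t / fact m\<bar> \<le> ?R"
      using Fm[of t] t s by (simp add: abs_divide divide_le_eq mult.commute)
    have "\<bar>F ?\<phi> V m t / fact m\<bar> * \<bar>s - 1\<bar> ^ m \<le> ?R * 1"
      by (intro mult_mono b pw order_trans[OF abs_ge_zero b]) simp
    then show ?thesis using t(3) by (simp add: abs_mult power_abs)
  qed
  obtain X :: "nat \<Rightarrow> real" where X: "\<And>n. 0 < X n" "\<And>n. X n \<le> 1 / 2" "X \<longlonglongrightarrow> 0"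
    using null_sequence_below_half by blast
  have X1: "X n < 1" for n using X(2)[of n] by linarith
  have "{\<alpha> :: 'n multi_index. mi_order \<alpha> = 0} = {\<lambda>_. 0}" by (auto simp: mi_order_def)
  then have F0: "F ?\<phi> V 0 s = J ?\<phi> (V (\<lambda>_. 0)) (\<lambda>_. 0) s" for s by (simp add: F_def)
  have "(\<lambda>n. F ?\<phi> V 0 (X n) - (\<Sum>j<m. F ?\<phi> V j 1 / fact j * (X n - 1) ^ j)) \<longlonglongrightarrow>
      (LBINT x. f x * V (\<lambda>_. 0) x) - (\<Sum>j<m. F ?\<phi> V j 1 / fact j * (0 - 1) ^ j)"
    unfolding F0 by (intro tendsto_intros J_tendsto[OF f V0] X)
  then have "\<bar>(LBINT x. f x * V (\<lambda>_. 0) x) - (\<Sum>j<m. F ?\<phi> V j 1 / fact j * (0 - 1) ^ j)\<bar> \<le> ?R"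
  proof (rule LIMSEQ_le_const2[OF tendsto_rabs])
    show "\<exists>N. \<forall>n\<ge>N. \<bar>F ?\<phi> V 0 (X n) - (\<Sum>j<m. F ?\<phi> V j 1 / fact j * (X n - 1) ^ j)\<bar> \<le> ?R"
      using taylor[OF X(1) X1] by blast
  qed
  also have "(LBINT x. f x * V (\<lambda>_. 0) x) = (LBINT x. ?\<phi> x * V (\<lambda>_. 0) x)"
    by (rule Bochner_Integration.integral_cong) (use V0(2) in \<open>auto simp: indicator_def\<close>)
  also have "(\<Sum>j<m. F ?\<phi> V j 1 / fact j * (0 - 1) ^ j) = (LBINT x. ?\<phi> x * ?A x)"
  proof -
    have "(\<Sum>j<m. F ?\<phi> V j 1 / fact j * (0 - 1) ^ j) =
        (\<Sum>j<m. \<Sum>\<alpha> | mi_order \<alpha> = j. (-1) ^ j * J ?\<phi> (V \<alpha>) \<alpha> 1)"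
    proof (rule sum.cong[OF refl])
      fix j
      have "F ?\<phi> V j 1 / fact j = (\<Sum>\<alpha> | mi_order \<alpha> = j. J ?\<phi> (V \<alpha>) \<alpha> 1)" by (simp add: F_def)
      then show "F ?\<phi> V j 1 / fact j * (0 - 1) ^ j = (\<Sum>\<alpha> | mi_order \<alpha> = j. (-1) ^ j * J ?\<phi> (V \<alpha>) \<alpha> 1)"
        by (simp only: sum_distrib_left diff_0 mult.commute)
    qed
    also have "\<dots> = (LBINT x. (\<Sum>j<m. \<Sum>\<alpha> | mi_order \<alpha> = j. (-1) ^ j * (?\<phi> x * (LBINT z. V \<alpha> z * K \<alpha> 1 x z))))"
    proof -
      have int: "integrable lborel (\<lambda>x. ?\<phi> x * (LBINT z. V \<alpha> z * K \<alpha> 1 x z))" if "mi_order \<alpha> < m" for \<alpha>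
        using weak_jetD(1)[OF V(1), of \<alpha>] that by (intro integrable_J[OF \<phi>]) auto
      have "(LBINT x. (\<Sum>j<m. \<Sum>\<alpha> | mi_order \<alpha> = j. (-1) ^ j * (?\<phi> x * (LBINT z. V \<alpha> z * K \<alpha> 1 x z))))
         = (\<Sum>j<m. LBINT x. (\<Sum>\<alpha> | mi_order \<alpha> = j. (-1) ^ j * (?\<phi> x * (LBINT z. V \<alpha> z * K \<alpha> 1 x z))))"
        by (intro Bochner_Integration.integral_sum Bochner_Integration.integrable_sum integrable_mult_right int) simp
      also have "\<dots> = (\<Sum>j<m. \<Sum>\<alpha> | mi_order \<alpha> = j. LBINT x. (-1) ^ j * (?\<phi> x * (LBINT z. V \<alpha> z * K \<alpha> 1 x z)))"
        by (intro sum.cong refl Bochner_Integration.integral_sum integrable_mult_right int) simp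
      finally show ?thesis by (simp add: J_def)
    qed
    also have "\<dots> = (LBINT x. ?\<phi> x * ?A x)"
      by (simp add: averaged_taylor_def sum_distrib_left mult_ac)
    finally show ?thesis .
  qed
  also have "(LBINT x. ?\<phi> x * V (\<lambda>_. 0) x) - (LBINT x. ?\<phi> x * ?A x) =
      (LBINT x. ?\<phi> x * (V (\<lambda>_. 0) x - ?A x))"
  proof -
    obtain B where B: "\<And>x. x \<in> D \<Longrightarrow> \<bar>?A x\<bar> \<le> B" using averaged_taylor_bounded[OF V(1)] by blast
    have "integrable lborel (\<lambda>x. ?\<phi> x * ?A x)"
      using B averaged_taylor_measurable[OF V(1)]
      by (intro integrable_times_bounded[OF \<phi>(1), where C = B]) (auto simp: indicator_def split: if_splits)
    moreover have "integrable lborel (\<lambda>x. V (\<lambda>_. 0) x * ?\<phi> x)"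
      by (intro integrable_times_bounded[OF V0(1), where C = M] indicator_bounded f) simp
    then have "integrable lborel (\<lambda>x. ?\<phi> x * V (\<lambda>_. 0) x)" by (simp add: mult.commute)
    ultimately show ?thesis by (simp add: right_diff_distrib)
  qed
  finally show ?thesis .
qed

lemma taylor_remainder_L2:
  assumes V: "weak_jet D m V" "m > 0"
    and C: "C \<ge> 0" "\<And>s z. 0 < s \<Longrightarrow> s < 1 \<Longrightarrow> (\<integral>\<^sup>+x. K0 s x z * indicator D x \<partial>lborel) \<le> ennreal C"
  shows "(LBINT x. (indicator D x * (V (\<lambda>_. 0) x - averaged_taylor V m x))\<^sup>2) \<le>
    (diameter D ^ m * sqrt C * taylor_weight m V)\<^sup>2"
proof (rule L2_bound_by_duality[OF bounded_D D_borel])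
  let ?A = "averaged_taylor V m"
  have [measurable]: "?A \<in> borel_measurable borel" by (rule averaged_taylor_measurable[OF V(1)])
  obtain B where B: "\<And>x. x \<in> D \<Longrightarrow> \<bar>?A x\<bar> \<le> B" using averaged_taylor_bounded[OF V(1)] by blast
  have V0: "integrable lborel (V (\<lambda>_. 0))" "integrable lborel (\<lambda>x. (V (\<lambda>_. 0) x)\<^sup>2)"
    "\<And>x. x \<notin> D \<Longrightarrow> V (\<lambda>_. 0) x = 0"
    using weak_jetD[OF V(1), of "\<lambda>_. 0"] by (auto simp: mi_order_def)
  have A: "integrable lborel (\<lambda>x. indicator D x * ?A x)" "integrable lborel (\<lambda>x. (indicator D x * ?A x)\<^sup>2)"
  proof -
    have B2: "(?A x)\<^sup>2 \<le> B\<^sup>2" if "x \<in> D" for x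
      using power_mono[OF B[OF that] abs_ge_zero, of 2] by simp
    show "integrable lborel (\<lambda>x. indicator D x * ?A x)"
      using B by (intro integrable_bounded_support[OF _ bounded_D D_borel, of _ B]) auto
    show "integrable lborel (\<lambda>x. (indicator D x * ?A x)\<^sup>2)"
      using B2 by (intro integrable_bounded_support[OF _ bounded_D D_borel, of _ "B\<^sup>2"]) auto
  qed
  have eq: "indicator D x * (V (\<lambda>_. 0) x - ?A x) = V (\<lambda>_. 0) x - indicator D x * ?A x" for x
    using V0(3)[of x] by (auto simp: indicator_def)
  show "integrable lborel (\<lambda>x. indicator D x * (V (\<lambda>_. 0) x - ?A x))"
    unfolding eq using V0(1) A(1) by simp
  show "integrable lborel (\<lambda>x. (indicator D x * (V (\<lambda>_. 0) x - ?A x))\<^sup>2)"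
  proof (rule Bochner_Integration.integrable_bound)
    show "integrable lborel (\<lambda>x. 2 * (V (\<lambda>_. 0) x)\<^sup>2 + 2 * (indicator D x * ?A x)\<^sup>2)"
      using V0(2) A(2) by simp
    have "(p - q)\<^sup>2 \<le> 2 * p\<^sup>2 + 2 * q\<^sup>2" for p q :: real
      using zero_le_power2[of "p + q"] by (simp add: power2_eq_square algebra_simps)
    then show "AE x in lborel. norm ((indicator D x * (V (\<lambda>_. 0) x - ?A x))\<^sup>2) \<le>
        norm (2 * (V (\<lambda>_. 0) x)\<^sup>2 + 2 * (indicator D x * ?A x)\<^sup>2)"
      unfolding eq by simp
    have [measurable]: "V (\<lambda>_. 0) \<in> borel_measurable borel" using V0 by auto
    show "(\<lambda>x. (indicator D x * (V (\<lambda>_. 0) x - ?A x))\<^sup>2) \<in> borel_measurable lborel" by measurable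
  qed
  show "diameter D ^ m * sqrt C * taylor_weight m V \<ge> 0"
    unfolding taylor_weight_def using diameter_ge_0[OF bounded_D] C(1)
    by (intro mult_nonneg_nonneg sum_nonneg divide_nonneg_nonneg prod_nonneg) auto
  fix f :: "real^'n \<Rightarrow> real" and M assume f: "continuous_on UNIV f" "\<And>x. \<bar>f x\<bar> \<le> M"
  have "f x * indicator D x * (indicator D x * (V (\<lambda>_. 0) x - ?A x)) = f x * indicator D x * (V (\<lambda>_. 0) x - ?A x)" for x
    by (simp add: indicator_def)
  note eq' = this
  show "\<bar>\<integral>x. f x * indicator D x * (indicator D x * (V (\<lambda>_. 0) x - ?A x)) \<partial>lborel\<bar> \<le>
    diameter D ^ m * sqrt C * taylor_weight m V * sqrt (LBINT x. (f x * indicator D x)\<^sup>2)"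
    unfolding eq' by (rule taylor_remainder_pairing[OF V C f])
qed simp

end

section \<open>Uniqueness of weak derivatives\<close>

text \<open>
  Lebesgue measure is complete, so a function that is only known to be a weak derivative becomes
  measurable once it agrees almost everywhere with a measurable one.
\<close>

lemma borel_measurable_lebesgue_AE_cong:
  fixes f g :: "'a::euclidean_space \<Rightarrow> real"
  assumes f: "f \<in> borel_measurable lebesgue" and eq: "AE x in lebesgue. f x = g x"
  shows "g \<in> borel_measurable lebesgue"
proof -
  have "negligible {x. f x \<noteq> g x}"
    using eq by (simp add: completion.AE_iff_null_sets negligible_iff_null_sets)
  moreover have "f measurable_on UNIV" using f by (simp add: lebesgue_measurable_imp_measurable_on)
  ultimately have "g measurable_on UNIV" by (elim measurable_on_spike) auto
  then show ?thesis by (simp add: measurable_on_iff_borel_measurable)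
qed

text \<open>
  The passage from Lebesgue integrals over \<open>S\<close> to integrals of Borel functions on the whole space,
  where Fubini's theorem for the product of Borel measures applies.
\<close>

lemma lebesgue_integral_representative:
  fixes F F' :: "'a::euclidean_space \<Rightarrow> real"
  assumes F': "F' \<in> borel_measurable borel" "\<And>x. x \<notin> S \<Longrightarrow> F' x = 0"
    and eq: "AE x in lebesgue. x \<in> S \<longrightarrow> F' x = F x"
  shows "(LINT x:S|lebesgue. F x) = (LBINT x. F' x)"
    and "set_integrable lebesgue S F \<longleftrightarrow> integrable lborel F'"
proof -
  have eq': "AE x in lebesgue. F' x = indicator S x *\<^sub>R F x"
    using eq by eventually_elim (use F'(2) in \<open>auto simp: indicator_def\<close>)
  have F'm: "F' \<in> borel_measurable lebesgue" using F'(1) by (simp add: measurable_completion)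
  note Fm = borel_measurable_lebesgue_AE_cong[OF F'm eq']
  have "(LINT x:S|lebesgue. F x) = (\<integral>x. F' x \<partial>lebesgue)"
    unfolding set_lebesgue_integral_def
    by (rule integral_cong_AE[OF Fm F'm]) (use eq' in \<open>simp add: eq_commute\<close>)
  also have "\<dots> = (LBINT x. F' x)" by (rule integral_completion) (use F'(1) in simp)
  finally show "(LINT x:S|lebesgue. F x) = (LBINT x. F' x)" .
  have "set_integrable lebesgue S F \<longleftrightarrow> integrable lebesgue F'"
    unfolding set_integrable_def
    by (rule integrable_cong_AE[OF Fm F'm]) (use eq' in \<open>simp add: eq_commute\<close>)
  also have "\<dots> \<longleftrightarrow> integrable lborel F'" by (rule integrable_completion) (use F'(1) in simp)
  finally show "set_integrable lebesgue S F \<longleftrightarrow> integrable lborel F'" .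
qed

lemma borel_representative:
  fixes w :: "'a::euclidean_space \<Rightarrow> real"
  assumes S: "S \<in> sets borel" and w: "set_borel_measurable lebesgue S w"
  obtains v where "v \<in> borel_measurable borel" "\<And>x. x \<notin> S \<Longrightarrow> v x = 0"
    "AE x in lebesgue. x \<in> S \<longrightarrow> v x = w x"
proof -
  have "(\<lambda>x. indicator S x *\<^sub>R w x) \<in> borel_measurable lebesgue"
    using w by (simp add: set_borel_measurable_def)
  from completion_ex_borel_measurable_real[OF this] obtain g
    where g: "g \<in> borel_measurable lborel" "AE x in lborel. indicator S x *\<^sub>R w x = g x" by blast
  show thesis
  proof (rule that[of "\<lambda>x. indicator S x * g x"])
    show "(\<lambda>x. indicator S x * g x) \<in> borel_measurable borel" using g(1) S by simp
    from AE_completion[OF g(2)] show "AE x in lebesgue. x \<in> S \<longrightarrow> indicator S x * g x = w x"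
      by eventually_elim auto
  qed simp
qed

text \<open>
  The mass of the bump function is normalised by distributing a root of the constant over the
  factors.
\<close>

lemma exists_star_kernel:
  fixes D :: "(real^'n::finite) set"
  assumes D: "open D" "bounded D" and ab: "\<And>i. a $ i < b $ i"
    and star: "\<And>x y. x \<in> D \<Longrightarrow> y \<in> cbox a b \<Longrightarrow> closed_segment x y \<subseteq> D"
  obtains \<psi> where "star_kernel D a b \<psi>"
proof -
  have "\<exists>f. infinitely_differentiable f \<and> (\<forall>t. f t \<ge> 0) \<and> (\<forall>t. f t > 0 \<longleftrightarrow> t \<in> {a $ i<..<b $ i})" for i
    using exists_bump[of "a $ i" "b $ i"] by metis
  then obtain f where f: "\<And>i. infinitely_differentiable (f i)" "\<And>i t. f i t \<ge> 0"
    "\<And>i t. f i t > 0 \<longleftrightarrow> t \<in> {a $ i<..<b $ i}" by metis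
  have supp: "t \<in> {a $ i..b $ i}" if "f i t \<noteq> 0" for i t
    using f(2)[of i t] f(3)[of i t] that by auto
  let ?I = "LBINT x. tensor f x"
  have nn: "tensor f x \<ge> 0" for x unfolding tensor_def by (intro prod_nonneg) (auto simp: f(2))
  have "integrable lborel (\<lambda>x. indicator (cbox a b) x * tensor f x)"
    by (rule integrable_times_tensor[OF _ f(1) supp]) (auto simp: emeasure_lborel_cbox_eq)
  moreover have "indicator (cbox a b) x * tensor f x = tensor f x" for x
    using supp by (force simp: indicator_def tensor_def mem_box_cart)
  ultimately have int: "integrable lborel (tensor f)" by simp
  have "?I \<noteq> 0"
  proof
    assume "?I = 0"
    then have "AE x in lborel. tensor f x = 0"
      using integral_nonneg_eq_0_iff_AE[OF int] nn by simp
    then have "AE x in lborel. x \<notin> box a b"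
    proof eventually_elim
      case (elim x)
      then obtain i where "f i (x $ i) = 0" by (auto simp: tensor_def)
      with f(3)[of i "x $ i"] show ?case by (auto simp: mem_box_cart)
    qed
    from AE_completion[OF this] have "negligible (box a b)"
      by (simp add: completion.AE_iff_null_sets negligible_iff_null_sets)
    moreover have "box a b \<noteq> {}"
    proof -
      have "(\<chi> i. (a $ i + b $ i) / 2) \<in> box a b" using ab by (auto simp: mem_box_cart field_simps)
      then show ?thesis by blast
    qed
    ultimately show False
      using open_not_negligible[OF open_box] by blast
  qed
  moreover have "?I \<ge> 0" using nn by simp
  ultimately have I: "?I > 0" by simp
  define c where "c = root CARD('n) (1 / ?I)"
  have c: "c > 0" "c ^ CARD('n) = 1 / ?I" using I by (simp_all add: c_def)
  have ten: "tensor (\<lambda>i t. c * f i t) x = (1 / ?I) * tensor f x" for x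
    using c(2) by (simp add: tensor_def prod.distrib)
  have "star_kernel D a b (\<lambda>i t. c * f i t)"
  proof
    show "(LBINT y. tensor (\<lambda>i t. c * f i t) y) = 1"
      unfolding ten using I by simp
    show "infinitely_differentiable (\<lambda>t. c * f i t)" for i by (intro infinitely_differentiable_mult f(1)) auto
  qed (use D star f(2) supp c(1) in auto)
  then show thesis by (rule that)
qed

lemma integral_zero_by_continuous:
  fixes v :: "'a::euclidean_space \<Rightarrow> real"
  assumes v: "integrable lborel v"
    and zero: "\<And>f M. continuous_on UNIV f \<Longrightarrow> (\<And>x. \<bar>f x\<bar> \<le> M) \<Longrightarrow> (LBINT x. f x * v x) = 0"
  shows "AE x in lborel. v x = 0"
proof -
  have [measurable]: "v \<in> borel_measurable borel" using v by auto
  \<comment> \<open>Testing with the sign of \<open>v\<close> yields the integral of \<open>\<bar>v\<bar>\<close>.\<close>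
  have "sgn \<circ> v \<in> borel_measurable borel" by measurable
  moreover have "\<bar>(sgn \<circ> v) x\<bar> \<le> 1" for x by (auto simp: sgn_if)
  ultimately obtain g where g: "\<And>n. continuous_on UNIV (g n)" "\<And>n x. \<bar>g n x\<bar> \<le> 1"
    "AE x in lborel. (\<lambda>n. g n x) \<longlonglongrightarrow> (sgn \<circ> v) x"
    using continuous_approximation[of "sgn \<circ> v" 1] by blast
  have [measurable]: "g n \<in> borel_measurable borel" for n
    using g(1) by (intro borel_measurable_continuous_onI)
  have "(\<lambda>n. LBINT x. g n x * v x) \<longlonglongrightarrow> (LBINT x. \<bar>v x\<bar>)"
  proof (rule integral_dominated_convergence[where w = "\<lambda>x. \<bar>v x\<bar>"])
    show "AE x in lborel. (\<lambda>n. g n x * v x) \<longlonglongrightarrow> \<bar>v x\<bar>"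
      using g(3)
    proof eventually_elim
      case (elim x)
      have "(sgn \<circ> v) x * v x = \<bar>v x\<bar>" by (simp add: sgn_if)
      with tendsto_mult[OF elim tendsto_const[of "v x"]] show ?case by metis
    qed
    show "AE x in lborel. norm (g n x * v x) \<le> \<bar>v x\<bar>" for n
    proof (rule AE_I2)
      show "norm (g n x * v x) \<le> \<bar>v x\<bar>" for x
        using mult_right_mono[OF g(2)[of n x] abs_ge_zero[of "v x"]] by (simp add: abs_mult)
    qed
  qed (use v in auto)
  then have "(LBINT x. \<bar>v x\<bar>) = 0"
    using zero[OF g(1,2)] by (simp add: LIMSEQ_const_iff)
  then have "AE x in lborel. \<bar>v x\<bar> = 0"
    using integral_nonneg_eq_0_iff_AE[of lborel "\<lambda>x. \<bar>v x\<bar>"] v by simp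
  then show ?thesis by simp
qed

text \<open>
  All the inner integrals in \<open>J\<close> vanish, since the kernels are test functions, and their limit as
  \<open>s \<rightarrow> 0\<close> is the pairing with an arbitrary bounded continuous function.
\<close>

lemma (in star_kernel) vanishing_of_test_integrals:
  assumes v: "integrable lborel v" "\<And>x. x \<notin> D \<Longrightarrow> v x = 0"
    and zero: "\<And>\<eta> c d. (\<And>j. infinitely_differentiable (\<eta> j)) \<Longrightarrow>
        (\<And>j t. \<eta> j t \<noteq> 0 \<Longrightarrow> t \<in> {c $ j..d $ j}) \<Longrightarrow> cbox c d \<subseteq> D \<Longrightarrow>
        (LBINT z. v z * tensor \<eta> z) = 0"
  shows "AE x in lborel. v x = 0"
proof (rule integral_zero_by_continuous[OF v(1)])
  fix f :: "real^'n \<Rightarrow> real" and M assume f: "continuous_on UNIV f" "\<And>x. \<bar>f x\<bar> \<le> M"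
  obtain X :: "nat \<Rightarrow> real" where X: "\<And>n. 0 < X n" "\<And>n. X n \<le> 1 / 2" "X \<longlonglongrightarrow> 0"
    using null_sequence_below_half by blast
  have X1: "X n \<le> 1" for n using X(2)[of n] by linarith
  have inner: "(LBINT z. v z * K0 (X n) x z) = 0" if x: "x \<in> D" for x n
    unfolding K_def
    by (rule zero[OF smooth_scaled scaled_support[OF X(1)] scaled_box_subset[OF x X(1) X1]])
  have "f x * indicator D x * (LBINT z. v z * K0 (X n) x z) = 0" for x n
    using inner[of x n] by (simp add: indicator_def)
  note vanish = this
  have "J (\<lambda>x. f x * indicator D x) v (\<lambda>_. 0) (X n) = 0" for n
    unfolding J_def vanish by simp
  with J_tendsto[OF f v X] show "(LBINT x. f x * v x) = 0"
    by (simp add: LIMSEQ_const_iff)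
qed

text \<open>
  Weak derivatives are only locally integrable, so the argument is local: a small ball is starlike
  with respect to each of its points, and both functions are integrable there.
\<close>

lemma weak_derivative_unique:
  fixes D :: "(real^'n::finite) set"
  assumes D: "open D" and v1: "weak_derivative D \<alpha> u v1" and v2: "weak_derivative D \<alpha> u v2"
  shows "AE x in lebesgue. x \<in> D \<longrightarrow> v1 x = v2 x"
proof -
  have "\<exists>U. openin (top_of_set {x \<in> D. v1 x \<noteq> v2 x}) U \<and> x \<in> U \<and> negligible U" if x: "x \<in> {x \<in> D. v1 x \<noteq> v2 x}" for x
  proof -
    from x D obtain r where r: "r > 0" "cball x r \<subseteq> D" unfolding open_contains_cball by blast
    let ?B = "ball x r"
    have BD: "?B \<subseteq> D" using r(2) by auto
    have B: "?B \<in> sets borel" by (rule borel_open[OF open_ball])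
    have B': "?B \<in> sets lebesgue" by (rule fmeasurableD[OF lmeasurable_ball])
    have int: "set_integrable lebesgue ?B w" if "weak_derivative D \<alpha> u w" for w
    proof (rule set_integrable_subset[OF _ B' ball_subset_cball])
      show "set_integrable lebesgue (cball x r) w"
        using that r(2) compact_cball[of x r] unfolding weak_derivative_def locally_integrable_on_def by blast
    qed
    have rep: "\<exists>v :: real^'n \<Rightarrow> real. integrable lborel v \<and> (\<forall>x. x \<notin> ?B \<longrightarrow> v x = 0) \<and> (AE x in lebesgue. x \<in> ?B \<longrightarrow> v x = w x)"
      if w: "set_integrable lebesgue ?B w" for w :: "real^'n \<Rightarrow> real"
    proof -
      have "set_borel_measurable lebesgue ?B w"
        using w unfolding set_integrable_def set_borel_measurable_def by auto
      from borel_representative[OF B this] obtain v where v: "v \<in> borel_measurable borel"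
        "\<And>x. x \<notin> ?B \<Longrightarrow> v x = 0" "AE x in lebesgue. x \<in> ?B \<longrightarrow> v x = w x" by blast
      with lebesgue_integral_representative(2)[OF v] w show ?thesis by blast
    qed
    obtain g1 where g1: "integrable lborel g1" "\<And>x. x \<notin> ?B \<Longrightarrow> g1 x = 0" "AE x in lebesgue. x \<in> ?B \<longrightarrow> g1 x = v1 x"
      using rep[OF int[OF v1]] by blast
    obtain g2 where g2: "integrable lborel g2" "\<And>x. x \<notin> ?B \<Longrightarrow> g2 x = 0" "AE x in lebesgue. x \<in> ?B \<longrightarrow> g2 x = v2 x"
      using rep[OF int[OF v2]] by blast
    define a b where "a = x - (\<chi> i. r / (2 * real CARD('n)))" and "b = x + (\<chi> i. r / (2 * real CARD('n)))"
    have box: "cbox a b \<subseteq> ?B"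
    proof
      fix y assume y: "y \<in> cbox a b"
      have "norm (y - x) \<le> (\<Sum>i\<in>UNIV. \<bar>(y - x) $ i\<bar>)" by (rule norm_le_l1_cart)
      also have "\<dots> \<le> (\<Sum>i\<in>(UNIV :: 'n set). r / (2 * real CARD('n)))"
      proof (rule sum_mono)
        fix i
        have "x $ i - r / (2 * real CARD('n)) \<le> y $ i" "y $ i \<le> x $ i + r / (2 * real CARD('n))"
          using y by (simp_all add: a_def b_def mem_box_cart)
        then show "\<bar>(y - x) $ i\<bar> \<le> r / (2 * real CARD('n))" unfolding vector_minus_component by linarith
      qed
      also have "\<dots> = r / 2" by simp
      also have "\<dots> < r" using r(1) by simp
      finally show "y \<in> ?B" by (simp add: dist_norm norm_minus_commute)
    qed
    obtain \<psi> where "star_kernel ?B a b \<psi>"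
    proof (rule exists_star_kernel[of ?B a b])
      show "a $ i < b $ i" for i
        using r(1) by (simp add: a_def b_def)
      show "closed_segment p q \<subseteq> ?B" if "p \<in> ?B" "q \<in> cbox a b" for p q
        using that box by (intro closed_segment_subset convex_ball) auto
    qed auto
    then interpret star_kernel ?B a b \<psi> .
    have "AE x in lborel. g1 x - g2 x = 0"
    proof (rule vanishing_of_test_integrals)
      show "integrable lborel (\<lambda>x. g1 x - g2 x)" using g1 g2 by simp
      show "g1 y - g2 y = 0" if "y \<notin> ?B" for y using that g1(2) g2(2) by simp
      fix \<eta> :: "'n \<Rightarrow> real \<Rightarrow> real" and c d :: "real^'n"
      assume \<eta>: "\<And>j. infinitely_differentiable (\<eta> j)" "\<And>j t. \<eta> j t \<noteq> 0 \<Longrightarrow> t \<in> {c $ j..d $ j}" "cbox c d \<subseteq> ?B"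
      have test: "test_function D (tensor \<eta>)" using \<eta> BD by (intro test_function_tensor[of _ c d]) auto
      have \<eta>0: "tensor \<eta> y = 0" if "y \<notin> ?B" for y
        using that closure_support_subset_cbox[of \<eta> c d, OF \<eta>(2)] closure_subset[of "{x. tensor \<eta> x \<noteq> 0}"] \<eta>(3)
        by blast
      have tr: "(LBINT z. g z * tensor \<eta> z) = (LINT z:D|lebesgue. v z * tensor \<eta> z)"
        if g: "integrable lborel g" "\<And>x. x \<notin> ?B \<Longrightarrow> g x = 0" "AE x in lebesgue. x \<in> ?B \<longrightarrow> g x = v x" for g v
      proof (rule lebesgue_integral_representative(1)[symmetric])
        show "(\<lambda>z. g z * tensor \<eta> z) \<in> borel_measurable borel"
          using g(1) tensor_measurable[OF \<eta>(1)] by measurable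
        show "g z * tensor \<eta> z = 0" if "z \<notin> D" for z
        proof -
          have "z \<notin> ?B" using that BD by blast
          then show ?thesis using g(2) by simp
        qed
        show "AE z in lebesgue. z \<in> D \<longrightarrow> g z * tensor \<eta> z = v z * tensor \<eta> z"
          using g(3) by eventually_elim (use \<eta>0 in auto)
      qed
      have "(LINT z:D|lebesgue. v1 z * tensor \<eta> z) = (LINT z:D|lebesgue. v2 z * tensor \<eta> z)"
        using v1 v2 test unfolding weak_derivative_def by auto
      then have "(LBINT z. g1 z * tensor \<eta> z) = (LBINT z. g2 z * tensor \<eta> z)"
        using tr[OF g1] tr[OF g2] by simp
      moreover have "integrable lborel (\<lambda>z. g1 z * tensor \<eta> z)" "integrable lborel (\<lambda>z. g2 z * tensor \<eta> z)"
        by (rule integrable_times_tensor[OF g1(1) \<eta>(1,2)], assumption)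
           (rule integrable_times_tensor[OF g2(1) \<eta>(1,2)], assumption)
      ultimately show "(LBINT z. (g1 z - g2 z) * tensor \<eta> z) = 0"
        by (simp add: left_diff_distrib)
    qed
    then have "AE x in lebesgue. g1 x - g2 x = 0" by (rule AE_completion)
    with g1(3) g2(3) have "AE y in lebesgue. y \<notin> {y \<in> ?B. v1 y \<noteq> v2 y}"
      by eventually_elim auto
    then have "negligible {y \<in> ?B. v1 y \<noteq> v2 y}"
      by (simp add: completion.AE_iff_null_sets negligible_iff_null_sets)
    moreover have "openin (top_of_set {x \<in> D. v1 x \<noteq> v2 x}) ({x \<in> D. v1 x \<noteq> v2 x} \<inter> ?B)"
      by (simp add: openin_open_Int)
    moreover have "{x \<in> D. v1 x \<noteq> v2 x} \<inter> ?B \<subseteq> {y \<in> ?B. v1 y \<noteq> v2 y}" by auto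
    ultimately show ?thesis using x r(1) negligible_subset
      by (intro exI[of _ "{x \<in> D. v1 x \<noteq> v2 x} \<inter> ?B"]) auto
  qed
  then have "negligible {x \<in> D. v1 x \<noteq> v2 x}" using locally_negligible_alt by blast
  then show ?thesis by (simp add: completion.AE_iff_null_sets negligible_iff_null_sets)
qed

lemma L2_norm_weak_partial:
  fixes D :: "(real^'n::finite) set"
  assumes D: "open D" and w: "weak_derivative D \<alpha> u w"
    and v: "v \<in> borel_measurable borel" "\<And>x. x \<notin> D \<Longrightarrow> v x = 0" "AE x in lebesgue. x \<in> D \<longrightarrow> v x = w x"
  shows "L2_norm_on D (weak_partial D \<alpha> u) = sqrt (LBINT x. (v x)\<^sup>2)"
proof -
  have "weak_derivative D \<alpha> u (weak_partial D \<alpha> u)"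
    unfolding weak_partial_def by (rule someI[where P = "weak_derivative D \<alpha> u", OF w])
  from weak_derivative_unique[OF D w this] v(3)
  have "AE x in lebesgue. x \<in> D \<longrightarrow> (v x)\<^sup>2 = (weak_partial D \<alpha> u x)\<^sup>2"
    by eventually_elim auto
  from lebesgue_integral_representative(1)[OF _ _ this] v(1,2) show ?thesis
    by (simp add: L2_norm_on_def)
qed

section \<open>The averaged Taylor polynomial as a polynomial\<close>

definition taylor_monomial :: "'n::finite multi_index \<Rightarrow> real^'n \<Rightarrow> real" where
  "taylor_monomial \<gamma> = tensor (\<lambda>i t. t ^ \<gamma> i / fact (\<gamma> i))"

lemma infinitely_differentiable_monomial: "infinitely_differentiable (\<lambda>t. t ^ n / fact n)"
  using infinitely_differentiable_mult[OF infinitely_differentiable_power infinitely_differentiable_const, of n "1 / fact n"]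
  by simp

lemma deriv_monomial:
  "(deriv ^^ b) (\<lambda>t::real. t ^ a / fact a) = (if b \<le> a then (\<lambda>t. t ^ (a - b) / fact (a - b)) else (\<lambda>t. 0))"
proof (induction b)
  case (Suc b)
  have step: "deriv (\<lambda>t::real. t ^ Suc n / fact (Suc n)) = (\<lambda>t. t ^ n / fact n)" for n
  proof (rule deriv_eqI)
    fix x :: real
    have "((\<lambda>t. t ^ Suc n / fact (Suc n)) has_real_derivative (real (Suc n) * x ^ n) / fact (Suc n)) (at x)"
      using DERIV_pow[of "Suc n" x] by (intro DERIV_cdivide) simp
    then show "((\<lambda>t. t ^ Suc n / fact (Suc n)) has_real_derivative x ^ n / fact n) (at x)"
      by (simp add: fact_Suc del: of_nat_Suc)
  qed
  have const: "deriv (\<lambda>t::real. c) = (\<lambda>t. 0)" for c by (rule deriv_eqI) (rule DERIV_const)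
  consider "Suc b \<le> a" | "b = a" | "b > a" by linarith
  then show ?case
  proof cases
    case 1
    then obtain n where n: "a - b = Suc n" "a - Suc b = n" by (metis Suc_diff_Suc Suc_le_lessD)
    show ?thesis using 1 Suc step[of n] by (simp del: fact_Suc power_Suc add: n)
  qed (use Suc const in auto)
qed simp

lemma taylor_monomial_eq: "taylor_monomial \<gamma> x = (\<Prod>i\<in>UNIV. (x $ i) ^ \<gamma> i) / (\<Prod>i\<in>UNIV. fact (\<gamma> i))"
  by (simp add: taylor_monomial_def tensor_def prod_dividef)

lemma continuous_taylor_monomial: "continuous_on A (taylor_monomial \<gamma>)"
  unfolding taylor_monomial_eq[abs_def] divide_inverse by (intro continuous_intros)

text \<open>
  The binomial theorem in terms of divided powers \<open>x\<^sup>a / a!\<close>.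
\<close>

lemma monomial_binomial:
  fixes x z :: real
  shows "(x - z) ^ a / fact a = (\<Sum>g\<le>a. x ^ g / fact g * ((- z) ^ (a - g) / fact (a - g)))"
proof -
  have "(x - z) ^ a / fact a = (\<Sum>g\<le>a. of_nat (a choose g) * x ^ g * (- z) ^ (a - g)) / fact a"
    using binomial_ring[of x "- z" a] by simp
  also have "\<dots> = (\<Sum>g\<le>a. x ^ g / fact g * ((- z) ^ (a - g) / fact (a - g)))"
    unfolding sum_divide_distrib
    by (intro sum.cong refl) (simp add: binomial_fact)
  finally show ?thesis .
qed

lemma taylor_monomial_diff:
  fixes x z :: "real^'n::finite"
  shows "taylor_monomial \<alpha> (x - z) =
    (\<Sum>\<gamma> | \<forall>i. \<gamma> i \<le> \<alpha> i. taylor_monomial \<gamma> x * taylor_monomial (\<lambda>i. \<alpha> i - \<gamma> i) (- z))"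
proof -
  have "taylor_monomial \<alpha> (x - z) =
      (\<Prod>i\<in>UNIV. \<Sum>g\<le>\<alpha> i. (x $ i) ^ g / fact g * ((- (z $ i)) ^ (\<alpha> i - g) / fact (\<alpha> i - g)))"
    by (simp add: taylor_monomial_def tensor_def monomial_binomial)
  also have "\<dots> = (\<Sum>\<gamma>\<in>PiE UNIV (\<lambda>i. {..\<alpha> i}).
      \<Prod>i\<in>UNIV. (x $ i) ^ \<gamma> i / fact (\<gamma> i) * ((- (z $ i)) ^ (\<alpha> i - \<gamma> i) / fact (\<alpha> i - \<gamma> i)))"
    by (rule prod_sum_PiE) auto
  also have "PiE UNIV (\<lambda>i. {..\<alpha> i}) = {\<gamma> :: 'n multi_index. \<forall>i. \<gamma> i \<le> \<alpha> i}" by (auto simp: PiE_iff)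
  finally show ?thesis by (simp add: taylor_monomial_def tensor_def prod.distrib[symmetric])
qed

definition mi_add :: "'n multi_index \<Rightarrow> 'n::finite multi_index \<Rightarrow> 'n multi_index" where
  "mi_add \<alpha> \<beta> = (\<lambda>i. \<alpha> i + \<beta> i)"

lemma mi_order_add [simp]: "mi_order (mi_add \<alpha> \<beta>) = mi_order \<alpha> + mi_order \<beta>"
  by (simp add: mi_order_def mi_add_def sum.distrib)

lemma mi_add_assoc: "mi_add (mi_add \<alpha> \<beta>) \<gamma> = mi_add \<alpha> (mi_add \<beta> \<gamma>)"
  by (simp add: mi_add_def add.assoc)

lemma mi_add_inc: "mi_add (mi_inc i \<alpha>) \<beta> = mi_inc i (mi_add \<alpha> \<beta>)"
  by (auto simp: mi_add_def mi_inc_def fun_eq_iff)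

lemma weak_jet_shift:
  assumes "weak_jet D m V" "mi_order \<beta> \<le> m"
  shows "weak_jet D (m - mi_order \<beta>) (\<lambda>\<alpha>. V (mi_add \<alpha> \<beta>))"
  unfolding weak_jet_def
proof (intro conjI allI impI)
  fix \<alpha> :: "'a multi_index" assume "mi_order \<alpha> \<le> m - mi_order \<beta>"
  then have le: "mi_order (mi_add \<alpha> \<beta>) \<le> m" using assms(2) by simp
  show "integrable lborel (V (mi_add \<alpha> \<beta>))" "integrable lborel (\<lambda>x. (V (mi_add \<alpha> \<beta>) x)\<^sup>2)"
    by (rule weak_jetD[OF assms(1) le])+
  show "V (mi_add \<alpha> \<beta>) x = 0" if "x \<notin> D" for x by (rule weak_jetD(3)[OF assms(1) le that])
next
  fix \<alpha> :: "'a multi_index" and i \<eta> c d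
  assume "mi_order \<alpha> < m - mi_order \<beta>" and \<eta>: "\<forall>j. infinitely_differentiable (\<eta> j)"
    "\<forall>j t. \<eta> j t \<noteq> 0 \<longrightarrow> t \<in> {c $ j..d $ j}" "cbox c d \<subseteq> D"
  then have lt: "mi_order (mi_add \<alpha> \<beta>) < m" by simp
  show "(LBINT z. V (mi_add \<alpha> \<beta>) z * partial i (tensor \<eta>) z) =
      - (LBINT z. V (mi_add (mi_inc i \<alpha>) \<beta>) z * tensor \<eta> z)"
    unfolding mi_add_inc using \<eta> by (intro weak_jet_integral[OF assms(1) lt, of _ c d]) auto
qed

context star_kernel
begin

text \<open>
  The coefficient of \<open>x\<^sup>\<gamma> / \<gamma>!\<close> after expanding each \<open>(x - z)\<^sup>\<alpha> / \<alpha>!\<close> in the averaged Taylor polynomial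
  by the binomial theorem, with \<open>\<alpha> = \<delta> + \<gamma>\<close>.
\<close>

definition taylor_coeff :: "('n multi_index \<Rightarrow> real^'n \<Rightarrow> real) \<Rightarrow> nat \<Rightarrow> 'n multi_index \<Rightarrow> real" where
  "taylor_coeff V m \<gamma> = (\<Sum>\<delta> | mi_order \<delta> + mi_order \<gamma> < m.
     LBINT z. V (mi_add \<delta> \<gamma>) z * (\<Psi> z * taylor_monomial \<delta> (- z)))"

text \<open>
  Differentiating a sum of divided powers \<open>x\<^sup>\<gamma> / \<gamma>!\<close> shifts its coefficients. So this says that taking the
  averaged Taylor polynomial commutes with differentiation.
\<close>

lemma taylor_coeff_shift:
  assumes "mi_order \<beta> \<le> m"
  shows "taylor_coeff (\<lambda>\<alpha>. V (mi_add \<alpha> \<beta>)) (m - mi_order \<beta>) \<gamma> = taylor_coeff V m (mi_add \<gamma> \<beta>)"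
  using assms unfolding taylor_coeff_def mi_add_assoc
  by (intro sum.cong) auto

lemma K_one: "K \<alpha> 1 x z = (-1) ^ mi_order \<alpha> * (\<Psi> z * taylor_monomial \<alpha> (x - z))"
proof -
  have "scaled_bump (\<psi> i) (x $ i) 1 (\<alpha> i) (z $ i) =
      (-1) ^ \<alpha> i * (\<psi> i (z $ i) * (((x - z) $ i) ^ \<alpha> i / fact (\<alpha> i)))" for i
  proof -
    have "(z $ i - x $ i) ^ \<alpha> i = (-1) ^ \<alpha> i * (x $ i - z $ i) ^ \<alpha> i"
      by (simp add: power_mult_distrib[symmetric])
    then show ?thesis by (simp add: scaled_bump_def)
  qed
  then show ?thesis
    by (simp add: K_def tensor_def taylor_monomial_def prod.distrib[symmetric] mi_prod_power[symmetric])
qed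

lemma integrable_times_bump_monomial:
  assumes "integrable lborel v"
  shows "integrable lborel (\<lambda>z. v z * (\<Psi> z * taylor_monomial \<delta> (- z)))"
proof -
  let ?\<eta> = "\<lambda>i t. \<psi> i t * ((- 1 * t + 0) ^ \<delta> i * (1 / fact (\<delta> i)))"
  have "integrable lborel (\<lambda>z. v z * tensor ?\<eta> z)"
  proof (rule integrable_times_tensor[OF assms])
    show "infinitely_differentiable (?\<eta> i)" for i
      by (intro infinitely_differentiable_mult smooth_\<psi> infinitely_differentiable_const
          infinitely_differentiable_affine[OF infinitely_differentiable_power])
    show "t \<in> {a $ i..b $ i}" if "?\<eta> i t \<noteq> 0" for i t using \<psi>_support[of i t] that by simp
  qed
  moreover have "tensor ?\<eta> z = \<Psi> z * taylor_monomial \<delta> (- z)" for z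
    by (simp add: tensor_def taylor_monomial_def prod.distrib[symmetric])
  ultimately show ?thesis by simp
qed

text \<open>
  At \<open>s = 1\<close> the kernel is \<open>(z - x)\<^sup>\<alpha> / \<alpha>!\<close> times the bump function of \<open>z\<close>; the signs \<open>(-1)\<^sup>j\<close> from Taylor's
  theorem turn \<open>z - x\<close> into \<open>x - z\<close>.
\<close>

lemma averaged_taylor_eq:
  assumes V: "weak_jet D m V"
  shows "averaged_taylor V m x = (\<Sum>\<gamma> | mi_order \<gamma> < m. taylor_coeff V m \<gamma> * taylor_monomial \<gamma> x)"
proof -
  let ?M = "\<lambda>\<gamma> \<delta>. LBINT z. V (mi_add \<delta> \<gamma>) z * (\<Psi> z * taylor_monomial \<delta> (- z))"
  have fin: "finite {\<alpha> :: 'n multi_index. mi_order \<alpha> < m}"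
    by (rule finite_subset[OF _ finite_mi_order_le[of m]]) auto
  have finle: "finite {\<gamma> :: 'n multi_index. \<forall>i. \<gamma> i \<le> \<alpha> i}" for \<alpha>
  proof (rule finite_subset[OF _ finite_mi_order_le[of "mi_order \<alpha>"]])
    show "{\<gamma> :: 'n multi_index. \<forall>i. \<gamma> i \<le> \<alpha> i} \<subseteq> {\<gamma>. mi_order \<gamma> \<le> mi_order \<alpha>}"
      by (auto simp: mi_order_def intro!: sum_mono)
  qed
  have inner: "(-1) ^ mi_order \<alpha> * (LBINT z. V \<alpha> z * K \<alpha> 1 x z) =
      (\<Sum>\<gamma> | \<forall>i. \<gamma> i \<le> \<alpha> i. ?M \<gamma> (\<lambda>i. \<alpha> i - \<gamma> i) * taylor_monomial \<gamma> x)" if \<alpha>: "mi_order \<alpha> < m" for \<alpha>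
  proof -
    have int: "integrable lborel (V \<alpha>)" using weak_jetD(1)[OF V] \<alpha> by simp
    have "(-1) ^ mi_order \<alpha> * (LBINT z. V \<alpha> z * K \<alpha> 1 x z) =
        (LBINT z. (-1) ^ mi_order \<alpha> * (V \<alpha> z * K \<alpha> 1 x z))" by simp
    also have "\<dots> = (LBINT z. (\<Sum>\<gamma> | \<forall>i. \<gamma> i \<le> \<alpha> i. taylor_monomial \<gamma> x *
        (V \<alpha> z * (\<Psi> z * taylor_monomial (\<lambda>i. \<alpha> i - \<gamma> i) (- z)))))"
    proof (rule Bochner_Integration.integral_cong[OF refl])
      fix z
      have "(-1) ^ mi_order \<alpha> * (V \<alpha> z * K \<alpha> 1 x z) =
          ((-1) ^ mi_order \<alpha> * (-1) ^ mi_order \<alpha>) * (V \<alpha> z * (\<Psi> z * taylor_monomial \<alpha> (x - z)))"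
        unfolding K_one by (simp only: mult_ac)
      also have "(-1 :: real) ^ mi_order \<alpha> * (-1) ^ mi_order \<alpha> = 1"
        by (simp add: power_mult_distrib[symmetric])
      finally show "(-1) ^ mi_order \<alpha> * (V \<alpha> z * K \<alpha> 1 x z) = (\<Sum>\<gamma> | \<forall>i. \<gamma> i \<le> \<alpha> i. taylor_monomial \<gamma> x *
        (V \<alpha> z * (\<Psi> z * taylor_monomial (\<lambda>i. \<alpha> i - \<gamma> i) (- z))))"
        by (simp add: taylor_monomial_diff sum_distrib_left mult_ac)
    qed
    also have "\<dots> = (\<Sum>\<gamma> | \<forall>i. \<gamma> i \<le> \<alpha> i. LBINT z. taylor_monomial \<gamma> x *
        (V \<alpha> z * (\<Psi> z * taylor_monomial (\<lambda>i. \<alpha> i - \<gamma> i) (- z))))"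
      by (intro Bochner_Integration.integral_sum integrable_mult_right integrable_times_bump_monomial int)
    also have "\<dots> = (\<Sum>\<gamma> | \<forall>i. \<gamma> i \<le> \<alpha> i. ?M \<gamma> (\<lambda>i. \<alpha> i - \<gamma> i) * taylor_monomial \<gamma> x)"
    proof (rule sum.cong[OF refl])
      fix \<gamma> assume "\<gamma> \<in> {\<gamma> :: 'n multi_index. \<forall>i. \<gamma> i \<le> \<alpha> i}"
      then have "mi_add (\<lambda>i. \<alpha> i - \<gamma> i) \<gamma> = \<alpha>" by (simp add: mi_add_def)
      then show "(LBINT z. taylor_monomial \<gamma> x * (V \<alpha> z * (\<Psi> z * taylor_monomial (\<lambda>i. \<alpha> i - \<gamma> i) (- z))))
          = ?M \<gamma> (\<lambda>i. \<alpha> i - \<gamma> i) * taylor_monomial \<gamma> x" by simp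
    qed
    finally show ?thesis .
  qed
  have "averaged_taylor V m x =
      (\<Sum>j<m. \<Sum>\<alpha> | mi_order \<alpha> = j. (-1) ^ mi_order \<alpha> * (LBINT z. V \<alpha> z * K \<alpha> 1 x z))"
    unfolding averaged_taylor_def sum_distrib_left by (intro sum.cong refl) simp
  also have "\<dots> = (\<Sum>\<alpha> | mi_order \<alpha> < m. (-1) ^ mi_order \<alpha> * (LBINT z. V \<alpha> z * K \<alpha> 1 x z))"
  proof -
    have "(\<Sum>j<m. \<Sum>\<alpha> | \<alpha> \<in> {\<alpha> :: 'n multi_index. mi_order \<alpha> < m} \<and> mi_order \<alpha> = j. (-1) ^ mi_order \<alpha> * (LBINT z. V \<alpha> z * K \<alpha> 1 x z))
        = (\<Sum>\<alpha> | mi_order \<alpha> < m. (-1) ^ mi_order \<alpha> * (LBINT z. V \<alpha> z * K \<alpha> 1 x z))"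
      by (rule sum.group[OF fin]) auto
    moreover have "{\<alpha> :: 'n multi_index. \<alpha> \<in> {\<alpha> :: 'n multi_index. mi_order \<alpha> < m} \<and> mi_order \<alpha> = j} = {\<alpha>. mi_order \<alpha> = j}" if "j < m" for j
      using that by auto
    ultimately show ?thesis by simp
  qed
  also have "\<dots> = (\<Sum>\<alpha> | mi_order \<alpha> < m. \<Sum>\<gamma> | \<forall>i. \<gamma> i \<le> \<alpha> i. ?M \<gamma> (\<lambda>i. \<alpha> i - \<gamma> i) * taylor_monomial \<gamma> x)"
    by (intro sum.cong refl inner) simp
  also have "\<dots> = (\<Sum>(\<alpha>, \<gamma>)\<in>Sigma {\<alpha> :: 'n multi_index. mi_order \<alpha> < m} (\<lambda>\<alpha>. {\<gamma> :: 'n multi_index. \<forall>i. \<gamma> i \<le> \<alpha> i}).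
      ?M \<gamma> (\<lambda>i. \<alpha> i - \<gamma> i) * taylor_monomial \<gamma> x)"
    using fin finle by (intro sum.Sigma) auto
  also have "\<dots> = (\<Sum>(\<gamma>, \<delta>)\<in>Sigma {\<gamma> :: 'n multi_index. mi_order \<gamma> < m} (\<lambda>\<gamma>. {\<delta> :: 'n multi_index. mi_order \<delta> + mi_order \<gamma> < m}).
      ?M \<gamma> \<delta> * taylor_monomial \<gamma> x)"
  proof (rule sum.reindex_bij_witness[of _ "\<lambda>(\<gamma>, \<delta>). (mi_add \<delta> \<gamma>, \<gamma>)" "\<lambda>(\<alpha>, \<gamma>). (\<gamma>, \<lambda>i. \<alpha> i - \<gamma> i)"])
    fix p assume "p \<in> Sigma {\<alpha> :: 'n multi_index. mi_order \<alpha> < m} (\<lambda>\<alpha>. {\<gamma> :: 'n multi_index. \<forall>i. \<gamma> i \<le> \<alpha> i})"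
    then obtain \<alpha> \<gamma> where p: "p = (\<alpha>, \<gamma>)" "mi_order \<alpha> < m" "\<forall>i. \<gamma> i \<le> \<alpha> i" by auto
    have add: "mi_add (\<lambda>i. \<alpha> i - \<gamma> i) \<gamma> = \<alpha>" using p(3) by (simp add: mi_add_def)
    from mi_order_add[of "\<lambda>i. \<alpha> i - \<gamma> i" \<gamma>]
    have ord: "mi_order \<alpha> = mi_order (\<lambda>i. \<alpha> i - \<gamma> i) + mi_order \<gamma>" unfolding add .
    show "(case case p of (\<alpha>, \<gamma>) \<Rightarrow> (\<gamma>, \<lambda>i. \<alpha> i - \<gamma> i) of (\<gamma>, \<delta>) \<Rightarrow> (mi_add \<delta> \<gamma>, \<gamma>)) = p"
      using add p(1) by simp
    show "(case p of (\<alpha>, \<gamma>) \<Rightarrow> (\<gamma>, \<lambda>i. \<alpha> i - \<gamma> i)) \<in> Sigma {\<gamma> :: 'n multi_index. mi_order \<gamma> < m} (\<lambda>\<gamma>. {\<delta> :: 'n multi_index. mi_order \<delta> + mi_order \<gamma> < m})"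
      using p ord by simp
  next
    fix q assume "q \<in> Sigma {\<gamma> :: 'n multi_index. mi_order \<gamma> < m} (\<lambda>\<gamma>. {\<delta> :: 'n multi_index. mi_order \<delta> + mi_order \<gamma> < m})"
    then obtain \<gamma> \<delta> where q: "q = (\<gamma>, \<delta>)" "mi_order \<delta> + mi_order \<gamma> < m" by auto
    show "(case case q of (\<gamma>, \<delta>) \<Rightarrow> (mi_add \<delta> \<gamma>, \<gamma>) of (\<alpha>, \<gamma>) \<Rightarrow> (\<gamma>, \<lambda>i. \<alpha> i - \<gamma> i)) = q"
      unfolding q(1) by (simp add: mi_add_def)
    show "(case q of (\<gamma>, \<delta>) \<Rightarrow> (mi_add \<delta> \<gamma>, \<gamma>)) \<in> Sigma {\<alpha> :: 'n multi_index. mi_order \<alpha> < m} (\<lambda>\<alpha>. {\<gamma> :: 'n multi_index. \<forall>i. \<gamma> i \<le> \<alpha> i})"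
      using q by (simp add: mi_add_def[of \<delta> \<gamma>] flip: mi_order_add)
  qed auto
  also have "\<dots> = (\<Sum>\<gamma> | mi_order \<gamma> < m. \<Sum>\<delta> | mi_order \<delta> + mi_order \<gamma> < m. ?M \<gamma> \<delta> * taylor_monomial \<gamma> x)"
    using fin by (intro sum.Sigma[symmetric]) (auto intro: finite_subset[OF _ fin])
  also have "\<dots> = (\<Sum>\<gamma> | mi_order \<gamma> < m. taylor_coeff V m \<gamma> * taylor_monomial \<gamma> x)"
    unfolding taylor_coeff_def sum_distrib_right ..
  finally show ?thesis .
qed

end

section \<open>Integration by parts against polynomials\<close>

text \<open>
  The integral is invariant under translation, so the difference quotients have integral zero, and
  they converge boundedly on a fixed ball.
\<close>

lemma integral_partial_eq_0:
  fixes g :: "real^'n::finite \<Rightarrow> real"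
  assumes diff: "\<And>x. g differentiable (at x)" and cont: "continuous_on UNIV (partial i g)"
    and supp: "bounded {x. g x \<noteq> 0}"
  shows "(LBINT x. partial i g x) = 0"
proof -
  let ?e = "axis i (1::real) :: real^'n"
  obtain R where R: "R > 0" "\<And>x. g x \<noteq> 0 \<Longrightarrow> norm x \<le> R"
    using supp unfolding bounded_pos by auto
  have gc: "continuous_on UNIV g"
    using diff by (meson continuous_at_imp_continuous_on differentiable_imp_continuous_within)
  have [measurable]: "g \<in> borel_measurable borel" "partial i g \<in> borel_measurable borel"
    using gc cont by (auto intro: borel_measurable_continuous_onI)
  have der: "((\<lambda>t. g (x + t *\<^sub>R ?e)) has_real_derivative partial i g (x + t *\<^sub>R ?e)) (at t)" for x t
  proof -
    have "(g has_derivative frechet_derivative g (at (x + t *\<^sub>R ?e))) (at (x + t *\<^sub>R ?e))"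
      using diff frechet_derivative_works by blast
    then have outer: "(g has_derivative frechet_derivative g (at (x + t *\<^sub>R ?e))) (at ((\<lambda>t. x + t *\<^sub>R ?e) t))" by simp
    have inner: "((\<lambda>t. x + t *\<^sub>R ?e) has_derivative (\<lambda>h. h *\<^sub>R ?e)) (at t)"
      by (auto intro!: derivative_eq_intros)
    have d: "((\<lambda>t. g (x + t *\<^sub>R ?e)) has_derivative
        (\<lambda>h. frechet_derivative g (at (x + t *\<^sub>R ?e)) (h *\<^sub>R ?e))) (at t)"
      by (rule has_derivative_compose[OF inner outer])
    have "linear (frechet_derivative g (at (x + t *\<^sub>R ?e)))"
      using diff linear_frechet_derivative by blast
    then have "(\<lambda>h. frechet_derivative g (at (x + t *\<^sub>R ?e)) (h *\<^sub>R ?e)) = (*) (partial i g (x + t *\<^sub>R ?e))"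
      by (auto simp: fun_eq_iff partial_def linear_scale)
    with d show ?thesis by (simp add: has_field_derivative_def)
  qed
  have "bounded (partial i g ` cball 0 (R + 2))"
    by (intro compact_imp_bounded compact_continuous_image continuous_on_subset[OF cont]) auto
  then obtain M0 where M0: "\<And>x. x \<in> cball 0 (R + 2) \<Longrightarrow> \<bar>partial i g x\<bar> \<le> M0"
    unfolding bounded_iff real_norm_def by blast
  define M where "M = max M0 0"
  have M: "M \<ge> 0" "\<And>x. norm x \<le> R + 2 \<Longrightarrow> \<bar>partial i g x\<bar> \<le> M"
  proof -
    show "M \<ge> 0" by (simp add: M_def)
    show "\<bar>partial i g x\<bar> \<le> M" if "norm x \<le> R + 2" for x
      using M0[of x] that by (simp add: M_def)
  qed
  define X where "X n = 1 / (real n + 1)" for n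
  have X: "X n > 0" "X n \<le> 1" for n by (auto simp: X_def field_simps)
  have X0: "X \<longlonglongrightarrow> 0"
    unfolding X_def using LIMSEQ_inverse_real_of_nat by (simp add: inverse_eq_divide add.commute)
  define Q where "Q n x = (g (x + X n *\<^sub>R ?e) - g x) / X n" for n x
  have bound: "\<bar>Q n x\<bar> \<le> M * indicator (cball 0 (R + 1)) x" for n x
  proof (cases "norm x \<le> R + 1")
    case True
    have "norm (g (x + X n *\<^sub>R ?e) - g (x + 0 *\<^sub>R ?e)) \<le> M * norm (X n - 0)"
    proof (rule field_differentiable_bound[of "{0..1}" "\<lambda>t. g (x + t *\<^sub>R ?e)" "\<lambda>t. partial i g (x + t *\<^sub>R ?e)"])
      show "((\<lambda>t. g (x + t *\<^sub>R ?e)) has_real_derivative partial i g (x + z *\<^sub>R ?e)) (at z within {0..1})" for z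
        by (rule has_field_derivative_at_within[OF der])
      show "norm (partial i g (x + z *\<^sub>R ?e)) \<le> M" if "z \<in> {0..1}" for z
      proof -
        have "norm (x + z *\<^sub>R ?e) \<le> norm x + norm (z *\<^sub>R ?e)" by (rule norm_triangle_ineq)
        also have "\<dots> \<le> R + 2" using True that by simp
        finally show ?thesis using M(2) by simp
      qed
    qed (use X[of n] in auto)
    then show ?thesis using True X(1)[of n] by (simp add: Q_def abs_divide divide_le_eq)
  next
    case False
    have "norm x \<le> norm (x + X n *\<^sub>R ?e) + norm (X n *\<^sub>R ?e)"
      using norm_triangle_ineq4[of "x + X n *\<^sub>R ?e" "X n *\<^sub>R ?e"] by simp
    then have "norm (x + X n *\<^sub>R ?e) > R" using False X[of n] by simp
    then have "g (x + X n *\<^sub>R ?e) = 0" "g x = 0" using R False by force+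
    then show ?thesis by (simp add: Q_def M(1))
  qed
  have "(\<lambda>n. LBINT x. Q n x) \<longlonglongrightarrow> (LBINT x. partial i g x)"
  proof (rule integral_dominated_convergence[where w = "\<lambda>x. M * indicator (cball 0 (R + 1)) x"])
    show "integrable lborel (\<lambda>x :: real^'n. M * indicator (cball 0 (R + 1)) x :: real)"
    proof (rule integrable_bounded_support[where D = "cball 0 (R + 1)" and M = M])
      show "(\<lambda>x :: real^'n. M * indicator (cball 0 (R + 1)) x :: real) \<in> borel_measurable borel"
        by (intro borel_measurable_times borel_measurable_const borel_measurable_indicator borel_closed closed_cball)
      show "bounded (cball (0 :: real^'n) (R + 1))" "cball (0 :: real^'n) (R + 1) \<in> sets borel" by simp_all
      show "\<bar>M * indicator (cball 0 (R + 1)) x :: real\<bar> \<le> M" for x :: "real^'n"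
        using M(1) by (simp add: indicator_def)
    qed simp
    have "(\<lambda>n. Q n x) \<longlonglongrightarrow> partial i g x" for x
    proof -
      have "((\<lambda>h. (g (x + h *\<^sub>R ?e) - g x) / h) \<longlongrightarrow> partial i g x) (at 0)"
        using der[of x 0] by (simp add: has_field_derivative_iff)
      moreover have "filterlim X (at 0) sequentially"
        using X0 X(1) by (auto simp: filterlim_at intro!: always_eventually less_imp_neq[symmetric])
      ultimately show ?thesis unfolding Q_def by (rule filterlim_compose)
    qed
    then show "AE x in lborel. (\<lambda>n. Q n x) \<longlonglongrightarrow> partial i g x" by simp
    show "AE x in lborel. norm (Q n x) \<le> M * indicator (cball 0 (R + 1)) x" for n
      using bound by simp
    show "Q n \<in> borel_measurable lborel" for n unfolding Q_def[abs_def] by measurable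
  qed measurable
  moreover have "(LBINT x. Q n x) = 0" for n
  proof -
    have int: "integrable lborel g"
    proof -
      have "bounded (g ` cball 0 R)"
        by (intro compact_imp_bounded compact_continuous_image continuous_on_subset[OF gc]) auto
      then obtain B where "\<And>x. x \<in> cball 0 R \<Longrightarrow> \<bar>g x\<bar> \<le> B"
        unfolding bounded_iff real_norm_def by blast
      then show ?thesis
        using R(2) by (intro integrable_bounded_support[of g "cball 0 R" B]) (auto simp: mem_cball_0)
    qed
    have tr: "(LBINT x. g x) = (LBINT x. g (x + X n *\<^sub>R ?e))"
      using integral_lborel_affine[of g 1 "X n *\<^sub>R ?e"] by (simp add: add.commute)
    have "integrable lborel (\<lambda>x. g (x + X n *\<^sub>R ?e))"
    proof -
      have "integrable (distr lborel borel ((+) (X n *\<^sub>R ?e))) g" using int by (simp add: lborel_distr_plus)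
      then have "integrable lborel (\<lambda>x. g (X n *\<^sub>R ?e + x))" by (subst (asm) integrable_distr_eq) auto
      then show ?thesis by (simp add: add.commute)
    qed
    then show ?thesis unfolding Q_def using int tr by simp
  qed
  ultimately show ?thesis by (simp add: LIMSEQ_const_iff)
qed

lemma integrable_continuous_bounded_support:
  fixes f :: "'a::euclidean_space \<Rightarrow> real"
  assumes f: "continuous_on UNIV f" "bounded {x. f x \<noteq> 0}"
  shows "integrable lborel f"
proof -
  obtain R where R: "\<And>x. f x \<noteq> 0 \<Longrightarrow> norm x \<le> R" using f(2) unfolding bounded_iff by auto
  have "bounded (f ` cball 0 R)"
    by (intro compact_imp_bounded compact_continuous_image continuous_on_subset[OF f(1)]) auto
  then obtain B where B: "\<And>x. x \<in> cball 0 R \<Longrightarrow> \<bar>f x\<bar> \<le> B"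
    unfolding bounded_iff real_norm_def by blast
  show ?thesis
  proof (rule integrable_bounded_support[of f "cball 0 R" B])
    show "f \<in> borel_measurable borel" using f(1) by (rule borel_measurable_continuous_onI)
    show "f x = 0" if "x \<notin> cball 0 R" for x using R[of x] that by auto
  qed (use B in auto)
qed

lemma partial_zero_near:
  assumes "open U" "x \<in> U" "\<And>y. y \<in> U \<Longrightarrow> f y = 0"
  shows "partial i f x = 0"
proof -
  have "((\<lambda>_. 0) has_derivative (\<lambda>_. 0)) (at x)" by simp
  then have "(f has_derivative (\<lambda>_. 0)) (at x)"
    by (rule has_derivative_transform_within_open[OF _ assms(1,2)]) (simp add: assms(3))
  from partial_eqI[OF this] show ?thesis .
qed

lemma iter_partial_Cons: "iter_partial (i # is) f = partial i (iter_partial is f)"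
  by (simp add: iter_partial_def)

lemma iter_partial_zero_outside:
  "x \<notin> closure {y. \<phi> y \<noteq> 0} \<Longrightarrow> iter_partial is \<phi> x = 0"
proof (induction "is" arbitrary: x)
  case Nil
  then show ?case using closure_subset[of "{y. \<phi> y \<noteq> 0}"] by (auto simp: iter_partial_def)
next
  case (Cons i js)
  show ?case unfolding iter_partial_Cons
    by (rule partial_zero_near[of "- closure {y. \<phi> y \<noteq> 0}"]) (use Cons in auto)
qed

lemma smooth_iter_partial:
  assumes "smooth \<phi>"
  shows "iter_partial is \<phi> differentiable (at x)" "continuous_on A (iter_partial is \<phi>)"
proof -
  have d: "iter_partial is \<phi> differentiable_on UNIV" using assms unfolding smooth_def by blast
  then show "iter_partial is \<phi> differentiable (at x)" by (simp add: differentiable_on_def)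
  show "continuous_on A (iter_partial is \<phi>)"
    using differentiable_imp_continuous_on[OF d] continuous_on_subset by blast
qed

lemma continuous_tensor:
  assumes "\<And>i. infinitely_differentiable (\<eta> i)"
  shows "continuous_on A (tensor \<eta>)"
proof -
  have "continuous_on A (\<lambda>x. \<eta> i (x $ i))" for i
    by (rule continuous_on_compose2[OF infinitely_differentiable_continuous[OF assms, of UNIV]])
       (auto intro!: continuous_intros)
  then show ?thesis unfolding tensor_def[abs_def] by (intro continuous_on_prod) auto
qed

lemma integral_by_parts_partial:
  fixes g :: "real^'n::finite \<Rightarrow> real"
  assumes \<eta>: "\<And>i. infinitely_differentiable (\<eta> i)"
    and g: "\<And>x. g differentiable (at x)" "continuous_on UNIV (partial i g)" "compact S"
      "\<And>x. x \<notin> S \<Longrightarrow> g x = 0" "\<And>x. x \<notin> S \<Longrightarrow> partial i g x = 0"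
  shows "(LBINT x. tensor \<eta> x * partial i g x) = - (LBINT x. tensor (\<eta>(i := deriv (\<eta> i))) x * g x)"
proof -
  let ?\<eta>' = "\<eta>(i := deriv (\<eta> i))"
  have \<eta>': "infinitely_differentiable (?\<eta>' j)" for j
    using \<eta>[of j] infinitely_differentiable_deriv[OF \<eta>[of i]] by simp
  have gc: "continuous_on UNIV g"
    by (intro continuous_at_imp_continuous_on ballI differentiable_imp_continuous_within g(1))
  have supp: "bounded {x. F x * G x \<noteq> 0}" if "\<And>x. x \<notin> S \<Longrightarrow> G x = 0" for F G :: "real^'n \<Rightarrow> real"
    by (rule bounded_subset[OF compact_imp_bounded[OF g(3)]]) (use that in auto)
  have part: "partial i (\<lambda>x. tensor \<eta> x * g x) x = tensor ?\<eta>' x * g x + tensor \<eta> x * partial i g x" for x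
  proof -
    have "(g has_derivative frechet_derivative g (at x)) (at x)"
      by (rule frechet_derivative_works[THEN iffD1, OF g(1)])
    moreover have "(tensor \<eta> has_derivative frechet_derivative (tensor \<eta>) (at x)) (at x)"
      by (rule frechet_derivative_works[THEN iffD1, OF differentiable_tensor[OF \<eta>]])
    ultimately have "((\<lambda>x. tensor \<eta> x * g x) has_derivative
        (\<lambda>h. tensor \<eta> x * frechet_derivative g (at x) h + frechet_derivative (tensor \<eta>) (at x) h * g x)) (at x)"
      by (intro has_derivative_mult)
    from partial_eqI[OF this] have "partial i (\<lambda>x. tensor \<eta> x * g x) x =
        tensor \<eta> x * partial i g x + partial i (tensor \<eta>) x * g x" by (simp add: partial_def)
    then show ?thesis by (simp add: partial_tensor[OF \<eta>])
  qed
  have int: "integrable lborel (\<lambda>x. tensor ?\<eta>' x * g x)" "integrable lborel (\<lambda>x. tensor \<eta> x * partial i g x)"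
    using g(4,5) by (auto intro!: integrable_continuous_bounded_support continuous_on_mult
      continuous_tensor \<eta> \<eta>' gc g(2) supp simp del: fun_upd_apply)
  have "(LBINT x. partial i (\<lambda>x. tensor \<eta> x * g x) x) = 0"
  proof (rule integral_partial_eq_0)
    show "(\<lambda>x. tensor \<eta> x * g x) differentiable at x" for x
      by (rule differentiable_mult[OF differentiable_tensor[OF \<eta>] g(1)])
    show "continuous_on UNIV (partial i (\<lambda>x. tensor \<eta> x * g x))"
      unfolding part[abs_def] by (intro continuous_on_add continuous_on_mult continuous_tensor \<eta> \<eta>' gc g(2))
    show "bounded {x. tensor \<eta> x * g x \<noteq> 0}" by (rule supp) (rule g(4))
  qed
  then show ?thesis unfolding part using int by simp
qed

lemma test_function_by_parts:
  fixes \<phi> :: "real^'n::finite \<Rightarrow> real"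
  assumes \<phi>: "test_function D \<phi>" and \<eta>: "\<And>i. infinitely_differentiable (\<eta> i)"
  shows "(LBINT x. tensor \<eta> x * iter_partial is \<phi> x) =
    (-1) ^ length is * (LBINT x. tensor (\<lambda>i. (deriv ^^ count_list is i) (\<eta> i)) x * \<phi> x)"
  using \<eta>
proof (induction "is" arbitrary: \<eta>)
  case Nil
  then show ?case by (simp add: iter_partial_def)
next
  case (Cons i js)
  let ?\<eta>' = "\<eta>(i := deriv (\<eta> i))" and ?S = "closure {y. \<phi> y \<noteq> 0}"
  have sm: "smooth \<phi>" and S: "compact ?S" using \<phi> unfolding test_function_def by auto
  have \<eta>': "infinitely_differentiable (?\<eta>' j)" for j
    using Cons.prems[of j] infinitely_differentiable_deriv[OF Cons.prems[of i]] by simp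
  have "(LBINT x. tensor \<eta> x * iter_partial (i # js) \<phi> x) = - (LBINT x. tensor ?\<eta>' x * iter_partial js \<phi> x)"
    unfolding iter_partial_Cons
  proof (rule integral_by_parts_partial[OF Cons.prems smooth_iter_partial(1)[OF sm] _ S])
    show "continuous_on UNIV (partial i (iter_partial js \<phi>))"
      using smooth_iter_partial(2)[OF sm, of UNIV "i # js"] by (simp add: iter_partial_Cons)
    show "iter_partial js \<phi> x = 0" "partial i (iter_partial js \<phi>) x = 0" if "x \<notin> ?S" for x
      using iter_partial_zero_outside[OF that, of js] iter_partial_zero_outside[OF that, of "i # js"]
      by (simp_all add: iter_partial_Cons)
  qed
  also have "\<dots> = - ((-1) ^ length js * (LBINT x. tensor (\<lambda>j. (deriv ^^ count_list js j) (?\<eta>' j)) x * \<phi> x))"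
    by (simp only: Cons.IH[OF \<eta>'])
  also have "(\<lambda>j. (deriv ^^ count_list js j) (?\<eta>' j)) = (\<lambda>j. (deriv ^^ count_list (i # js) j) (\<eta> j))"
  proof
    fix j
    show "(deriv ^^ count_list js j) (?\<eta>' j) = (deriv ^^ count_list (i # js) j) (\<eta> j)"
      by (cases "j = i") (simp_all add: funpow_swap1[of deriv _ "\<eta> i", symmetric])
  qed
  finally show ?case by simp
qed

lemma monomial_tensor_deriv:
  "tensor (\<lambda>i. (deriv ^^ \<beta> i) (\<lambda>t. t ^ \<gamma> i / fact (\<gamma> i))) =
    (if \<forall>i. \<beta> i \<le> \<gamma> i then taylor_monomial (\<lambda>i. \<gamma> i - \<beta> i) else (\<lambda>_. 0))"
proof (cases "\<forall>i. \<beta> i \<le> \<gamma> i")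
  case True
  then show ?thesis by (simp add: deriv_monomial taylor_monomial_def)
next
  case False
  then obtain i where "\<not> \<beta> i \<le> \<gamma> i" by blast
  then have "tensor (\<lambda>i. (deriv ^^ \<beta> i) (\<lambda>t. t ^ \<gamma> i / fact (\<gamma> i))) x = 0" for x
    unfolding tensor_def by (intro prod_zero) (auto simp: deriv_monomial)
  with False show ?thesis by auto
qed

definition taylor_polynomial :: "('n::finite multi_index \<Rightarrow> real) \<Rightarrow> nat \<Rightarrow> real^'n \<Rightarrow> real" where
  "taylor_polynomial c m x = (\<Sum>\<gamma> | mi_order \<gamma> < m. c \<gamma> * taylor_monomial \<gamma> x)"

lemma finite_mi_order_less: "finite {\<gamma> :: 'n::finite multi_index. mi_order \<gamma> < m}"
  by (rule finite_subset[OF _ finite_mi_order_le[of m]]) auto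

lemma continuous_taylor_polynomial: "continuous_on A (taylor_polynomial c m)"
  unfolding taylor_polynomial_def[abs_def]
  by (intro continuous_on_sum continuous_on_mult continuous_on_const continuous_taylor_monomial)

lemma mi_partial_test_function:
  fixes \<phi> :: "real^'n::finite \<Rightarrow> real"
  assumes "test_function D \<phi>"
  obtains S where "compact S" "S \<subseteq> D" "continuous_on UNIV (mi_partial \<beta> \<phi>)" "continuous_on UNIV \<phi>"
    "\<And>x. x \<notin> S \<Longrightarrow> mi_partial \<beta> \<phi> x = 0" "\<And>x. x \<notin> S \<Longrightarrow> \<phi> x = 0"
proof (rule that[of "closure {y. \<phi> y \<noteq> 0}"])
  have sm: "smooth \<phi>" using assms unfolding test_function_def by simp
  show "compact (closure {y. \<phi> y \<noteq> 0})" "closure {y. \<phi> y \<noteq> 0} \<subseteq> D"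
    using assms unfolding test_function_def by auto
  show "continuous_on UNIV (mi_partial \<beta> \<phi>)" unfolding mi_partial_def by (rule smooth_iter_partial(2)[OF sm])
  show "continuous_on UNIV \<phi>" using smooth_iter_partial(2)[OF sm, of UNIV "[]"] by (simp add: iter_partial_def)
  show "mi_partial \<beta> \<phi> x = 0" "\<phi> x = 0" if "x \<notin> closure {y. \<phi> y \<noteq> 0}" for x
    using iter_partial_zero_outside[OF that] iter_partial_zero_outside[OF that, of "[]"]
    by (simp_all add: mi_partial_def iter_partial_def)
qed

text \<open>
  Only monomials \<open>\<gamma> \<ge> \<beta>\<close> survive \<open>\<partial>\<^sup>\<beta>\<close>; writing them as \<open>\<gamma> + \<beta>\<close> gives the shifted coefficients.
\<close>

lemma taylor_polynomial_by_parts: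
  fixes \<phi> :: "real^'n::finite \<Rightarrow> real"
  assumes \<phi>: "test_function D \<phi>" and \<beta>: "mi_order \<beta> \<le> m"
  shows "(LBINT x. taylor_polynomial c m x * mi_partial \<beta> \<phi> x) = (-1) ^ mi_order \<beta> *
    (LBINT x. taylor_polynomial (\<lambda>\<gamma>. c (mi_add \<gamma> \<beta>)) (m - mi_order \<beta>) x * \<phi> x)"
proof -
  obtain S where S: "compact S" "S \<subseteq> D" "continuous_on UNIV (mi_partial \<beta> \<phi>)" "continuous_on UNIV \<phi>"
    "\<And>x. x \<notin> S \<Longrightarrow> mi_partial \<beta> \<phi> x = 0" "\<And>x. x \<notin> S \<Longrightarrow> \<phi> x = 0"
    using mi_partial_test_function[OF \<phi>] by metis
  have int: "integrable lborel (\<lambda>x. taylor_monomial \<gamma> x * G x)"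
    if G: "continuous_on UNIV G" "\<And>x. x \<notin> S \<Longrightarrow> G x = 0" for \<gamma> and G :: "real^'n \<Rightarrow> real"
  proof (rule integrable_continuous_bounded_support)
    show "continuous_on UNIV (\<lambda>x. taylor_monomial \<gamma> x * G x)"
      by (intro continuous_on_mult continuous_taylor_monomial G(1))
    show "bounded {x. taylor_monomial \<gamma> x * G x \<noteq> 0}"
      by (rule bounded_subset[OF compact_imp_bounded[OF S(1)]]) (use G(2) in auto)
  qed
  have int_poly: "(LBINT x. taylor_polynomial d k x * G x) =
      (\<Sum>\<gamma> | mi_order \<gamma> < k. d \<gamma> * (LBINT x. taylor_monomial \<gamma> x * G x))"
    if G: "continuous_on UNIV G" "\<And>x. x \<notin> S \<Longrightarrow> G x = 0" for d k and G :: "real^'n \<Rightarrow> real"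
  proof -
    have "(LBINT x. taylor_polynomial d k x * G x) =
        (LBINT x. (\<Sum>\<gamma> | mi_order \<gamma> < k. d \<gamma> * (taylor_monomial \<gamma> x * G x)))"
      by (simp add: taylor_polynomial_def sum_distrib_right mult.assoc)
    also have "\<dots> = (\<Sum>\<gamma> | mi_order \<gamma> < k. LBINT x. d \<gamma> * (taylor_monomial \<gamma> x * G x))"
      by (intro Bochner_Integration.integral_sum integrable_mult_right int G)
    finally show ?thesis by simp
  qed
  define L where "L = (SOME is. \<forall>i. count_list is i = \<beta> i)"
  have L: "\<forall>i. count_list L i = \<beta> i" unfolding L_def by (rule someI_ex[OF exists_list_with_counts])
  have mono: "(LBINT x. taylor_monomial \<gamma> x * mi_partial \<beta> \<phi> x) = (-1) ^ mi_order \<beta> *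
      (if \<forall>i. \<beta> i \<le> \<gamma> i then \<integral>x. taylor_monomial (\<lambda>i. \<gamma> i - \<beta> i) x * \<phi> x \<partial>lborel else 0)" for \<gamma>
  proof -
    have "(LBINT x. taylor_monomial \<gamma> x * mi_partial \<beta> \<phi> x) = (-1) ^ length L *
        (LBINT x. tensor (\<lambda>i. (deriv ^^ count_list L i) (\<lambda>t. t ^ \<gamma> i / fact (\<gamma> i))) x * \<phi> x)"
      unfolding taylor_monomial_def mi_partial_def L_def[symmetric]
      by (rule test_function_by_parts[OF \<phi> infinitely_differentiable_monomial])
    also have "(\<lambda>i. (deriv ^^ count_list L i) (\<lambda>t::real. t ^ \<gamma> i / fact (\<gamma> i))) =
        (\<lambda>i. (deriv ^^ \<beta> i) (\<lambda>t. t ^ \<gamma> i / fact (\<gamma> i)))" using L by simp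
    finally show ?thesis by (simp add: monomial_tensor_deriv mi_order_list[OF L])
  qed
  have "(LBINT x. taylor_polynomial c m x * mi_partial \<beta> \<phi> x) =
      (\<Sum>\<gamma> | mi_order \<gamma> < m. c \<gamma> * (LBINT x. taylor_monomial \<gamma> x * mi_partial \<beta> \<phi> x))"
    by (rule int_poly[OF S(3,5)])
  also have "\<dots> = (-1) ^ mi_order \<beta> * (\<Sum>\<gamma> | mi_order \<gamma> < m. if \<forall>i. \<beta> i \<le> \<gamma> i
        then c \<gamma> * (LBINT x. taylor_monomial (\<lambda>i. \<gamma> i - \<beta> i) x * \<phi> x) else 0)"
    unfolding mono sum_distrib_left by (intro sum.cong refl) auto
  also have "(\<Sum>\<gamma> | mi_order \<gamma> < m. if \<forall>i. \<beta> i \<le> \<gamma> i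
        then c \<gamma> * (LBINT x. taylor_monomial (\<lambda>i. \<gamma> i - \<beta> i) x * \<phi> x) else 0) =
      (\<Sum>\<gamma> | mi_order \<gamma> < m \<and> (\<forall>i. \<beta> i \<le> \<gamma> i).
        c \<gamma> * (LBINT x. taylor_monomial (\<lambda>i. \<gamma> i - \<beta> i) x * \<phi> x))"
    by (intro sum.mono_neutral_cong_right finite_mi_order_less) auto
  also have "\<dots> = (\<Sum>\<gamma> | mi_order \<gamma> < m - mi_order \<beta>. c (mi_add \<gamma> \<beta>) * (LBINT x. taylor_monomial \<gamma> x * \<phi> x))"
  proof (rule sum.reindex_bij_witness[of _ "\<lambda>\<gamma>. mi_add \<gamma> \<beta>" "\<lambda>\<gamma> i. \<gamma> i - \<beta> i"])
    fix \<gamma> :: "'n multi_index" assume "\<gamma> \<in> {\<gamma>. mi_order \<gamma> < m \<and> (\<forall>i. \<beta> i \<le> \<gamma> i)}"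
    then have \<gamma>: "mi_order \<gamma> < m" "\<forall>i. \<beta> i \<le> \<gamma> i" by auto
    have add: "mi_add (\<lambda>i. \<gamma> i - \<beta> i) \<beta> = \<gamma>" using \<gamma>(2) by (simp add: mi_add_def)
    then show "mi_add (\<lambda>i. \<gamma> i - \<beta> i) \<beta> = \<gamma>" .
    have "mi_order (\<lambda>i. \<gamma> i - \<beta> i) + mi_order \<beta> = mi_order \<gamma>"
      using mi_order_add[of "\<lambda>i. \<gamma> i - \<beta> i" \<beta>] unfolding add by simp
    then show "(\<lambda>i. \<gamma> i - \<beta> i) \<in> {\<gamma>. mi_order \<gamma> < m - mi_order \<beta>}" using \<gamma>(1) by simp
    show "c (mi_add (\<lambda>i. \<gamma> i - \<beta> i) \<beta>) * (LBINT x. taylor_monomial (\<lambda>i. \<gamma> i - \<beta> i) x * \<phi> x) =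
        c \<gamma> * (LBINT x. taylor_monomial (\<lambda>i. \<gamma> i - \<beta> i) x * \<phi> x)" unfolding add ..
  next
    fix \<gamma> :: "'n multi_index" assume "\<gamma> \<in> {\<gamma>. mi_order \<gamma> < m - mi_order \<beta>}"
    then have "mi_order (mi_add \<gamma> \<beta>) < m" by simp
    then show "mi_add \<gamma> \<beta> \<in> {\<gamma>. mi_order \<gamma> < m \<and> (\<forall>i. \<beta> i \<le> \<gamma> i)}"
      by (simp add: mi_add_def)
    show "(\<lambda>i. mi_add \<gamma> \<beta> i - \<beta> i) = \<gamma>" by (simp add: mi_add_def)
  qed
  also have "\<dots> = (LBINT x. taylor_polynomial (\<lambda>\<gamma>. c (mi_add \<gamma> \<beta>)) (m - mi_order \<beta>) x * \<phi> x)"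
    by (rule int_poly[OF S(4,6), symmetric])
  finally show ?thesis .
qed

lemma locally_integrable_continuous:
  fixes f :: "'a::euclidean_space \<Rightarrow> real"
  assumes f: "continuous_on UNIV f"
  shows "locally_integrable_on f D"
  unfolding locally_integrable_on_def
proof (intro allI impI)
  fix S :: "'a set" assume S: "compact S \<and> S \<subseteq> D"
  then have "integrable lborel (\<lambda>x. indicator S x *\<^sub>R f x)"
    by (intro borel_integrable_compact continuous_on_subset[OF f]) auto
  then have "integrable lebesgue (\<lambda>x. indicator S x *\<^sub>R f x)"
    by (subst integrable_completion) auto
  then show "set_integrable lebesgue S f" by (simp add: set_integrable_def)
qed

lemma set_integrable_times_compact_support:
  fixes u g :: "'a::euclidean_space \<Rightarrow> real"
  assumes u: "locally_integrable_on u D" and S: "compact S" "S \<subseteq> D"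
    and g: "continuous_on UNIV g" "\<And>x. x \<notin> S \<Longrightarrow> g x = 0"
  shows "set_integrable lebesgue D (\<lambda>x. u x * g x)"
proof -
  have "bounded (g ` S)"
    by (intro compact_imp_bounded compact_continuous_image continuous_on_subset[OF g(1)] S(1)) auto
  then obtain B where B: "\<And>x. x \<in> S \<Longrightarrow> \<bar>g x\<bar> \<le> B" unfolding bounded_iff real_norm_def by blast
  have "integrable lebesgue (\<lambda>x. indicator S x *\<^sub>R u x)"
    using u S unfolding locally_integrable_on_def set_integrable_def by blast
  moreover have "g \<in> borel_measurable lebesgue"
    using borel_measurable_continuous_onI[OF g(1)] by (simp add: measurable_completion)
  ultimately have "integrable lebesgue (\<lambda>x. (indicator S x *\<^sub>R u x) * g x)"
    by (rule integrable_times_bounded) (use B in \<open>auto simp: indicator_def split: if_splits\<close>)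
  moreover have "(indicator S x *\<^sub>R u x) * g x = indicator D x *\<^sub>R (u x * g x)" for x
    using S(2) g(2)[of x] by (auto simp: indicator_def)
  ultimately show ?thesis by (simp only: set_integrable_def)
qed

lemma weak_derivative_diff_taylor_polynomial:
  fixes D :: "(real^'n::finite) set"
  assumes w: "weak_derivative D \<beta> u w" and \<beta>: "mi_order \<beta> \<le> m"
  shows "weak_derivative D \<beta> (\<lambda>x. u x - taylor_polynomial c m x)
    (\<lambda>x. w x - taylor_polynomial (\<lambda>\<gamma>. c (mi_add \<gamma> \<beta>)) (m - mi_order \<beta>) x)"
  unfolding weak_derivative_def
proof (intro conjI allI impI)
  let ?q = "taylor_polynomial c m" and ?q' = "taylor_polynomial (\<lambda>\<gamma>. c (mi_add \<gamma> \<beta>)) (m - mi_order \<beta>)"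
  have u: "locally_integrable_on u D" "locally_integrable_on w D"
    using w unfolding weak_derivative_def by auto
  have q: "locally_integrable_on ?q D" "locally_integrable_on ?q' D"
    by (rule locally_integrable_continuous, rule continuous_taylor_polynomial)+
  show "locally_integrable_on (\<lambda>x. u x - ?q x) D" "locally_integrable_on (\<lambda>x. w x - ?q' x) D"
    using u q unfolding locally_integrable_on_def by auto
  fix \<phi> :: "real^'n \<Rightarrow> real" assume \<phi>: "test_function D \<phi>"
  obtain S where S: "compact S" "S \<subseteq> D" "continuous_on UNIV (mi_partial \<beta> \<phi>)" "continuous_on UNIV \<phi>"
    "\<And>x. x \<notin> S \<Longrightarrow> mi_partial \<beta> \<phi> x = 0" "\<And>x. x \<notin> S \<Longrightarrow> \<phi> x = 0"
    using mi_partial_test_function[OF \<phi>] by metis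
  have split: "(LINT x:D|lebesgue. (f x - p x) * G x) = (LINT x:D|lebesgue. f x * G x) - (LBINT x. p x * G x)"
    if f: "locally_integrable_on f D" and p: "continuous_on UNIV p"
      and G: "continuous_on UNIV G" "\<And>x. x \<notin> S \<Longrightarrow> G x = 0" for f p G
  proof -
    have "(LINT x:D|lebesgue. (f x - p x) * G x) = (LINT x:D|lebesgue. f x * G x - p x * G x)"
      by (simp add: left_diff_distrib)
    also have "\<dots> = (LINT x:D|lebesgue. f x * G x) - (LINT x:D|lebesgue. p x * G x)"
      by (intro set_integral_diff(2) set_integrable_times_compact_support[OF _ S(1,2) G]
          f locally_integrable_continuous p)
    also have "(LINT x:D|lebesgue. p x * G x) = (LBINT x. p x * G x)"
    proof (rule lebesgue_integral_representative(1))
      show "(\<lambda>x. p x * G x) \<in> borel_measurable borel"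
        by (intro borel_measurable_continuous_onI continuous_on_mult p G(1))
      show "p x * G x = 0" if "x \<notin> D" for x using G(2)[of x] S(2) that by auto
    qed simp
    finally show ?thesis .
  qed
  have "(LINT x:D|lebesgue. u x * mi_partial \<beta> \<phi> x) = (-1) ^ mi_order \<beta> * (LINT x:D|lebesgue. w x * \<phi> x)"
    using w \<phi> unfolding weak_derivative_def by blast
  moreover have "(LINT x:D|lebesgue. (u x - ?q x) * mi_partial \<beta> \<phi> x) =
      (LINT x:D|lebesgue. u x * mi_partial \<beta> \<phi> x) - (LBINT x. ?q x * mi_partial \<beta> \<phi> x)"
    by (rule split[OF u(1) continuous_taylor_polynomial S(3,5)])
  moreover have "(LINT x:D|lebesgue. (w x - ?q' x) * \<phi> x) =
      (LINT x:D|lebesgue. w x * \<phi> x) - (LBINT x. ?q' x * \<phi> x)"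
    by (rule split[OF u(2) continuous_taylor_polynomial S(4,6)])
  ultimately show "(LINT x:D|lebesgue. (u x - ?q x) * mi_partial \<beta> \<phi> x) =
      (-1) ^ mi_order \<beta> * (LINT x:D|lebesgue. (w x - ?q' x) * \<phi> x)"
    by (simp add: taylor_polynomial_by_parts[OF \<phi> \<beta>] right_diff_distrib)
qed

lemma polynomial_taylor_polynomial: "polynomial_of_degree_le k (taylor_polynomial c (k + 1))"
  unfolding polynomial_of_degree_le_def
proof (intro exI allI)
  fix x
  show "taylor_polynomial c (k + 1) x =
      (\<Sum>\<alpha> | mi_order \<alpha> \<le> k. c \<alpha> / mi_fact \<alpha> * (\<Prod>i\<in>UNIV. (x $ i) ^ \<alpha> i))"
    unfolding taylor_polynomial_def by (intro sum.cong) (auto simp: taylor_monomial_eq)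
qed

section \<open>Sobolev functions\<close>

text \<open>
  Multi-indices of order \<open>m\<close> have entries at most \<open>m\<close>, and over all such families the sum factorises
  into \<open>n\<close> partial sums of the exponential series.
\<close>

lemma sum_inverse_mi_fact_le:
  "(\<Sum>\<alpha> :: 'n::finite multi_index | mi_order \<alpha> = m. 1 / mi_fact \<alpha>) \<le> exp (1::real) ^ CARD('n)"
proof -
  let ?P = "PiE (UNIV :: 'n set) (\<lambda>_. {..m})"
  have "(\<Sum>\<alpha> :: 'n multi_index | mi_order \<alpha> = m. 1 / (\<Prod>i\<in>UNIV. fact (\<alpha> i) :: real)) \<le>
      (\<Sum>\<alpha>\<in>?P. 1 / mi_fact \<alpha>)"
  proof (rule sum_mono2)
    show "finite ?P" by (rule finite_PiE) simp_all
    show "{\<alpha>. mi_order \<alpha> = m} \<subseteq> ?P"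
    proof
      fix \<alpha> :: "'n multi_index" assume "\<alpha> \<in> {\<alpha>. mi_order \<alpha> = m}"
      then have "sum \<alpha> UNIV = m" by (simp add: mi_order_def)
      moreover have "\<alpha> i \<le> sum \<alpha> UNIV" for i by (rule member_le_sum) simp_all
      ultimately show "\<alpha> \<in> ?P" by (simp add: PiE_iff)
    qed
    show "0 \<le> 1 / (\<Prod>i\<in>UNIV. fact (\<alpha> i) :: real)" for \<alpha> :: "'n multi_index"
      by (intro divide_nonneg_nonneg prod_nonneg) auto
  qed
  also have "\<dots> = (\<Sum>\<alpha>\<in>?P. \<Prod>i\<in>UNIV. 1 / fact (\<alpha> i))" by (simp add: prod_dividef)
  also have "\<dots> = (\<Prod>i\<in>(UNIV :: 'n set). \<Sum>j\<le>m. 1 / fact j)"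
    by (rule prod_sum_PiE[symmetric]) auto
  also have "\<dots> = (\<Sum>j\<le>m. 1 / fact j) ^ CARD('n)" by simp
  also have "\<dots> \<le> exp 1 ^ CARD('n)"
  proof (rule power_mono)
    have s: "(\<lambda>j. 1 / fact j :: real) sums exp 1"
      using exp_converges[of "1::real"] by (simp add: divide_inverse)
    show "(\<Sum>j\<le>m. 1 / fact j) \<le> exp (1::real)"
      using sum_le_suminf[OF sums_summable[OF s], of "{..m}"] sums_unique[OF s] by simp
  qed (auto intro: sum_nonneg)
  finally show ?thesis .
qed

lemma weighted_sum_square_le:
  fixes w a :: "'b \<Rightarrow> real"
  assumes "\<And>x. x \<in> S \<Longrightarrow> w x \<ge> 0"
  shows "(\<Sum>x\<in>S. w x * a x)\<^sup>2 \<le> (\<Sum>x\<in>S. w x) * (\<Sum>x\<in>S. w x * (a x)\<^sup>2)"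
proof -
  have "(\<Sum>x\<in>S. sqrt (w x) * (sqrt (w x) * a x))\<^sup>2 \<le> (\<Sum>x\<in>S. (sqrt (w x))\<^sup>2) * (\<Sum>x\<in>S. (sqrt (w x) * a x)\<^sup>2)"
    by (rule Cauchy_Schwarz_ineq_sum)
  moreover have "(\<Sum>x\<in>S. sqrt (w x) * (sqrt (w x) * a x)) = (\<Sum>x\<in>S. w x * a x)"
    using assms by (intro sum.cong) (auto simp: mult.assoc[symmetric])
  moreover have "(\<Sum>x\<in>S. (sqrt (w x))\<^sup>2) = (\<Sum>x\<in>S. w x)"
    using assms by (intro sum.cong) auto
  moreover have "(\<Sum>x\<in>S. (sqrt (w x) * a x)\<^sup>2) = (\<Sum>x\<in>S. w x * (a x)\<^sup>2)"
    using assms by (intro sum.cong) (auto simp: power_mult_distrib)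
  ultimately show ?thesis by simp
qed

text \<open>
  Cauchy-Schwarz with the weights \<open>1 / \<alpha>!\<close>, applied before summing over \<open>\<beta>\<close>. For fixed \<open>\<alpha>\<close> the
  multi-indices \<open>\<alpha> + \<beta>\<close> are distinct, so no counting of multi-indices, which would bring in powers of
  \<open>k\<close>, is needed.
\<close>

lemma sum_shifted_taylor_weights:
  fixes a :: "'n::finite multi_index \<Rightarrow> real"
  shows "(\<Sum>\<beta> | mi_order \<beta> = l. (\<Sum>\<alpha> | mi_order \<alpha> = m. a (mi_add \<alpha> \<beta>) / mi_fact \<alpha>)\<^sup>2)
    \<le> (exp 1 ^ CARD('n))\<^sup>2 * (\<Sum>\<gamma> | mi_order \<gamma> = m + l. (a \<gamma>)\<^sup>2)"
proof -
  let ?L = "{\<beta> :: 'n multi_index. mi_order \<beta> = l}" and ?M = "{\<alpha> :: 'n multi_index. mi_order \<alpha> = m}"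
  let ?w = "\<lambda>\<alpha> :: 'n multi_index. 1 / mi_fact \<alpha> :: real"
  let ?E = "exp (1::real) ^ CARD('n)" and ?S = "\<Sum>\<gamma> | mi_order \<gamma> = m + l. (a \<gamma>)\<^sup>2"
  have w: "?w \<alpha> \<ge> 0" for \<alpha> by (intro divide_nonneg_nonneg prod_nonneg) auto
  have E: "(\<Sum>\<alpha>\<in>?M. ?w \<alpha>) \<le> ?E" by (rule sum_inverse_mi_fact_le)
  have S0: "?S \<ge> 0" by (intro sum_nonneg) auto
  have shift: "(\<Sum>\<beta>\<in>?L. (a (mi_add \<alpha> \<beta>))\<^sup>2) \<le> ?S" if "\<alpha> \<in> ?M" for \<alpha>
  proof -
    have "inj_on (mi_add \<alpha>) ?L" by (auto simp: inj_on_def mi_add_def fun_eq_iff)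
    then have "(\<Sum>\<beta>\<in>?L. (a (mi_add \<alpha> \<beta>))\<^sup>2) = (\<Sum>\<gamma>\<in>mi_add \<alpha> ` ?L. (a \<gamma>)\<^sup>2)"
      by (subst sum.reindex) (auto simp: comp_def)
    also have "\<dots> \<le> ?S" using that by (intro sum_mono2 finite_mi_order_eq) auto
    finally show ?thesis .
  qed
  have "(\<Sum>\<beta>\<in>?L. (\<Sum>\<alpha>\<in>?M. a (mi_add \<alpha> \<beta>) / mi_fact \<alpha>)\<^sup>2)
      = (\<Sum>\<beta>\<in>?L. (\<Sum>\<alpha>\<in>?M. ?w \<alpha> * a (mi_add \<alpha> \<beta>))\<^sup>2)" by simp
  also have "\<dots> \<le> (\<Sum>\<beta>\<in>?L. (\<Sum>\<alpha>\<in>?M. ?w \<alpha>) * (\<Sum>\<alpha>\<in>?M. ?w \<alpha> * (a (mi_add \<alpha> \<beta>))\<^sup>2))"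
    by (intro sum_mono weighted_sum_square_le w)
  also have "\<dots> \<le> (\<Sum>\<beta>\<in>?L. ?E * (\<Sum>\<alpha>\<in>?M. ?w \<alpha> * (a (mi_add \<alpha> \<beta>))\<^sup>2))"
    by (intro sum_mono mult_right_mono E sum_nonneg mult_nonneg_nonneg w) auto
  also have "\<dots> = ?E * (\<Sum>\<alpha>\<in>?M. ?w \<alpha> * (\<Sum>\<beta>\<in>?L. (a (mi_add \<alpha> \<beta>))\<^sup>2))"
    by (subst sum_distrib_left[symmetric], subst sum.swap) (simp only: sum_distrib_left)
  also have "\<dots> \<le> ?E * (\<Sum>\<alpha>\<in>?M. ?w \<alpha> * ?S)"
    by (intro mult_left_mono sum_mono shift w) auto
  also have "\<dots> = ?E * ((\<Sum>\<alpha>\<in>?M. ?w \<alpha>) * ?S)" by (simp only: sum_distrib_right)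
  also have "\<dots> \<le> ?E * (?E * ?S)"
    by (intro mult_left_mono mult_right_mono E S0) auto
  finally show ?thesis by (simp add: power2_eq_square mult.assoc)
qed

text \<open>
  Both sides are, up to the same sign, the integral of \<open>u\<close> times the derivative of the test function along
  \<open>\<alpha> + e\<^sub>i\<close>.
\<close>

lemma weak_derivative_step:
  fixes D :: "(real^'n::finite) set"
  assumes w: "weak_derivative D \<alpha> u w" and w': "weak_derivative D (mi_inc i \<alpha>) u w'"
    and \<eta>: "\<And>j. infinitely_differentiable (\<eta> j)" "\<And>j t. \<eta> j t \<noteq> 0 \<Longrightarrow> t \<in> {c $ j..d $ j}" "cbox c d \<subseteq> D"
  shows "(LINT x:D|lebesgue. w x * partial i (tensor \<eta>) x) = - (LINT x:D|lebesgue. w' x * tensor \<eta> x)"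
proof -
  let ?\<eta>' = "\<eta>(i := deriv (\<eta> i))"
  have \<eta>': "infinitely_differentiable (?\<eta>' j)" for j
    using \<eta>(1)[of j] infinitely_differentiable_deriv[OF \<eta>(1)[of i]] by simp
  have supp': "t \<in> {c $ j..d $ j}" if "?\<eta>' j t \<noteq> 0" for j t
  proof (cases "j = i")
    case True
    with that have "deriv (\<eta> i) t \<noteq> 0" by simp
    from deriv_support[of "\<eta> i" "c $ i" "d $ i" t, OF \<eta>(2) this] True show ?thesis by simp
  next
    case False
    with that \<eta>(2)[of j t] show ?thesis by simp
  qed
  have test: "test_function D (tensor \<eta>)" by (rule test_function_tensor[OF \<eta>])
  have test': "test_function D (tensor ?\<eta>')" by (rule test_function_tensor[OF \<eta>' supp' \<eta>(3)])
  have "(deriv ^^ \<alpha> j) (?\<eta>' j) = (deriv ^^ mi_inc i \<alpha> j) (\<eta> j)" for j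
    by (cases "j = i") (simp_all add: mi_inc_def funpow_swap1[of deriv _ "\<eta> i", symmetric])
  then have eq: "mi_partial \<alpha> (tensor ?\<eta>') = mi_partial (mi_inc i \<alpha>) (tensor \<eta>)"
    by (simp only: mi_partial_tensor[OF \<eta>'] mi_partial_tensor[OF \<eta>(1)])
  have "(LINT x:D|lebesgue. u x * mi_partial \<alpha> (tensor ?\<eta>') x) =
      (-1) ^ mi_order \<alpha> * (LINT x:D|lebesgue. w x * tensor ?\<eta>' x)"
    using w test' unfolding weak_derivative_def by blast
  moreover have "(LINT x:D|lebesgue. u x * mi_partial (mi_inc i \<alpha>) (tensor \<eta>) x) =
      (-1) ^ mi_order (mi_inc i \<alpha>) * (LINT x:D|lebesgue. w' x * tensor \<eta> x)"
    using w' test unfolding weak_derivative_def by blast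
  ultimately have "(-1) ^ mi_order \<alpha> * (LINT x:D|lebesgue. w x * tensor ?\<eta>' x) =
      (-1) ^ mi_order \<alpha> * (- (LINT x:D|lebesgue. w' x * tensor \<eta> x))" unfolding eq by simp
  then show ?thesis unfolding partial_tensor[OF \<eta>(1)] by (simp only: mult_cancel_left) simp
qed

text \<open>
  On a bounded set square integrable functions are integrable, so Borel representatives of the weak
  derivatives form a weak jet.
\<close>

lemma sobolev_jet:
  fixes D :: "(real^'n::finite) set"
  assumes D: "open D" "bounded D" and u: "in_Sobolev m D u"
  shows "\<exists>w V. weak_jet D m V \<and> (\<forall>\<alpha>. mi_order \<alpha> \<le> m \<longrightarrow>
    weak_derivative D \<alpha> u (w \<alpha>) \<and> (AE x in lebesgue. x \<in> D \<longrightarrow> V \<alpha> x = w \<alpha> x))"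
proof -
  have Db: "D \<in> sets borel" using D(1) by simp
  define R where "R \<alpha> w v \<longleftrightarrow> weak_derivative D \<alpha> u w \<and> integrable lborel v \<and> integrable lborel (\<lambda>x. (v x)\<^sup>2) \<and>
      (\<forall>x. x \<notin> D \<longrightarrow> v x = 0) \<and> (AE x in lebesgue. x \<in> D \<longrightarrow> v x = w x)" for \<alpha> w v
  have "\<exists>w v. R \<alpha> w v" if \<alpha>: "mi_order \<alpha> \<le> m" for \<alpha>
  proof -
    obtain w where w: "weak_derivative D \<alpha> u w" "in_L2 D w"
      using u \<alpha> unfolding in_Sobolev_def by blast
    then have "set_borel_measurable lebesgue D w" unfolding in_L2_def by simp
    from borel_representative[OF Db this] obtain v where v: "v \<in> borel_measurable borel"
      "\<And>x. x \<notin> D \<Longrightarrow> v x = 0" "AE x in lebesgue. x \<in> D \<longrightarrow> v x = w x" by blast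
    have "AE x in lebesgue. x \<in> D \<longrightarrow> (v x)\<^sup>2 = (w x)\<^sup>2"
      using v(3) by eventually_elim auto
    from lebesgue_integral_representative(2)[OF _ _ this] v(1,2) w(2)
    have v2: "integrable lborel (\<lambda>x. (v x)\<^sup>2)" unfolding in_L2_def by simp
    have "integrable lborel v"
    proof (rule Bochner_Integration.integrable_bound)
      have "integrable lborel (\<lambda>x. indicator D x :: real)"
        using Db emeasure_bounded_finite[OF D(2)] by simp
      then show "integrable lborel (\<lambda>x. indicator D x + (v x)\<^sup>2)" using v2 by simp
      have "\<bar>v x\<bar> \<le> indicator D x + (v x)\<^sup>2" for x
      proof (cases "x \<in> D")
        case True
        have "\<bar>v x\<bar> * 1 \<le> (\<bar>v x\<bar>\<^sup>2 + 1\<^sup>2) / 2"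
          using zero_le_power2[of "\<bar>v x\<bar> - 1"] by (simp add: power2_eq_square algebra_simps)
        also have "\<dots> \<le> 1 + (v x)\<^sup>2" by simp
        finally show ?thesis using True by simp
      qed (simp add: v(2))
      then show "AE x in lborel. norm (v x) \<le> norm (indicator D x + (v x)\<^sup>2)" by simp
    qed (use v(1) in simp)
    with w(1) v2 v(2,3) show ?thesis unfolding R_def by blast
  qed
  then have "\<exists>w V. \<forall>\<alpha>. mi_order \<alpha> \<le> m \<longrightarrow> R \<alpha> (w \<alpha>) (V \<alpha>)" by metis
  then obtain w V where R: "\<And>\<alpha>. mi_order \<alpha> \<le> m \<Longrightarrow> R \<alpha> (w \<alpha>) (V \<alpha>)" by blast
  have wV: "\<And>\<alpha>. mi_order \<alpha> \<le> m \<Longrightarrow> weak_derivative D \<alpha> u (w \<alpha>)"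
    "\<And>\<alpha>. mi_order \<alpha> \<le> m \<Longrightarrow> integrable lborel (V \<alpha>)"
    "\<And>\<alpha>. mi_order \<alpha> \<le> m \<Longrightarrow> integrable lborel (\<lambda>x. (V \<alpha> x)\<^sup>2)"
    "\<And>\<alpha> x. mi_order \<alpha> \<le> m \<Longrightarrow> x \<notin> D \<Longrightarrow> V \<alpha> x = 0"
    "\<And>\<alpha>. mi_order \<alpha> \<le> m \<Longrightarrow> AE x in lebesgue. x \<in> D \<longrightarrow> V \<alpha> x = w \<alpha> x"
    using R unfolding R_def by blast+
  have tr: "(LINT z:D|lebesgue. w \<alpha> z * G z) = (LBINT z. V \<alpha> z * G z)"
    if \<alpha>: "mi_order \<alpha> \<le> m" and G: "G \<in> borel_measurable borel" for \<alpha> G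
  proof (rule lebesgue_integral_representative(1))
    show "(\<lambda>z. V \<alpha> z * G z) \<in> borel_measurable borel"
      using wV(2)[OF \<alpha>] G by (intro borel_measurable_times) auto
    show "V \<alpha> z * G z = 0" if "z \<notin> D" for z using wV(4)[OF \<alpha> that] by simp
    show "AE z in lebesgue. z \<in> D \<longrightarrow> V \<alpha> z * G z = w \<alpha> z * G z"
      using wV(5)[OF \<alpha>] by eventually_elim auto
  qed
  have "weak_jet D m V"
    unfolding weak_jet_def
  proof (intro conjI allI impI)
    fix \<alpha> :: "'n multi_index" and i :: 'n and \<eta> and c d :: "real^'n"
    assume \<alpha>: "mi_order \<alpha> < m" and "\<forall>j. infinitely_differentiable (\<eta> j)"
      "\<forall>j t. \<eta> j t \<noteq> 0 \<longrightarrow> t \<in> {c $ j..d $ j}" and cd: "cbox c d \<subseteq> D"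
    then have \<eta>: "\<And>j. infinitely_differentiable (\<eta> j)" "\<And>j t. \<eta> j t \<noteq> 0 \<Longrightarrow> t \<in> {c $ j..d $ j}" by auto
    have \<eta>': "infinitely_differentiable ((\<eta>(i := deriv (\<eta> i))) j)" for j
      using \<eta>(1)[of j] infinitely_differentiable_deriv[OF \<eta>(1)[of i]] by simp
    have le: "mi_order \<alpha> \<le> m" "mi_order (mi_inc i \<alpha>) \<le> m" using \<alpha> by simp_all
    show "(LBINT z. V \<alpha> z * partial i (tensor \<eta>) z) = - (LBINT z. V (mi_inc i \<alpha>) z * tensor \<eta> z)"
    proof -
      have "partial i (tensor \<eta>) \<in> borel_measurable borel"
        unfolding partial_tensor[OF \<eta>(1)] by (rule tensor_measurable[OF \<eta>'])
      from tr[OF le(1) this]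
      have "(LBINT z. V \<alpha> z * partial i (tensor \<eta>) z) = (LINT z:D|lebesgue. w \<alpha> z * partial i (tensor \<eta>) z)" ..
      also have "\<dots> = - (LINT z:D|lebesgue. w (mi_inc i \<alpha>) z * tensor \<eta> z)"
        by (rule weak_derivative_step[OF wV(1)[OF le(1)] wV(1)[OF le(2)] \<eta> cd])
      also have "(LINT z:D|lebesgue. w (mi_inc i \<alpha>) z * tensor \<eta> z) = (LBINT z. V (mi_inc i \<alpha>) z * tensor \<eta> z)"
        by (rule tr[OF le(2) tensor_measurable[OF \<eta>(1)]])
      finally show ?thesis .
    qed
  qed (use wV in auto)
  then show ?thesis using wV(1,5) by blast
qed

text \<open>
  For each \<open>\<beta>\<close> of order \<open>l\<close> the remainder estimate is applied to the jet shifted by \<open>\<beta>\<close>, whose averaged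
  Taylor polynomial is \<open>\<partial>\<^sup>\<beta>\<close> of the one polynomial chosen for \<open>u\<close>.
\<close>

lemma (in star_kernel) sobolev_polynomial_approximation:
  assumes C: "C \<ge> 0" "\<And>s z. 0 < s \<Longrightarrow> s < 1 \<Longrightarrow> (\<integral>\<^sup>+x. K0 s x z * indicator D x \<partial>lborel) \<le> ennreal C"
    and u: "in_Sobolev (k + 1) D u"
  obtains q where "polynomial_of_degree_le k q"
    "\<And>l. l \<le> k \<Longrightarrow> Sobolev_seminorm l D (\<lambda>x. u x - q x) \<le>
      sqrt C * exp 1 ^ CARD('n) * diameter D ^ (k + 1 - l) * Sobolev_seminorm (k + 1) D u"
proof -
  obtain w V where V: "weak_jet D (k + 1) V"
    "\<And>\<alpha>. mi_order \<alpha> \<le> k + 1 \<Longrightarrow> weak_derivative D \<alpha> u (w \<alpha>)"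
    "\<And>\<alpha>. mi_order \<alpha> \<le> k + 1 \<Longrightarrow> AE x in lebesgue. x \<in> D \<longrightarrow> V \<alpha> x = w \<alpha> x"
    using sobolev_jet[OF open_D bounded_D u] by blast
  define c where "c = taylor_coeff V (k + 1)"
  let ?q = "taylor_polynomial c (k + 1)"
  let ?a = "\<lambda>\<alpha>. sqrt (LBINT x. (V \<alpha> x)\<^sup>2)"
  have a: "L2_norm_on D (weak_partial D \<alpha> u) = ?a \<alpha>" if "mi_order \<alpha> \<le> k + 1" for \<alpha>
    using weak_jetD[OF V(1) that] by (intro L2_norm_weak_partial[OF open_D V(2)[OF that] _ _ V(3)[OF that]]) auto
  have top: "Sobolev_seminorm (k + 1) D u = sqrt (\<Sum>\<alpha> | mi_order \<alpha> = k + 1. (?a \<alpha>)\<^sup>2)"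
    unfolding Sobolev_seminorm_def using a by simp
  show thesis
  proof (rule that[of ?q])
    show "polynomial_of_degree_le k ?q" by (rule polynomial_taylor_polynomial)
    fix l assume l: "l \<le> k"
    define m where "m = k + 1 - l"
    have m: "m > 0" "m + l = k + 1" using l by (auto simp: m_def)
    let ?B = "\<lambda>\<beta>. diameter D ^ m * sqrt C * (\<Sum>\<alpha> | mi_order \<alpha> = m. ?a (mi_add \<alpha> \<beta>) / mi_fact \<alpha>)"
    have part: "(L2_norm_on D (weak_partial D \<beta> (\<lambda>x. u x - ?q x)))\<^sup>2 \<le> (?B \<beta>)\<^sup>2" if \<beta>: "mi_order \<beta> = l" for \<beta>
    proof -
      let ?V = "\<lambda>\<alpha>. V (mi_add \<alpha> \<beta>)" and ?q' = "taylor_polynomial (\<lambda>\<gamma>. c (mi_add \<gamma> \<beta>)) m"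
      have \<beta>k: "mi_order \<beta> \<le> k + 1" using \<beta> l by simp
      have jet: "weak_jet D m ?V" using weak_jet_shift[OF V(1) \<beta>k] \<beta> by (simp add: m_def)
      have avg: "averaged_taylor ?V m x = ?q' x" for x
        unfolding averaged_taylor_eq[OF jet] taylor_polynomial_def c_def
        using taylor_coeff_shift[OF \<beta>k, of V] \<beta> by (simp add: m_def)
      have V0: "?V (\<lambda>_. 0) = V \<beta>" by (simp add: mi_add_def)
      let ?g = "\<lambda>x. indicator D x * (V \<beta> x - ?q' x)"
      have "L2_norm_on D (weak_partial D \<beta> (\<lambda>x. u x - ?q x)) = sqrt (LBINT x. (?g x)\<^sup>2)"
      proof (rule L2_norm_weak_partial[OF open_D])
        show "weak_derivative D \<beta> (\<lambda>x. u x - ?q x) (\<lambda>x. w \<beta> x - ?q' x)"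
          using weak_derivative_diff_taylor_polynomial[OF V(2)[OF \<beta>k] \<beta>k] \<beta> by (simp add: m_def)
        have [measurable]: "V \<beta> \<in> borel_measurable borel" using weak_jetD(1)[OF V(1) \<beta>k] by auto
        have [measurable]: "?q' \<in> borel_measurable borel"
          by (rule borel_measurable_continuous_onI[OF continuous_taylor_polynomial])
        show "?g \<in> borel_measurable borel" by measurable
        show "?g x = 0" if "x \<notin> D" for x using that by simp
        show "AE x in lebesgue. x \<in> D \<longrightarrow> ?g x = w \<beta> x - ?q' x"
          using V(3)[OF \<beta>k] by eventually_elim auto
      qed
      also have "(\<dots>)\<^sup>2 = (LBINT x. (?g x)\<^sup>2)" by simp
      also have "\<dots> \<le> (diameter D ^ m * sqrt C * taylor_weight m ?V)\<^sup>2"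
        using taylor_remainder_L2[OF jet m(1) C] unfolding avg V0 .
      finally show ?thesis by (simp only: taylor_weight_def)
    qed
    have "(\<Sum>\<beta> | mi_order \<beta> = l. (L2_norm_on D (weak_partial D \<beta> (\<lambda>x. u x - ?q x)))\<^sup>2) \<le>
        (\<Sum>\<beta> | mi_order \<beta> = l. (?B \<beta>)\<^sup>2)"
      using part by (intro sum_mono) auto
    also have "\<dots> = (diameter D ^ m * sqrt C)\<^sup>2 *
        (\<Sum>\<beta> | mi_order \<beta> = l. (\<Sum>\<alpha> | mi_order \<alpha> = m. ?a (mi_add \<alpha> \<beta>) / mi_fact \<alpha>)\<^sup>2)"
      unfolding power_mult_distrib[of "diameter D ^ m * sqrt C"] sum_distrib_left[symmetric] ..
    also have "\<dots> \<le> (diameter D ^ m * sqrt C)\<^sup>2 *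
        ((exp 1 ^ CARD('n))\<^sup>2 * (\<Sum>\<alpha> | mi_order \<alpha> = k + 1. (?a \<alpha>)\<^sup>2))"
      using sum_shifted_taylor_weights[of ?a m l] unfolding m(2) by (rule mult_left_mono) simp
    finally have "sqrt (\<Sum>\<beta> | mi_order \<beta> = l. (L2_norm_on D (weak_partial D \<beta> (\<lambda>x. u x - ?q x)))\<^sup>2) \<le>
        sqrt ((diameter D ^ m * sqrt C)\<^sup>2 * ((exp 1 ^ CARD('n))\<^sup>2 * (\<Sum>\<alpha> | mi_order \<alpha> = k + 1. (?a \<alpha>)\<^sup>2)))"
      by (rule real_sqrt_le_mono)
    also have "\<dots> = (diameter D ^ m * sqrt C) * (exp 1 ^ CARD('n) * Sobolev_seminorm (k + 1) D u)"
      unfolding top real_sqrt_mult real_sqrt_abs using C(1) diameter_ge_0[OF bounded_D] by simp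
    finally show "Sobolev_seminorm l D (\<lambda>x. u x - ?q x) \<le>
      sqrt C * exp 1 ^ CARD('n) * diameter D ^ (k + 1 - l) * Sobolev_seminorm (k + 1) D u"
      unfolding Sobolev_seminorm_def[of l] m_def[symmetric] by (simp only: mult_ac)
  qed
qed

section \<open>Star centres and the approximation theorem\<close>

text \<open>
  A point of the segment from \<open>(1 - t) p + t q\<close> to \<open>x\<close> also lies on a segment from \<open>p\<close> to a point of
  the segment from \<open>q\<close> to \<open>x\<close>.
\<close>

lemma convex_star_centres:
  assumes "open D"
  shows "convex (star_centres D)"
proof (rule convexI)
  have star: "p \<in> star_centres D \<longleftrightarrow> p \<in> D \<and> (\<forall>x\<in>D. closed_segment p x \<subseteq> D)" for p
    using assms by (auto simp: star_centres_def starlike_wrt_def interior_open)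
  fix p q and s t :: real
  assume p: "p \<in> star_centres D" and q: "q \<in> star_centres D" and st: "0 \<le> s" "0 \<le> t" "s + t = 1"
  let ?r = "s *\<^sub>R p + t *\<^sub>R q"
  have seg: "(1 - \<theta>) *\<^sub>R ?r + \<theta> *\<^sub>R x \<in> D" if x: "x \<in> D" and \<theta>: "0 \<le> \<theta>" "\<theta> \<le> 1" for x \<theta>
  proof (cases "(1 - \<theta>) * t + \<theta> = 0")
    case True
    moreover have "(1 - \<theta>) * t \<ge> 0" using \<theta> st by simp
    ultimately have "\<theta> = 0" using \<theta>(1) by linarith
    moreover with True have "t = 0" by simp
    ultimately show ?thesis using p st(3) by (simp add: star)
  next
    case False
    \<comment> \<open>The total weight of \<open>q\<close> and \<open>x\<close>; if it vanishes, the point is \<open>p\<close>.\<close>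
    let ?\<mu> = "(1 - \<theta>) * t + \<theta>"
    have nn: "(1 - \<theta>) * t \<ge> 0" "(1 - \<theta>) * s \<ge> 0" using \<theta> st by simp_all
    have \<mu>: "?\<mu> > 0" using False nn(1) \<theta>(1) by linarith
    have sum: "(1 - \<theta>) * s + ?\<mu> = 1" using st(3) by (simp add: algebra_simps flip: distrib_left)
    have "closed_segment q x \<subseteq> D" using q x by (simp add: star)
    moreover have "(1 - \<theta> / ?\<mu>) *\<^sub>R q + (\<theta> / ?\<mu>) *\<^sub>R x \<in> closed_segment q x"
      unfolding closed_segment_def using \<theta>(1) \<mu> nn(1) by (auto intro!: exI[of _ "\<theta> / ?\<mu>"])
    ultimately have y: "(1 - \<theta> / ?\<mu>) *\<^sub>R q + (\<theta> / ?\<mu>) *\<^sub>R x \<in> D" (is "?y \<in> D") by blast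
    have "?\<mu> *\<^sub>R ?y = (?\<mu> * (1 - \<theta> / ?\<mu>)) *\<^sub>R q + (?\<mu> * (\<theta> / ?\<mu>)) *\<^sub>R x"
      by (simp only: scaleR_add_right scaleR_scaleR)
    also have "?\<mu> * (1 - \<theta> / ?\<mu>) = (1 - \<theta>) * t" using \<mu> by (simp add: right_diff_distrib)
    also have "?\<mu> * (\<theta> / ?\<mu>) = \<theta>" using \<mu> by simp
    finally have \<mu>y: "?\<mu> *\<^sub>R ?y = ((1 - \<theta>) * t) *\<^sub>R q + \<theta> *\<^sub>R x" .
    have \<mu>s: "1 - ?\<mu> = (1 - \<theta>) * s" using sum by linarith
    have eq: "(1 - \<theta>) *\<^sub>R ?r + \<theta> *\<^sub>R x = (1 - ?\<mu>) *\<^sub>R p + ?\<mu> *\<^sub>R ?y"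
      by (subst \<mu>s, subst \<mu>y) (simp add: scaleR_add_right)
    have "closed_segment p ?y \<subseteq> D" using p y by (simp add: star)
    moreover have "(1 - ?\<mu>) *\<^sub>R p + ?\<mu> *\<^sub>R ?y \<in> closed_segment p ?y"
      unfolding closed_segment_def using \<mu> sum nn(2) by (intro CollectI exI[of _ ?\<mu>] conjI refl) linarith+
    ultimately show ?thesis unfolding eq by blast
  qed
  have "?r \<in> D" using seg[of p 0] p by (simp add: star)
  moreover have "closed_segment ?r x \<subseteq> D" if "x \<in> D" for x
    using seg[OF that] by (auto simp: closed_segment_def)
  ultimately show "?r \<in> star_centres D" by (simp add: star)
qed

text \<open>
  A convex set with empty interior is a null set.
\<close>

lemma star_centres_contain_box:
  fixes D :: "(real^'n::finite) set"
  assumes D: "open D" and pos: "emeasure lebesgue (star_centres D) > 0"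
  obtains a b where "\<And>i. a $ i < b $ i" "cbox a b \<subseteq> star_centres D"
proof -
  have "\<not> negligible (star_centres D)"
    using pos by (auto simp: negligible_iff_null_sets null_sets_def)
  then have "interior (star_centres D) \<noteq> {}"
    using negligible_convex_interior[OF convex_star_centres[OF D]] by simp
  then obtain p where p: "p \<in> interior (star_centres D)" by blast
  obtain a b where ab: "cbox a b \<subseteq> interior (star_centres D)" "p \<in> box a b"
    using open_contains_cbox[OF open_interior p] by metis
  have "a $ i < b $ i" for i using ab(2) by (auto simp: mem_box_cart dest!: spec[of _ i])
  then show thesis using ab(1) interior_subset that by blast
qed

theorem theorem1:
  fixes D :: "(real^'n::finite) set" and \<sigma> :: real
  assumes "lipschitz_domain D"
    and "\<exists>p. starlike_wrt D p"
    and "shape_regular \<sigma> D"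
    and A1: "emeasure lebesgue (star_centres D) > 0"
    and A2: "\<exists>c\<^sub>0>0. \<exists>p\<in>star_centres D. AE_boundary D
               (\<lambda>x. \<exists>\<nu>. outward_unit_normal D x \<nu> \<and> (x - p) \<bullet> \<nu> \<ge> c\<^sub>0 * diameter D)"
  shows "\<exists>c>0. \<forall>(k::nat) (u :: real^'n \<Rightarrow> real). in_Sobolev (k + 1) D u \<longrightarrow>
           (\<exists>q. polynomial_of_degree_le k q \<and>
             (\<forall>l\<le>k. Sobolev_seminorm l D (\<lambda>x. u x - q x)
                \<le> c * (real k + 1) * diameter D ^ (k + 1 - l) * Sobolev_seminorm (k + 1) D u))"
proof -
  have D: "open D" "bounded D" using assms(1) by (auto simp: lipschitz_domain_def)
  obtain a b where ab: "\<And>i. a $ i < b $ i" "cbox a b \<subseteq> star_centres D"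
    using star_centres_contain_box[OF D(1) A1] by metis
  obtain \<psi> where "star_kernel D a b \<psi>"
  proof (rule exists_star_kernel[OF D ab(1)])
    show "closed_segment x y \<subseteq> D" if "x \<in> D" "y \<in> cbox a b" for x y
      using that ab(2) by (auto simp: star_centres_def starlike_wrt_def closed_segment_commute[of x y])
  qed auto
  then interpret star_kernel D a b \<psi> .
  obtain C where C: "C \<ge> 0" "\<And>s z. 0 < s \<Longrightarrow> s < 1 \<Longrightarrow> (\<integral>\<^sup>+x. K0 s x z * indicator D x \<partial>lborel) \<le> ennreal C"
    using K0_nn_integral_fst by blast
  \<comment> \<open>The summand 1 makes \<open>c\<close> positive.\<close>
  define c where "c = sqrt C * exp 1 ^ CARD('n) + 1"
  have c0: "sqrt C * exp 1 ^ CARD('n) \<ge> 0" using C(1) by simp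
  show ?thesis
  proof (intro exI[of _ c] conjI allI impI)
    show "c > 0" using c0 by (simp add: c_def)
    fix k :: nat and u :: "real^'n \<Rightarrow> real"
    assume u: "in_Sobolev (k + 1) D u"
    obtain q where q: "polynomial_of_degree_le k q"
      "\<And>l. l \<le> k \<Longrightarrow> Sobolev_seminorm l D (\<lambda>x. u x - q x) \<le>
        sqrt C * exp 1 ^ CARD('n) * diameter D ^ (k + 1 - l) * Sobolev_seminorm (k + 1) D u"
      using sobolev_polynomial_approximation[OF C u] by blast
    show "\<exists>q. polynomial_of_degree_le k q \<and>
      (\<forall>l\<le>k. Sobolev_seminorm l D (\<lambda>x. u x - q x)
         \<le> c * (real k + 1) * diameter D ^ (k + 1 - l) * Sobolev_seminorm (k + 1) D u)"
    proof (intro exI[of _ q] conjI allI impI q(1))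
      fix l assume "l \<le> k"
      have "sqrt C * exp 1 ^ CARD('n) \<le> c * 1" by (simp add: c_def)
      also have "\<dots> \<le> c * (real k + 1)" using c0 by (intro mult_left_mono) (auto simp: c_def)
      finally have "sqrt C * exp 1 ^ CARD('n) \<le> c * (real k + 1)" .
      moreover have "diameter D ^ (k + 1 - l) \<ge> 0" using diameter_ge_0[OF bounded_D] by simp
      moreover have "Sobolev_seminorm (k + 1) D u \<ge> 0"
        unfolding Sobolev_seminorm_def by (intro real_sqrt_ge_zero sum_nonneg) auto
      ultimately have "sqrt C * exp 1 ^ CARD('n) * diameter D ^ (k + 1 - l) * Sobolev_seminorm (k + 1) D u \<le>
          c * (real k + 1) * diameter D ^ (k + 1 - l) * Sobolev_seminorm (k + 1) D u"
        by (intro mult_right_mono)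
      with q(2)[OF \<open>l \<le> k\<close>] show "Sobolev_seminorm l D (\<lambda>x. u x - q x)
         \<le> c * (real k + 1) * diameter D ^ (k + 1 - l) * Sobolev_seminorm (k + 1) D u" by linarith
    qed
  qed
qed

end
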